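(* Let $A$ be a graded $K$-algebra of finite complexity $c=c(A)$. Let $D$ be a central extension of $A$ by the variable $z$ (that is, the central extension associated to some deformation of $A$). Then $z$ is regular in $D$ if and only if $z$ is not a zero divisor on $D_{\le c}$.
   Context: $K$ is a field and $T=K\langle x_1,\ldots,x_n\rangle$ is the free algebra with its standard grading ($\deg x_i=1$). A graded $K$-algebra is $A=T/\langle r_1,\ldots,r_m\rangle$, where $r_1,\ldots,r_m$ are homogeneous elements of $T$ of degree at least $2$ (no linear relations) forming a minimal set of relations for $A$; $A$ inherits the grading of $T$ and $K=A/A_+$ is the trivial module. A deformation of $A$ is an algebra $U=T/\langle r_1+l_1,\ldots,r_m+l_m\rangle$ where $l_1,\ldots,l_m\in T$ are (not necessarily homogeneous) elements with $\deg(l_i)<\deg(r_i)$ for all $i$. Let $T[z]=T\otimes_K K[z]$, graded with $\deg z=1$. For $f=\sum_{i=0}^p f_i\in T$ with $f_i\in T_i$, $f_p\neq 0$, put $h(f)=\sum_{i=0}^p z^{p-i}f_i\in T[z]$. The central extension of $A$ associated to the deformation $U$ is the graded algebra $D=T[z]/\langle h(r_1+l_1),\ldots,h(r_m+l_m)\rangle$, in which $z\in D_1$ is central and $D/Dz=A$. The element $z$ is regular in $D$ if it is not a zero divisor in $D$; $z$ is not a zero divisor on $D_{\le c}$ means that no nonzero $x\in D_k$ with $k\le c$ satisfies $zx=0$. The complexity of $A$ is $c(A)=\sup\{n \mid \mathrm{Ext}_A^{3,n}(K,K)\neq 0\}-1$ if the global dimension of $A$ is at least $3$ (here the second superscript is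 the internal degree, so that $\mathrm{Ext}_A^{3,n}(K,K)\ne 0$ exactly when the third term of the minimal graded free resolution of $K$ has a generator in degree $n$), and $c(A)=0$ if the global dimension of $A$ is less than $3$. *)

theory Defs
  imports
    "HOL-Algebra.Algebraic_Closure_Type"
    "HOL-Algebra.QuotRing"
    "HOL-Algebra.Module"
    "HOL-Library.Poly_Mapping"
    "HOL-Library.Extended_Nat"
begin

section \<open>The free algebra and its polynomial extension\<close>

text \<open>
  Lists under concatenation are the free monoid, so \<open>'x list \<Rightarrow>\<^sub>0 'k\<close> with the convolution
  product of \<^theory>\<open>HOL-Library.Poly_Mapping\<close> is the free algebra over \<open>'k\<close> on the variables \<open>'x\<close>.
\<close>

instantiation list :: (type) monoid_add
begin
definition zero_list :: "'a list" where "zero_list = []"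
definition plus_list :: "'a list \<Rightarrow> 'a list \<Rightarrow> 'a list" where "plus_list = (@)"
instance by standard (simp_all add: zero_list_def plus_list_def)
end

type_synonym ('x, 'k) free_algebra = "'x list \<Rightarrow>\<^sub>0 'k"

text \<open>
  \<open>T[z]\<close> is the monoid algebra of \<open>\<nat>\<close> (the powers of \<open>z\<close>) with coefficients in \<open>T\<close>;
  the type \<open>poly\<close> is not available over a noncommutative ring.
\<close>

type_synonym ('x, 'k) free_algebra_z = "nat \<Rightarrow>\<^sub>0 ('x list \<Rightarrow>\<^sub>0 'k)"

definition free_comp :: "nat \<Rightarrow> ('x, 'k::field) free_algebra set" where
  "free_comp d = {f. \<forall>w \<in> Poly_Mapping.keys f. length w = d}"

definition free_z_comp :: "nat \<Rightarrow> ('x, 'k::field) free_algebra_z set" where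
  "free_z_comp d =
    {F. \<forall>i \<in> Poly_Mapping.keys F. \<forall>w \<in> Poly_Mapping.keys (Poly_Mapping.lookup F i). i + length w = d}"

text \<open>The degree of \<open>0\<close> is set to \<open>0\<close>.\<close>

definition free_deg :: "('x, 'k::field) free_algebra \<Rightarrow> nat" where
  "free_deg f = Max (insert 0 (length ` Poly_Mapping.keys f))"

definition hom_part :: "nat \<Rightarrow> ('x, 'k::field) free_algebra \<Rightarrow> ('x, 'k) free_algebra" where
  "hom_part i f =
    (\<Sum>w | w \<in> Poly_Mapping.keys f \<and> length w = i. Poly_Mapping.single w (Poly_Mapping.lookup f w))"

text \<open>\<open>Poly_Mapping.single j g\<close> is \<open>z\<^sup>j g\<close>.\<close>

definition homogenize :: "('x, 'k::field) free_algebra \<Rightarrow> ('x, 'k) free_algebra_z" where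
  "homogenize f = (\<Sum>i\<le>free_deg f. Poly_Mapping.single (free_deg f - i) (hom_part i f))"

definition z_var :: "('x, 'k::field) free_algebra_z" where
  "z_var = Poly_Mapping.single 1 1"


section \<open>Modules over a noncommutative ring\<close>

text \<open>
  \<open>HOL-Algebra.Module\<close> requires a commutative ring of scalars, so only its record is reused.
  The ring multiplication and unit fields of that record carry no meaning here.
\<close>

locale left_module = R?: ring R + M?: abelian_group M
  for R :: "('a, 'r) ring_scheme" (structure) and M :: "('a, 'b, 'c) module_scheme" (structure) +
  assumes smult_closed:
      "\<lbrakk>a \<in> carrier R; x \<in> carrier M\<rbrakk> \<Longrightarrow> a \<odot>\<^bsub>M\<^esub> x \<in> carrier M"
    and smult_l_distr:
      "\<lbrakk>a \<in> carrier R; b \<in> carrier R; x \<in> carrier M\<rbrakk> \<Longrightarrow>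
        (a \<oplus>\<^bsub>R\<^esub> b) \<odot>\<^bsub>M\<^esub> x = a \<odot>\<^bsub>M\<^esub> x \<oplus>\<^bsub>M\<^esub> b \<odot>\<^bsub>M\<^esub> x"
    and smult_r_distr:
      "\<lbrakk>a \<in> carrier R; x \<in> carrier M; y \<in> carrier M\<rbrakk> \<Longrightarrow>
        a \<odot>\<^bsub>M\<^esub> (x \<oplus>\<^bsub>M\<^esub> y) = a \<odot>\<^bsub>M\<^esub> x \<oplus>\<^bsub>M\<^esub> a \<odot>\<^bsub>M\<^esub> y"
    and smult_assoc1:
      "\<lbrakk>a \<in> carrier R; b \<in> carrier R; x \<in> carrier M\<rbrakk> \<Longrightarrow>
        (a \<otimes>\<^bsub>R\<^esub> b) \<odot>\<^bsub>M\<^esub> x = a \<odot>\<^bsub>M\<^esub> (b \<odot>\<^bsub>M\<^esub> x)"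
    and smult_one:
      "x \<in> carrier M \<Longrightarrow> \<one>\<^bsub>R\<^esub> \<odot>\<^bsub>M\<^esub> x = x"

definition left_module_hom ::
    "('a, 'r) ring_scheme \<Rightarrow> ('a, 'b, 'c) module_scheme \<Rightarrow> ('a, 'd, 'e) module_scheme \<Rightarrow> ('b \<Rightarrow> 'd) set" where
  "left_module_hom R M N = {f \<in> carrier M \<rightarrow> carrier N.
      (\<forall>x \<in> carrier M. \<forall>y \<in> carrier M. f (x \<oplus>\<^bsub>M\<^esub> y) = f x \<oplus>\<^bsub>N\<^esub> f y) \<and>
      (\<forall>a \<in> carrier R. \<forall>x \<in> carrier M. f (a \<odot>\<^bsub>M\<^esub> x) = a \<odot>\<^bsub>N\<^esub> f x)}"

text \<open>The free left module on a set \<open>J\<close>: finitely supported families indexed by \<open>J\<close>.\<close>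

definition free_module :: "('a, 'r) ring_scheme \<Rightarrow> 'j set \<Rightarrow> ('a, 'j \<Rightarrow> 'a) module" where
  "free_module R J = \<lparr>
      carrier = {f. finite {j. f j \<noteq> \<zero>\<^bsub>R\<^esub>} \<and> (\<forall>j \<in> J. f j \<in> carrier R) \<and> (\<forall>j. j \<notin> J \<longrightarrow> f j = \<zero>\<^bsub>R\<^esub>)},
      monoid.mult = undefined, one = undefined,
      ring.zero = (\<lambda>j. \<zero>\<^bsub>R\<^esub>), add = (\<lambda>f g j. f j \<oplus>\<^bsub>R\<^esub> g j),
      module.smult = (\<lambda>a f j. a \<otimes>\<^bsub>R\<^esub> f j)\<rparr>"

text \<open>
  Projective means direct summand of a free module. Taking the basis inside the carrier type of the
  module is no restriction: a summand of some free module is one of the free module on its elements.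
\<close>

definition projective_module :: "('a, 'r) ring_scheme \<Rightarrow> ('a, 'p, 'c) module_scheme \<Rightarrow> bool" where
  "projective_module R P \<longleftrightarrow> left_module R P \<and>
    (\<exists>(J :: 'p set) s p. s \<in> left_module_hom R P (free_module R J) \<and>
       p \<in> left_module_hom R (free_module R J) P \<and> (\<forall>x \<in> carrier P. p (s x) = x))"

text \<open>Exactness of \<open>\<dots> \<rightarrow> P 2 \<rightarrow> P 1 \<rightarrow> P 0 \<rightarrow> M \<rightarrow> 0\<close>, where \<open>d i\<close> maps \<open>P (i + 1)\<close> to \<open>P i\<close>.\<close>

definition is_resolution ::
    "('a, 'r) ring_scheme \<Rightarrow> (nat \<Rightarrow> ('a, 'p) module) \<Rightarrow> (nat \<Rightarrow> 'p \<Rightarrow> 'p) \<Rightarrow> ('p \<Rightarrow> 'm) \<Rightarrow>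
     ('a, 'm, 'c) module_scheme \<Rightarrow> bool" where
  "is_resolution R P d e M \<longleftrightarrow>
    (\<forall>i. left_module R (P i)) \<and> left_module R M \<and>
    (\<forall>i. d i \<in> left_module_hom R (P (Suc i)) (P i)) \<and>
    e \<in> left_module_hom R (P 0) M \<and>
    e ` carrier (P 0) = carrier M \<and>
    d 0 ` carrier (P 1) = {x \<in> carrier (P 0). e x = \<zero>\<^bsub>M\<^esub>} \<and>
    (\<forall>i. d (Suc i) ` carrier (P (Suc (Suc i))) = {x \<in> carrier (P (Suc i)). d i x = \<zero>\<^bsub>P i\<^esub>})"

text \<open>
  The supremum over all modules in the definition of global dimension needs a fixed carrier type.
  We take the underlying type \<open>nat \<times> 'a \<Rightarrow> 'a\<close> of the free module on \<open>nat \<times> 'a\<close>. It contains a copy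
  of every module of cardinality at most \<open>max |R| \<aleph>\<^sub>0\<close>, in particular of every cyclic module, and
  these suffice by Auslander's theorem. For \<open>R\<close> nonzero the type is infinite and at least as large as \<open>R\<close>, so every
  module living in it also has a free resolution living in it and all syzygies do, so restricting the
  modules in a projective resolution to this type does not change projective dimensions.
\<close>

definition has_projective_resolution ::
    "('a, 'r) ring_scheme \<Rightarrow> ('a, nat \<times> 'a \<Rightarrow> 'a) module \<Rightarrow> nat \<Rightarrow> bool" where
  "has_projective_resolution R M n \<longleftrightarrow>
    (\<exists>(P :: nat \<Rightarrow> ('a, nat \<times> 'a \<Rightarrow> 'a) module) d e.
       is_resolution R P d e M \<and> (\<forall>i. projective_module R (P i)) \<and>
       (\<forall>i > n. carrier (P i) = {\<zero>\<^bsub>P i\<^esub>}))"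

definition proj_dim :: "('a, 'r) ring_scheme \<Rightarrow> ('a, nat \<times> 'a \<Rightarrow> 'a) module \<Rightarrow> enat" where
  "proj_dim R M = (INF n \<in> {n. has_projective_resolution R M n}. enat n)"

definition global_dim :: "('a, 'r) ring_scheme \<Rightarrow> enat" where
  "global_dim R = (SUP M \<in> {M. left_module R M}. proj_dim R M)"


section \<open>Graded modules, Ext and complexity\<close>

text \<open>
  A grading of a ring or module is given by the family \<open>G :: nat \<Rightarrow> _ set\<close> of its components.
\<close>

definition quot_comp :: "('a, 'r) ring_scheme \<Rightarrow> 'a set \<Rightarrow> (nat \<Rightarrow> 'a set) \<Rightarrow> nat \<Rightarrow> 'a set set" where
  "quot_comp R I G d = (\<lambda>t. I +>\<^bsub>R\<^esub> t) ` G d"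

definition augmentation_ideal :: "('a, 'r) ring_scheme \<Rightarrow> (nat \<Rightarrow> 'a set) \<Rightarrow> 'a set" where
  "augmentation_ideal R G = Idl\<^bsub>R\<^esub> (\<Union>d \<in> {1..}. G d)"

definition trivial_module :: "('a, 'r) ring_scheme \<Rightarrow> (nat \<Rightarrow> 'a set) \<Rightarrow> ('a, 'a set) module" where
  "trivial_module R G =
    (let I = augmentation_ideal R G in
     ring.extend (R Quot I) (module.fields (\<lambda>a x. (I +>\<^bsub>R\<^esub> a) \<otimes>\<^bsub>R Quot I\<^esub> x)))"

definition trivial_comp :: "('a, 'r) ring_scheme \<Rightarrow> (nat \<Rightarrow> 'a set) \<Rightarrow> nat \<Rightarrow> 'a set set" where
  "trivial_comp R G = quot_comp R (augmentation_ideal R G) G"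

text \<open>The grading of the free module on \<open>J\<close> in which the basis element \<open>j\<close> has degree \<open>\<delta> j\<close>.\<close>

definition free_module_comp ::
    "('a, 'r) ring_scheme \<Rightarrow> (nat \<Rightarrow> 'a set) \<Rightarrow> 'j set \<Rightarrow> ('j \<Rightarrow> nat) \<Rightarrow> nat \<Rightarrow> ('j \<Rightarrow> 'a) set" where
  "free_module_comp R G J \<delta> n = {f \<in> carrier (free_module R J).
     \<forall>j \<in> J. if \<delta> j \<le> n then f j \<in> G (n - \<delta> j) else f j = \<zero>\<^bsub>R\<^esub>}"

text \<open>Homomorphisms lowering the degree by \<open>n\<close>, i.e. degree-preserving ones into the shift \<open>N(-n)\<close>.\<close>

definition graded_hom ::
    "('a, 'r) ring_scheme \<Rightarrow> ('a, 'b, 'c) module_scheme \<Rightarrow> (nat \<Rightarrow> 'b set) \<Rightarrow>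
     ('a, 'd, 'e) module_scheme \<Rightarrow> (nat \<Rightarrow> 'd set) \<Rightarrow> nat \<Rightarrow> ('b \<Rightarrow> 'd) set" where
  "graded_hom R M GM N GN n = {f \<in> left_module_hom R M N.
     \<forall>k. f ` GM k \<subseteq> (if n \<le> k then GN (k - n) else {\<zero>\<^bsub>N\<^esub>})}"

definition graded_free_resolution ::
    "('a, 'r) ring_scheme \<Rightarrow> (nat \<Rightarrow> 'a set) \<Rightarrow>
     (nat \<Rightarrow> 'j set) \<Rightarrow> (nat \<Rightarrow> 'j \<Rightarrow> nat) \<Rightarrow> (nat \<Rightarrow> ('j \<Rightarrow> 'a) \<Rightarrow> ('j \<Rightarrow> 'a)) \<Rightarrow> (('j \<Rightarrow> 'a) \<Rightarrow> 'm) \<Rightarrow>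
     ('a, 'm, 'c) module_scheme \<Rightarrow> (nat \<Rightarrow> 'm set) \<Rightarrow> bool" where
  "graded_free_resolution R G J \<delta> d e M GM \<longleftrightarrow>
     is_resolution R (\<lambda>i. free_module R (J i)) d e M \<and>
     (\<forall>i. d i \<in> graded_hom R
        (free_module R (J (Suc i))) (free_module_comp R G (J (Suc i)) (\<delta> (Suc i)))
        (free_module R (J i)) (free_module_comp R G (J i) (\<delta> i)) 0) \<and>
     e \<in> graded_hom R (free_module R (J 0)) (free_module_comp R G (J 0) (\<delta> 0)) M GM 0"

text \<open>
  \<open>ext_cochains\<close>, \<open>ext_cocycles\<close> and \<open>ext_coboundaries\<close> describe the part of internal degree \<open>n\<close> of the
  complex \<open>Hom\<^sub>R(P, K)\<close>, where \<open>P\<close> is the free resolution with bases \<open>J\<close>, degrees \<open>\<delta>\<close> and differential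
  \<open>d\<close>, and \<open>K\<close> is the trivial module. Only the values of a cochain on the carrier of \<open>P i\<close> matter.
\<close>

definition ext_cochains ::
    "('a, 'r) ring_scheme \<Rightarrow> (nat \<Rightarrow> 'a set) \<Rightarrow> (nat \<Rightarrow> 'j set) \<Rightarrow> (nat \<Rightarrow> 'j \<Rightarrow> nat) \<Rightarrow>
     nat \<Rightarrow> nat \<Rightarrow> (('j \<Rightarrow> 'a) \<Rightarrow> 'a set) set" where
  "ext_cochains R G J \<delta> i n = graded_hom R
     (free_module R (J i)) (free_module_comp R G (J i) (\<delta> i)) (trivial_module R G) (trivial_comp R G) n"

definition ext_cocycles ::
    "('a, 'r) ring_scheme \<Rightarrow> (nat \<Rightarrow> 'a set) \<Rightarrow> (nat \<Rightarrow> 'j set) \<Rightarrow> (nat \<Rightarrow> 'j \<Rightarrow> nat) \<Rightarrow>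
     (nat \<Rightarrow> ('j \<Rightarrow> 'a) \<Rightarrow> ('j \<Rightarrow> 'a)) \<Rightarrow> nat \<Rightarrow> nat \<Rightarrow> (('j \<Rightarrow> 'a) \<Rightarrow> 'a set) set" where
  "ext_cocycles R G J \<delta> d i n = {\<phi> \<in> ext_cochains R G J \<delta> i n.
     \<forall>x \<in> carrier (free_module R (J (Suc i))). \<phi> (d i x) = \<zero>\<^bsub>trivial_module R G\<^esub>}"

definition ext_coboundaries ::
    "('a, 'r) ring_scheme \<Rightarrow> (nat \<Rightarrow> 'a set) \<Rightarrow> (nat \<Rightarrow> 'j set) \<Rightarrow> (nat \<Rightarrow> 'j \<Rightarrow> nat) \<Rightarrow>
     (nat \<Rightarrow> ('j \<Rightarrow> 'a) \<Rightarrow> ('j \<Rightarrow> 'a)) \<Rightarrow> nat \<Rightarrow> nat \<Rightarrow> (('j \<Rightarrow> 'a) \<Rightarrow> 'a set) set" where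
  "ext_coboundaries R G J \<delta> d i n = {\<phi> \<in> ext_cochains R G J \<delta> i n.
     case i of
       0 \<Rightarrow> \<forall>x \<in> carrier (free_module R (J 0)). \<phi> x = \<zero>\<^bsub>trivial_module R G\<^esub>
     | Suc k \<Rightarrow> \<exists>\<psi> \<in> ext_cochains R G J \<delta> k n. \<forall>x \<in> carrier (free_module R (J i)). \<phi> x = \<psi> (d k x)}"

text \<open>
  \<open>Ext\<^bsup>i,n\<^esup>\<^sub>R(K, K) \<noteq> 0\<close>. The cohomology does not depend on the graded free resolution of \<open>K\<close>.
  Bases in \<open>nat\<close> suffice when \<open>R\<close> is a finitely generated connected graded algebra over a field: in its
  minimal resolution every module has finitely many basis elements in each degree.
\<close>

definition ext_nonzero :: "('a, 'r) ring_scheme \<Rightarrow> (nat \<Rightarrow> 'a set) \<Rightarrow> nat \<Rightarrow> nat \<Rightarrow> bool" where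
  "ext_nonzero R G i n \<longleftrightarrow>
    (\<exists>(J :: nat \<Rightarrow> nat set) \<delta> d e.
       graded_free_resolution R G J \<delta> d e (trivial_module R G) (trivial_comp R G) \<and>
       \<not> ext_cocycles R G J \<delta> d i n \<subseteq> ext_coboundaries R G J \<delta> d i n)"

definition complexity :: "('a, 'r) ring_scheme \<Rightarrow> (nat \<Rightarrow> 'a set) \<Rightarrow> enat" where
  "complexity R G =
    (if global_dim R \<ge> 3 then (SUP n \<in> {n. ext_nonzero R G 3 n}. enat n) - 1 else 0)"


section \<open>Graded algebras and their central extensions\<close>

text \<open>Families \<open>r 0, \<dots>, r (m - 1)\<close> of relations are functions on \<open>nat\<close> of which only that part is used.\<close>

definition minimal_relations :: "nat \<Rightarrow> (nat \<Rightarrow> ('x, 'k::field) free_algebra) \<Rightarrow> bool" where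
  "minimal_relations m r \<longleftrightarrow>
    (\<forall>S. S \<subset> {..<m} \<longrightarrow>
       Idl\<^bsub>ring_of_type_algebra\<^esub> (r ` S) \<noteq> Idl\<^bsub>ring_of_type_algebra\<^esub> (r ` {..<m}))"

definition rel_ideal :: "nat \<Rightarrow> (nat \<Rightarrow> ('x, 'k::field) free_algebra) \<Rightarrow> ('x, 'k) free_algebra set" where
  "rel_ideal m r = Idl\<^bsub>ring_of_type_algebra\<^esub> (r ` {..<m})"

definition quot_algebra ::
    "nat \<Rightarrow> (nat \<Rightarrow> ('x, 'k::field) free_algebra) \<Rightarrow> ('x, 'k) free_algebra set ring" where
  "quot_algebra m r = ring_of_type_algebra Quot rel_ideal m r"

definition quot_algebra_comp ::
    "nat \<Rightarrow> (nat \<Rightarrow> ('x, 'k::field) free_algebra) \<Rightarrow> nat \<Rightarrow> ('x, 'k) free_algebra set set" where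
  "quot_algebra_comp m r = quot_comp ring_of_type_algebra (rel_ideal m r) free_comp"

definition ext_ideal ::
    "nat \<Rightarrow> (nat \<Rightarrow> ('x, 'k::field) free_algebra) \<Rightarrow> (nat \<Rightarrow> ('x, 'k) free_algebra) \<Rightarrow>
     ('x, 'k) free_algebra_z set" where
  "ext_ideal m r l = Idl\<^bsub>ring_of_type_algebra\<^esub> ((\<lambda>i. homogenize (r i + l i)) ` {..<m})"

definition central_ext ::
    "nat \<Rightarrow> (nat \<Rightarrow> ('x, 'k::field) free_algebra) \<Rightarrow> (nat \<Rightarrow> ('x, 'k) free_algebra) \<Rightarrow>
     ('x, 'k) free_algebra_z set ring" where
  "central_ext m r l = ring_of_type_algebra Quot ext_ideal m r l"

definition central_ext_comp ::
    "nat \<Rightarrow> (nat \<Rightarrow> ('x, 'k::field) free_algebra) \<Rightarrow> (nat \<Rightarrow> ('x, 'k) free_algebra) \<Rightarrow>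
     nat \<Rightarrow> ('x, 'k) free_algebra_z set set" where
  "central_ext_comp m r l = quot_comp ring_of_type_algebra (ext_ideal m r l) free_z_comp"

definition central_ext_z ::
    "nat \<Rightarrow> (nat \<Rightarrow> ('x, 'k::field) free_algebra) \<Rightarrow> (nat \<Rightarrow> ('x, 'k) free_algebra) \<Rightarrow>
     ('x, 'k) free_algebra_z set" where
  "central_ext_z m r l = ext_ideal m r l +>\<^bsub>ring_of_type_algebra\<^esub> z_var"

definition regular_element :: "('a, 'r) ring_scheme \<Rightarrow> 'a \<Rightarrow> bool" where
  "regular_element R a \<longleftrightarrow> a \<in> carrier R \<and>
    (\<forall>x \<in> carrier R. a \<otimes>\<^bsub>R\<^esub> x = \<zero>\<^bsub>R\<^esub> \<or> x \<otimes>\<^bsub>R\<^esub> a = \<zero>\<^bsub>R\<^esub> \<longrightarrow> x = \<zero>\<^bsub>R\<^esub>)"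

definition not_zero_divisor_upto :: "('a, 'r) ring_scheme \<Rightarrow> (nat \<Rightarrow> 'a set) \<Rightarrow> nat \<Rightarrow> 'a \<Rightarrow> bool" where
  "not_zero_divisor_upto R G c a \<longleftrightarrow>
    \<not> (\<exists>k \<le> c. \<exists>x \<in> G k. x \<noteq> \<zero>\<^bsub>R\<^esub> \<and> a \<otimes>\<^bsub>R\<^esub> x = \<zero>\<^bsub>R\<^esub>)"

end

theory Submission
  imports Defs
begin

text \<open>
  Write \<open>T\<close> for the free algebra, \<open>d\<^sub>i \<ge> 2\<close> for the degree of \<open>r\<^sub>i\<close>, \<open>p\<^sub>i = r\<^sub>i + l\<^sub>i\<close> for the deformed
  relations, and \<open>I\<close> for the ideal defining \<open>A\<close>. Setting \<open>z = 1\<close> turns the degree \<open>n\<close> part of \<open>T[z]\<close>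
  into the polynomials of degree at most \<open>n\<close>, and the degree \<open>n\<close> part of the ideal defining \<open>D\<close> into
  the span \<open>V\<^sub>n\<close> of all products \<open>u p\<^sub>i v\<close> with \<open>deg u + d\<^sub>i + deg v \<le> n\<close> (lemma \<open>H_iff\<close>). Multiplication
  by \<open>z\<close> becomes an inclusion, so \<open>z\<close> is injective on \<open>D\<^sub>k\<close> exactly if \<open>V\<^sub>k\<^sub>+\<^sub>1\<close> contains no elements
  of degree at most \<open>k\<close> besides those of \<open>V\<^sub>k\<close>. This condition is called \<open>reg k\<close>.

  Assume \<open>reg\<close> below \<open>k\<close>, and take \<open>q \<in> V\<^sub>k\<^sub>+\<^sub>1\<close> whose part of degree \<open>k + 1\<close> vanishes. Modulo \<open>V\<^sub>k\<close>,
  \<open>q\<close> is \<open>\<Sum> t\<^sub>i p\<^sub>i + \<Sum> q\<^sub>x x\<close> with homogeneous \<open>t\<^sub>i\<close> and \<open>q\<^sub>x \<in> V\<^sub>k\<close>. Cancelling the variable \<open>x\<close> on the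
  right in the part of degree \<open>k + 1\<close> shows that \<open>\<Sum> t\<^sub>i (r\<^sub>i / x)\<close> lies in \<open>I\<close> for every \<open>x\<close>. Such
  tuples \<open>t\<close> are the syzygies: modulo \<open>I\<close> they form the kernel \<open>\<Omega>\<close> of the map from \<open>A\<^sup>m\<close> to the free module
  on the variables in the minimal resolution of \<open>K\<close>; minimal generators of \<open>\<Omega>\<close> are the basis of the next term. If \<open>t\<close> is
  decomposable, that is a combination of syzygies with coefficients in \<open>T\<^sub>+\<close> up to tuples over \<open>I\<close>,
  then \<open>\<Sum> t\<^sub>i p\<^sub>i\<close> can be rewritten modulo \<open>V\<^sub>k\<close> as a sum \<open>\<Sum> q'\<^sub>x x\<close>: for the syzygies of smaller degree
  this uses the induction hypothesis, and for tuples over \<open>I\<close> the identity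
  \<open>(u r\<^sub>j v) p\<^sub>i \<equiv> u p\<^sub>j v p\<^sub>i \<equiv> u p\<^sub>j v r\<^sub>i\<close>. Afterwards \<open>q\<close> is \<open>\<Sum> (q\<^sub>x - q'\<^sub>x) x\<close> modulo \<open>V\<^sub>k\<close>, whose
  coefficients have degree below \<open>k\<close>, and the induction hypothesis places them in \<open>V\<^sub>k\<^sub>-\<^sub>1\<close>. So \<open>reg\<close> passes
  from degrees at most \<open>c\<close> to all degrees as soon as all homogeneous syzygies of degree above
  \<open>c + 1\<close> are decomposable (theorem \<open>reg_all\<close>).

  It remains to read this off from \<open>c = c(A)\<close>. A homogeneous indecomposable syzygy of degree \<open>n\<close> is
  separated from the decomposable ones by a linear functional, which induces a cocycle on a
  resolution that begins with the minimal one; minimality makes all coboundaries vanish, so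
  \<open>Ext\<^sup>3\<^sup>,\<^sup>n\<close> is nonzero (theorem \<open>ext_nonzero_of_indecomposable\<close>). This bounds \<open>n\<close> by \<open>c + 1\<close> if the global
  dimension is at least 3. If it is smaller, \<open>K\<close> has a projective resolution of length at most 2.
  Comparing it with the minimal resolution splits \<open>\<Omega>\<close> off from \<open>A\<^sup>m\<close>; since \<open>\<Omega> \<subseteq> A\<^sub>+ A\<^sup>m\<close>, this gives
  \<open>\<Omega> = A\<^sub>+ \<Omega>\<close>, hence \<open>\<Omega> = 0\<close> for degree reasons (lemmas \<open>syzygy_retraction\<close> and
  \<open>syz_trivial_of_retraction\<close>).

  Modules over \<open>A\<close> are handled through tuples over \<open>T\<close>: maps between free modules over \<open>A\<close> are
  induced by \<open>T\<close>-linear maps of tuples, and exactness becomes a statement modulo tuples over \<open>I\<close>.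
\<close>

abbreviation (input) "lookup \<equiv> Poly_Mapping.lookup"
abbreviation (input) "keys \<equiv> Poly_Mapping.keys"
abbreviation (input) "single \<equiv> Poly_Mapping.single"

section \<open>Homogeneous parts and right division in the free algebra\<close>

text \<open>
  Bilinear identities such as product formulas are reduced to monomials by this rule, because the
  convolution sum of the product is awkward to manipulate directly.
\<close>

lemma poly_mapping_additive_induct [case_names zero single add]:
  fixes f :: "'a \<Rightarrow>\<^sub>0 'b::comm_monoid_add"
  assumes "P 0" and "\<And>k c. P (single k c)" and "\<And>f g. P f \<Longrightarrow> P g \<Longrightarrow> P (f + g)"
  shows "P f"
proof -
  have "f = (\<Sum>k\<in>keys f. single k (lookup f k))"
    by (rule poly_mapping_eqI)
      (simp add: lookup_sum lookup_single when_def sum.delta in_keys_iff)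
  moreover have "P (\<Sum>k\<in>A. single k (lookup f k))" if "finite A" for A
    using that assms by (induction A) auto
  ultimately show ?thesis by (metis finite_keys)
qed

lemma lookup_hom_part: "lookup (hom_part i f) w = (if length w = i then lookup f w else 0)"
proof -
  have "finite {w \<in> keys f. length w = i}" by simp
  then show ?thesis
    by (auto simp: hom_part_def lookup_sum lookup_single when_def sum.delta in_keys_iff)
qed

lemma hom_part_zero [simp]: "hom_part i 0 = 0"
  by (rule poly_mapping_eqI) (simp add: lookup_hom_part)

lemma hom_part_add: "hom_part i (f + g) = hom_part i f + hom_part i g"
  by (rule poly_mapping_eqI) (simp add: lookup_hom_part lookup_add)

lemma hom_part_uminus: "hom_part i (- f) = - hom_part i f"
  by (rule poly_mapping_eqI) (simp add: lookup_hom_part)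

lemma hom_part_diff: "hom_part i (f - g) = hom_part i f - hom_part i g"
  by (rule poly_mapping_eqI) (simp add: lookup_hom_part lookup_minus)

lemma hom_part_sum: "hom_part i (sum f A) = (\<Sum>a\<in>A. hom_part i (f a))"
  by (rule poly_mapping_eqI) (simp add: lookup_hom_part lookup_sum)

lemma hom_part_single:
  "hom_part i (single w c) = (if length w = i then single w c else 0)"
  by (rule poly_mapping_eqI) (auto simp: lookup_hom_part lookup_single when_def)

lemma hom_part_hom_part: "hom_part i (hom_part j f) = (if i = j then hom_part i f else 0)"
  by (rule poly_mapping_eqI) (simp add: lookup_hom_part)

lemma free_comp_iff: "f \<in> free_comp d \<longleftrightarrow> hom_part d f = f"
  by (auto simp: free_comp_def poly_mapping_eq_iff fun_eq_iff lookup_hom_part in_keys_iff)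

lemma hom_part_in_free_comp [simp]: "hom_part i f \<in> free_comp i"
  by (simp add: free_comp_iff hom_part_hom_part)

lemma hom_part_free_comp: "f \<in> free_comp d \<Longrightarrow> hom_part i f = (if i = d then f else 0)"
  by (metis free_comp_iff hom_part_hom_part)

lemma hom_part_mult: "hom_part n (f * g) = (\<Sum>i\<le>n. hom_part i f * hom_part (n - i) g)"
proof (induction f rule: poly_mapping_additive_induct)
  case (single v c)
  show ?case
  proof (induction g rule: poly_mapping_additive_induct)
    case (single w d)
    have "(\<Sum>i\<le>n. hom_part i (single v c) * hom_part (n - i) (single w d))
      = (\<Sum>i\<le>n. if i = length v then hom_part n (single (v @ w) (c * d)) else 0)"
      by (rule sum.cong) (auto simp: hom_part_single mult_single plus_list_def)
    then show ?case
      by (auto simp: hom_part_single mult_single plus_list_def sum.delta)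
  qed (simp_all add: hom_part_add distrib_left sum.distrib)
qed (simp_all add: hom_part_add distrib_right sum.distrib)

definition free_le :: "nat \<Rightarrow> ('x, 'k::field) free_algebra set" where
  "free_le n = {f. \<forall>i>n. hom_part i f = 0}"

lemma free_leI: "(\<And>i. i > n \<Longrightarrow> hom_part i f = 0) \<Longrightarrow> f \<in> free_le n"
  and free_leD: "f \<in> free_le n \<Longrightarrow> i > n \<Longrightarrow> hom_part i f = 0"
  by (auto simp: free_le_def)

lemma free_le_zero [simp]: "0 \<in> free_le n"
  by (simp add: free_le_def)

lemma free_le_add: "f \<in> free_le n \<Longrightarrow> g \<in> free_le n \<Longrightarrow> f + g \<in> free_le n"
  by (simp add: free_le_def hom_part_add)

lemma free_le_uminus: "f \<in> free_le n \<Longrightarrow> - f \<in> free_le n"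
  by (simp add: free_le_def hom_part_uminus)

lemma free_le_diff: "f \<in> free_le n \<Longrightarrow> g \<in> free_le n \<Longrightarrow> f - g \<in> free_le n"
  by (simp add: free_le_def hom_part_diff)

lemma free_le_mono: "f \<in> free_le a \<Longrightarrow> a \<le> b \<Longrightarrow> f \<in> free_le b"
  by (simp add: free_le_def)

lemma free_comp_free_le: "f \<in> free_comp n \<Longrightarrow> f \<in> free_le n"
  by (simp add: free_le_def hom_part_free_comp)

lemma hom_part_free_le [simp]: "hom_part n f \<in> free_le n"
  by (simp add: free_comp_free_le)

lemma free_le_mult: "f \<in> free_le a \<Longrightarrow> g \<in> free_le b \<Longrightarrow> f * g \<in> free_le (a + b)"
proof (rule free_leI)
  fix n assume f: "f \<in> free_le a" and g: "g \<in> free_le b" and n: "a + b < n"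
  have "hom_part i f * hom_part (n - i) g = 0" if "i \<le> n" for i
  proof (cases "i > a")
    case True then show ?thesis by (simp add: free_leD[OF f])
  next
    case False
    then have "n - i > b" using n that by auto
    then show ?thesis by (simp add: free_leD[OF g])
  qed
  then show "hom_part n (f * g) = 0" by (simp add: hom_part_mult)
qed

lemma hom_part_mult_top:
  assumes "f \<in> free_le a" "g \<in> free_le b"
  shows "hom_part (a + b) (f * g) = hom_part a f * hom_part b g"
proof -
  have "hom_part i f * hom_part (a + b - i) g = (if i = a then hom_part a f * hom_part b g else 0)"
    if "i \<le> a + b" for i
  proof (cases "i > a")
    case True then show ?thesis by (simp add: free_leD[OF assms(1)])
  next
    case False
    show ?thesis
    proof (cases "i = a")
      case False
      then have "a + b - i > b" using \<open>\<not> i > a\<close> by auto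
      then show ?thesis using False by (simp add: free_leD[OF assms(2)])
    qed simp
  qed
  then show ?thesis by (simp add: hom_part_mult sum.delta)
qed

lemma hom_part_homog_mult:
  assumes "f \<in> free_comp a"
  shows "hom_part n (f * g) = (if a \<le> n then f * hom_part (n - a) g else 0)"
proof -
  have "hom_part n (f * g) = (\<Sum>i\<le>n. if i = a then f * hom_part (n - a) g else 0)"
    unfolding hom_part_mult by (rule sum.cong) (auto simp: hom_part_free_comp[OF assms])
  then show ?thesis by (simp add: sum.delta)
qed

lemma hom_part_mult_homog:
  assumes "g \<in> free_comp b"
  shows "hom_part n (f * g) = (if b \<le> n then hom_part (n - b) f * g else 0)"
proof -
  have "hom_part n (f * g) = (\<Sum>i\<le>n. if i = n - b \<and> b \<le> n then hom_part (n - b) f * g else 0)"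
    unfolding hom_part_mult by (rule sum.cong) (auto simp: hom_part_free_comp[OF assms])
  then show ?thesis by (simp add: sum.delta)
qed

lemma free_comp_zero [simp]: "0 \<in> free_comp d"
  by (simp add: free_comp_iff)

lemma free_deg_le: "f \<in> free_le (free_deg f)"
proof -
  have "length w \<le> free_deg f" if "w \<in> keys f" for w
    unfolding free_deg_def using that by (intro Max_ge) auto
  then show ?thesis
    by (intro free_leI poly_mapping_eqI) (force simp: lookup_hom_part in_keys_iff)
qed

lemma free_deg_least: "f \<in> free_le n \<Longrightarrow> free_deg f \<le> n"
proof -
  assume f: "f \<in> free_le n"
  have "length w \<le> n" if "w \<in> keys f" for w
  proof (rule ccontr)
    assume "\<not> length w \<le> n"
    then have "hom_part (length w) f = 0" using f by (simp add: free_leD)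
    then have "lookup (hom_part (length w) f) w = 0" by simp
    then show False using that by (simp add: lookup_hom_part in_keys_iff)
  qed
  then show ?thesis by (simp add: free_deg_def)
qed

lemma free_deg_homog: "f \<in> free_comp d \<Longrightarrow> f \<noteq> 0 \<Longrightarrow> free_deg f = d"
  by (metis free_comp_free_le free_deg_least free_deg_le free_leD hom_part_free_comp le_neq_implies_less)

lemma sum_hom_part: "f \<in> free_le n \<Longrightarrow> (\<Sum>i\<le>n. hom_part i f) = f"
proof (rule poly_mapping_eqI)
  fix w assume f: "f \<in> free_le n"
  have "lookup f w = 0" if "length w > n"
    using free_leD[OF f that] lookup_hom_part[of "length w" f w] by simp
  then show "lookup (\<Sum>i\<le>n. hom_part i f) w = lookup f w"
    by (cases "length w \<le> n") (auto simp: lookup_sum lookup_hom_part sum.delta)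
qed

lemma single_Nil_one: "single [] 1 = 1"
  by (metis single_one zero_list_def)

definition scal :: "'k::field \<Rightarrow> ('x, 'k) free_algebra" where
  "scal c = single [] c"

definition const_coeff :: "('x, 'k::field) free_algebra \<Rightarrow> 'k" where
  "const_coeff f = lookup f []"

definition gen :: "'x \<Rightarrow> ('x, 'k::field) free_algebra" where
  "gen x = single [x] 1"

lemma scal_add: "scal (a + b) = scal a + scal b" by (simp add: scal_def single_add)
lemma scal_mult: "scal (a * b) = scal a * scal b" by (simp add: scal_def mult_single plus_list_def)
lemma scal_0 [simp]: "scal 0 = 0" by (simp add: scal_def)
lemma scal_1 [simp]: "scal 1 = 1" by (simp add: scal_def single_Nil_one)
lemma scal_uminus: "scal (- a) = - scal a" by (simp add: scal_def single_uminus)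

lemma const_coeff_scal [simp]: "const_coeff (scal c) = c"
  by (simp add: const_coeff_def scal_def)
lemma const_coeff_0 [simp]: "const_coeff 0 = 0" by (simp add: const_coeff_def)
lemma const_coeff_add: "const_coeff (f + g) = const_coeff f + const_coeff g"
  by (simp add: const_coeff_def lookup_add)
lemma const_coeff_diff: "const_coeff (f - g) = const_coeff f - const_coeff g"
  by (simp add: const_coeff_def lookup_minus)
lemma const_coeff_uminus: "const_coeff (- f) = - const_coeff f"
  by (simp add: const_coeff_def)
lemma const_coeff_sum: "const_coeff (sum f A) = (\<Sum>a\<in>A. const_coeff (f a))"
  by (simp add: const_coeff_def lookup_sum)

lemma hom_part_0: "hom_part 0 f = scal (const_coeff f)"
  by (rule poly_mapping_eqI) (auto simp: lookup_hom_part scal_def const_coeff_def lookup_single when_def)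

lemma const_coeff_hom_part: "const_coeff (hom_part i f) = (if i = 0 then const_coeff f else 0)"
  by (simp add: const_coeff_def lookup_hom_part)

lemma scal_inj: "scal a = scal b \<Longrightarrow> a = b"
  by (metis const_coeff_scal)

lemma const_coeff_mult: "const_coeff (f * g) = const_coeff f * const_coeff g"
proof -
  have "hom_part 0 (f * g) = hom_part 0 f * hom_part 0 g" by (simp add: hom_part_mult)
  then show ?thesis by (metis hom_part_0 scal_inj scal_mult)
qed

lemma const_coeff_free_comp: "f \<in> free_comp d \<Longrightarrow> d > 0 \<Longrightarrow> const_coeff f = 0"
  by (metis const_coeff_hom_part free_comp_iff less_not_refl)

lemma scal_free_comp [simp]: "scal c \<in> free_comp 0"
  by (simp add: free_comp_iff hom_part_0)

lemma gen_free_comp [simp]: "gen x \<in> free_comp 1"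
  by (simp add: free_comp_iff gen_def hom_part_single)

lemma one_free_comp [simp]: "1 \<in> free_comp 0"
  by (metis scal_1 scal_free_comp)

text \<open>
  \<open>T\<close> is the direct sum of \<open>K\<close> and the left ideals \<open>T x\<close>, each free on the variable \<open>x\<close>. The quotient
  of the component of \<open>f\<close> in \<open>T x\<close> by \<open>x\<close> is \<open>rdiv x f\<close>.
\<close>

definition rdiv :: "'x \<Rightarrow> ('x, 'k::field) free_algebra \<Rightarrow> ('x, 'k) free_algebra" where
  "rdiv x f = Poly_Mapping.map_key (\<lambda>w. w @ [x]) f"

lemma lookup_rdiv: "lookup (rdiv x f) w = lookup f (w @ [x])"
  unfolding rdiv_def by (subst map_key.rep_eq) (auto simp: inj_def)

lemma rdiv_zero [simp]: "rdiv x 0 = 0"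
  by (rule poly_mapping_eqI) (simp add: lookup_rdiv)
lemma rdiv_add: "rdiv x (f + g) = rdiv x f + rdiv x g"
  by (rule poly_mapping_eqI) (simp add: lookup_rdiv lookup_add)
lemma rdiv_uminus: "rdiv x (- f) = - rdiv x f"
  by (rule poly_mapping_eqI) (simp add: lookup_rdiv)
lemma rdiv_sum: "rdiv x (sum f A) = (\<Sum>a\<in>A. rdiv x (f a))"
  by (rule poly_mapping_eqI) (simp add: lookup_rdiv lookup_sum)

lemma rdiv_single: "rdiv x (single w c)
    = (if w \<noteq> [] \<and> last w = x then single (butlast w) c else 0)"
  by (rule poly_mapping_eqI) (auto simp: lookup_rdiv lookup_single when_def)

lemma rdiv_hom_part: "rdiv x (hom_part (Suc n) f) = hom_part n (rdiv x f)"
  by (rule poly_mapping_eqI) (simp add: lookup_rdiv lookup_hom_part)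

lemma rdiv_scal [simp]: "rdiv x (scal c) = 0"
  by (simp add: scal_def rdiv_single)

text \<open>
  A word of \<open>f g\<close> ends in the last letter of its part from \<open>g\<close>, unless that part is empty.
\<close>

lemma rdiv_mult: "rdiv x (f * g) = f * rdiv x g + rdiv x f * scal (const_coeff g)"
proof (induction f rule: poly_mapping_additive_induct)
  case (single v c)
  show ?case
  proof (induction g rule: poly_mapping_additive_induct)
    case (single w d)
    show ?case
      by (auto simp: mult_single rdiv_single scal_def const_coeff_def lookup_single when_def
          plus_list_def butlast_append)
  qed (simp_all add: rdiv_add const_coeff_add scal_add algebra_simps)
qed (simp_all add: rdiv_add algebra_simps)

lemma rdiv_gen: "rdiv x (gen y) = (if x = y then 1 else 0)"
  by (simp add: gen_def rdiv_single single_Nil_one)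

lemma const_coeff_gen [simp]: "const_coeff (gen x) = 0"
  by (simp add: const_coeff_def gen_def lookup_single when_def)

lemma rdiv_mult_gen: "rdiv x (f * gen y) = (if x = y then f else 0)"
  by (simp add: rdiv_mult rdiv_gen)

lemma rdiv_sum_gen: "rdiv x (\<Sum>y\<in>UNIV. q y * gen y) = q (x::'x::finite)"
  by (simp add: rdiv_sum rdiv_mult_gen)

lemma rdiv_decomp: "f = scal (const_coeff f) + (\<Sum>x\<in>UNIV. rdiv (x::'x::finite) f * gen x)"
proof (induction f rule: poly_mapping_additive_induct)
  case (single w c)
  have *: "rdiv x (single w c) * gen x
     = (if w \<noteq> [] \<and> x = last w then single w c else 0)" for x
    by (auto simp: rdiv_single gen_def mult_single plus_list_def)
  have "(\<Sum>x\<in>UNIV. rdiv x (single w c) * gen x)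
     = (if w = [] then 0 else single w c)"
    unfolding * by (auto simp: sum.delta)
  then show ?case
    by (cases "w = []") (simp_all add: scal_def const_coeff_def lookup_single)
next
  case (add f g)
  have "scal (const_coeff (f + g)) + (\<Sum>x\<in>UNIV. rdiv x (f + g) * gen x)
      = (scal (const_coeff f) + (\<Sum>x\<in>UNIV. rdiv x f * gen x))
      + (scal (const_coeff g) + (\<Sum>x\<in>UNIV. rdiv x g * gen x))"
    by (simp add: const_coeff_add scal_add rdiv_add distrib_right sum.distrib)
  also have "\<dots> = f + g"
    by (simp only: add[symmetric])
  finally show ?case by (rule sym)
qed simp

lemma rdiv_free_comp: "f \<in> free_comp (Suc d) \<Longrightarrow> rdiv x f \<in> free_comp d"
  by (metis free_comp_iff rdiv_hom_part)

lemma rdiv_free_le: "f \<in> free_le (Suc d) \<Longrightarrow> rdiv x f \<in> free_le d"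
  by (auto intro!: free_leI simp: rdiv_hom_part[symmetric] free_leD)


lemma scal_central: "f * scal c = scal c * f"
  by (induction f rule: poly_mapping_additive_induct)
    (simp_all add: scal_def mult_single plus_list_def mult.commute distrib_left distrib_right)

section \<open>Two-sided ideals of a ring type\<close>

lemma ring_of_type_algebra_simps [simp]:
  "carrier (ring_of_type_algebra :: 'a::ring_1 ring) = UNIV"
  "x \<otimes>\<^bsub>(ring_of_type_algebra :: 'a ring)\<^esub> y = x * y"
  "\<one>\<^bsub>(ring_of_type_algebra :: 'a ring)\<^esub> = 1"
  "\<zero>\<^bsub>(ring_of_type_algebra :: 'a ring)\<^esub> = 0"
  "x \<oplus>\<^bsub>(ring_of_type_algebra :: 'a ring)\<^esub> y = x + y"
  by (simp_all add: ring_of_type_algebra_def)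

lemma ring_type_algebra: "ring (ring_of_type_algebra :: 'a::ring_1 ring)"
proof -
  have "\<exists>y. x + y = 0" "\<exists>y. y + x = 0" for x :: 'a
    using add.right_inverse add.left_inverse by blast+
  then show ?thesis
    by unfold_locales (auto simp: algebra_simps Units_def)
qed

lemma a_inv_type_algebra [simp]: "\<ominus>\<^bsub>(ring_of_type_algebra :: 'a::ring_1 ring)\<^esub> x = - x"
proof -
  interpret ring "ring_of_type_algebra :: 'a ring" by (rule ring_type_algebra)
  show ?thesis using minus_equality[of "- x" x] by simp
qed

lemma ideal_type_algebraI:
  fixes J :: "'a::ring_1 set"
  assumes "0 \<in> J" "\<And>a b. a \<in> J \<Longrightarrow> b \<in> J \<Longrightarrow> a + b \<in> J"
    "\<And>a b. b \<in> J \<Longrightarrow> a * b \<in> J" "\<And>a b. a \<in> J \<Longrightarrow> a * b \<in> J"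
  shows "ideal J ring_of_type_algebra"
proof -
  interpret ring "ring_of_type_algebra :: 'a ring" by (rule ring_type_algebra)
  have "- a \<in> J" if "a \<in> J" for a using assms(3)[OF that, of "-1"] by simp
  moreover have "inv\<^bsub>\<lparr>carrier = UNIV, monoid.mult = (\<oplus>\<^bsub>ring_of_type_algebra\<^esub>), one = 0\<rparr>\<^esub> a = - a" for a :: 'a
    using a_inv_type_algebra[of a] by (simp add: a_inv_def)
  ultimately show ?thesis
    by (intro idealI ring_type_algebra subgroup.intro) (auto simp: assms)
qed

context
  fixes S :: "'a::ring_1 set"
begin

lemma ideal_Idl: "ideal (Idl\<^bsub>ring_of_type_algebra\<^esub> S) ring_of_type_algebra"
  by (rule ring.genideal_ideal[OF ring_type_algebra]) simp

lemma Idl_incl: "s \<in> S \<Longrightarrow> s \<in> Idl\<^bsub>ring_of_type_algebra\<^esub> S"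
  using ring.genideal_self[OF ring_type_algebra, of S] by auto

lemma Idl_zero: "0 \<in> Idl\<^bsub>ring_of_type_algebra\<^esub> S"
  using additive_subgroup.zero_closed[OF ideal.axioms(1)[OF ideal_Idl]] by simp

lemma Idl_add:
  "a \<in> Idl\<^bsub>ring_of_type_algebra\<^esub> S \<Longrightarrow> b \<in> Idl\<^bsub>ring_of_type_algebra\<^esub> S
    \<Longrightarrow> a + b \<in> Idl\<^bsub>ring_of_type_algebra\<^esub> S"
  using additive_subgroup.a_closed[OF ideal.axioms(1)[OF ideal_Idl]] by simp

lemma Idl_lmult: "a \<in> Idl\<^bsub>ring_of_type_algebra\<^esub> S \<Longrightarrow> b * a \<in> Idl\<^bsub>ring_of_type_algebra\<^esub> S"
  using ideal.I_l_closed[OF ideal_Idl] by simp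

lemma Idl_rmult: "a \<in> Idl\<^bsub>ring_of_type_algebra\<^esub> S \<Longrightarrow> a * b \<in> Idl\<^bsub>ring_of_type_algebra\<^esub> S"
  using ideal.I_r_closed[OF ideal_Idl] by simp

lemma Idl_uminus: "a \<in> Idl\<^bsub>ring_of_type_algebra\<^esub> S \<Longrightarrow> - a \<in> Idl\<^bsub>ring_of_type_algebra\<^esub> S"
  using Idl_lmult[of a "-1"] by simp

lemma Idl_diff:
  "a \<in> Idl\<^bsub>ring_of_type_algebra\<^esub> S \<Longrightarrow> b \<in> Idl\<^bsub>ring_of_type_algebra\<^esub> S
    \<Longrightarrow> a - b \<in> Idl\<^bsub>ring_of_type_algebra\<^esub> S"
  using Idl_add[of a "-b"] Idl_uminus[of b] by simp

lemma Idl_sum: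
  "(\<And>i. i \<in> A \<Longrightarrow> f i \<in> Idl\<^bsub>ring_of_type_algebra\<^esub> S) \<Longrightarrow> sum f A \<in> Idl\<^bsub>ring_of_type_algebra\<^esub> S"
  by (induction A rule: infinite_finite_induct) (auto intro: Idl_add Idl_zero)

lemma Idl_induct [consumes 1, case_names incl zero add lmult rmult]:
  assumes "f \<in> Idl\<^bsub>ring_of_type_algebra\<^esub> S"
    and "\<And>s. s \<in> S \<Longrightarrow> P s" and "P 0" and "\<And>a b. P a \<Longrightarrow> P b \<Longrightarrow> P (a + b)"
    and "\<And>a b. P b \<Longrightarrow> P (a * b)" and "\<And>a b. P a \<Longrightarrow> P (a * b)"
  shows "P f"
proof -
  have "ideal {f. P f} ring_of_type_algebra"
    using assms(3-) by (intro ideal_type_algebraI) auto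
  then have "Idl\<^bsub>ring_of_type_algebra\<^esub> S \<subseteq> {f. P f}"
    by (rule ring.genideal_minimal[OF ring_type_algebra]) (auto simp: assms(2))
  then show ?thesis using assms(1) by auto
qed

end

section \<open>Tuples over the free algebra\<close>

text \<open>
  An element of the free left module on the basis \<open>e\<^sub>j\<close>, with its coefficient at \<open>e\<^sub>j\<close>. The type
  coincides with that of \<open>T[z]\<close>, but its ring structure is not meant here.
\<close>

type_synonym ('x, 'k) tuples = "nat \<Rightarrow>\<^sub>0 ('x, 'k) free_algebra"

definition tsmult :: "('x, 'k::field) free_algebra \<Rightarrow> ('x, 'k) tuples \<Rightarrow> ('x, 'k) tuples" where
  "tsmult t f = Poly_Mapping.map (\<lambda>u. t * u) f"

text \<open>
  The part of degree \<open>n\<close> when \<open>e\<^sub>j\<close> has degree \<open>\<delta> j\<close>. The case distinction matters: truncated subtraction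
  would otherwise let a constant coefficient of \<open>e\<^sub>j\<close> contribute to all degrees below \<open>\<delta> j\<close>.
\<close>

definition tuple_part :: "(nat \<Rightarrow> nat) \<Rightarrow> nat \<Rightarrow> ('x, 'k::field) tuples \<Rightarrow> ('x, 'k) tuples" where
  "tuple_part \<delta> n f = Poly_Mapping.mapp (\<lambda>j u. if \<delta> j \<le> n then hom_part (n - \<delta> j) u else 0) f"

lemma lookup_tsmult: "lookup (tsmult t f) j = t * lookup f j"
  by (simp add: tsmult_def map.rep_eq when_def)

lemma lookup_tuple_part: "lookup (tuple_part \<delta> n f) j
    = (if \<delta> j \<le> n then hom_part (n - \<delta> j) (lookup f j) else 0)"
  by (auto simp: tuple_part_def mapp.rep_eq when_def in_keys_iff)

lemma tsmult_add_left: "tsmult (s + t) f = tsmult s f + tsmult t f"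
  by (rule poly_mapping_eqI) (simp add: lookup_tsmult lookup_add distrib_right)
lemma tsmult_add_right: "tsmult t (f + g) = tsmult t f + tsmult t g"
  by (rule poly_mapping_eqI) (simp add: lookup_tsmult lookup_add distrib_left)
lemma tsmult_diff_right: "tsmult t (f - g) = tsmult t f - tsmult t g"
  by (rule poly_mapping_eqI) (simp add: lookup_tsmult lookup_minus right_diff_distrib)
lemma tsmult_tsmult: "tsmult s (tsmult t f) = tsmult (s * t) f"
  by (rule poly_mapping_eqI) (simp add: lookup_tsmult mult.assoc)
lemma tsmult_one [simp]: "tsmult 1 f = f"
  by (rule poly_mapping_eqI) (simp add: lookup_tsmult)
lemma tsmult_zero_left [simp]: "tsmult 0 f = 0"
  by (rule poly_mapping_eqI) (simp add: lookup_tsmult)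
lemma tsmult_zero_right [simp]: "tsmult t 0 = 0"
  by (rule poly_mapping_eqI) (simp add: lookup_tsmult)
lemma tsmult_uminus_left: "tsmult (- s) f = - tsmult s f"
  by (rule poly_mapping_eqI) (simp add: lookup_tsmult)
lemma tsmult_sum_right: "tsmult t (sum f A) = (\<Sum>a\<in>A. tsmult t (f a))"
  by (rule poly_mapping_eqI) (simp add: lookup_tsmult lookup_sum sum_distrib_left)
lemma tsmult_single: "tsmult t (single j u) = single j (t * u)"
  by (rule poly_mapping_eqI) (simp add: lookup_tsmult lookup_single when_def)

lemma tuple_part_zero [simp]: "tuple_part \<delta> n 0 = 0"
  by (rule poly_mapping_eqI) (simp add: lookup_tuple_part)
lemma tuple_part_add: "tuple_part \<delta> n (f + g) = tuple_part \<delta> n f + tuple_part \<delta> n g"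
  by (rule poly_mapping_eqI) (simp add: lookup_tuple_part lookup_add hom_part_add)
lemma tuple_part_tuple_part:
  "tuple_part \<delta> n (tuple_part \<delta> k f) = (if n = k then tuple_part \<delta> n f else 0)"
  by (rule poly_mapping_eqI) (auto simp: lookup_tuple_part hom_part_hom_part)

lemma tuple_part_tsmult:
  "tuple_part \<delta> n (tsmult t f) = (\<Sum>a\<le>n. tsmult (hom_part a t) (tuple_part \<delta> (n - a) f))"
proof (rule poly_mapping_eqI)
  fix j
  show "lookup (tuple_part \<delta> n (tsmult t f)) j
      = lookup (\<Sum>a\<le>n. tsmult (hom_part a t) (tuple_part \<delta> (n - a) f)) j"
  proof (cases "\<delta> j \<le> n")
    case True
    have "(\<Sum>a\<le>n. hom_part a t * (if \<delta> j \<le> n - a then hom_part (n - a - \<delta> j) (lookup f j) else 0))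
       = (\<Sum>a\<le>n - \<delta> j. hom_part a t * hom_part (n - \<delta> j - a) (lookup f j))"
      using True by (intro sum.mono_neutral_cong_right) (auto simp: algebra_simps)
    then show ?thesis using True
      by (simp add: lookup_sum lookup_tsmult lookup_tuple_part hom_part_mult)
  next
    case False
    then have "\<not> \<delta> j \<le> n - a" for a by simp
    then show ?thesis using False by (simp add: lookup_sum lookup_tsmult lookup_tuple_part)
  qed
qed

lemma keys_tuple_part: "keys (tuple_part \<delta> n f) \<subseteq> keys f"
  by (auto simp: in_keys_iff lookup_tuple_part split: if_splits)

lemma keys_tsmult: "keys (tsmult t f) \<subseteq> keys f"
  by (auto simp: in_keys_iff lookup_tsmult)

section \<open>Homogeneous relations and their syzygies\<close>

locale homogeneous_relations =
  fixes m :: nat and r :: "nat \<Rightarrow> ('x::finite, 'k::field) free_algebra" and d :: "nat \<Rightarrow> nat"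
  assumes r_homog: "i < m \<Longrightarrow> r i \<in> free_comp (d i)"
    and d_ge: "i < m \<Longrightarrow> 2 \<le> d i"
begin

definition I :: "('x, 'k) free_algebra set" where "I = rel_ideal m r"

lemmas I_zero [simp] = Idl_zero[where S="r ` {..<m}", folded rel_ideal_def I_def]
lemmas I_add = Idl_add[where S="r ` {..<m}", folded rel_ideal_def I_def]
lemmas I_lmult = Idl_lmult[where S="r ` {..<m}", folded rel_ideal_def I_def]
lemmas I_rmult = Idl_rmult[where S="r ` {..<m}", folded rel_ideal_def I_def]
lemmas I_uminus = Idl_uminus[where S="r ` {..<m}", folded rel_ideal_def I_def]
lemmas I_diff = Idl_diff[where S="r ` {..<m}", folded rel_ideal_def I_def]
lemmas I_sum = Idl_sum[where S="r ` {..<m}", folded rel_ideal_def I_def]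
lemmas I_induct [consumes 1, case_names incl zero add lmult rmult] =
  Idl_induct[where S="r ` {..<m}", folded rel_ideal_def I_def]

lemma I_incl: "i < m \<Longrightarrow> r i \<in> I"
  unfolding I_def rel_ideal_def by (intro Idl_incl) auto

lemma r_const [simp]: "i < m \<Longrightarrow> const_coeff (r i) = 0"
  using r_homog[of i] d_ge[of i] const_coeff_free_comp[of "r i" "d i"] by auto

lemma r_rdiv: "i < m \<Longrightarrow> r i = (\<Sum>x\<in>UNIV. rdiv x (r i) * gen x)"
  using rdiv_decomp[of "r i"] by simp

lemma sum_r_rdiv:
  "(\<Sum>i<m. t i * r i) = (\<Sum>x\<in>UNIV. (\<Sum>i<m. t i * rdiv x (r i)) * gen x)"
proof -
  have "t i * r i = (\<Sum>x\<in>UNIV. t i * rdiv x (r i) * gen x)" if "i < m" for i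
    by (subst r_rdiv[OF that]) (simp add: sum_distrib_left mult.assoc)
  then have "(\<Sum>i<m. t i * r i) = (\<Sum>i<m. \<Sum>x\<in>UNIV. t i * rdiv x (r i) * gen x)" by simp
  then show ?thesis by (subst (asm) sum.swap) (simp add: sum_distrib_right)
qed

lemma rdiv_r: "i < m \<Longrightarrow> rdiv x (t * r i) = t * rdiv x (r i)"
  by (simp add: rdiv_mult)

lemma rdiv_r_homog: "i < m \<Longrightarrow> rdiv x (r i) \<in> free_comp (d i - 1)"
  using r_homog[of i] d_ge[of i] rdiv_free_comp[of "r i" "d i - 1" x] by simp

lemma I_hom_part: "f \<in> I \<Longrightarrow> hom_part n f \<in> I"
proof (induction f arbitrary: n rule: I_induct)
  case (incl s)
  then obtain i where "s = r i" "i < m" by auto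
  then show ?case by (simp add: hom_part_free_comp[OF r_homog] I_incl)
next
  case (lmult a b)
  then show ?case by (auto simp: hom_part_mult intro!: I_sum I_lmult)
next
  case (rmult a b)
  then show ?case by (auto simp: hom_part_mult intro!: I_sum I_rmult)
qed (auto simp: hom_part_add intro: I_add)

lemma I_const: "f \<in> I \<Longrightarrow> const_coeff f = 0"
  by (induction f rule: I_induct) (auto simp: const_coeff_add const_coeff_mult)

text \<open>
  \<open>I\<close> is the sum of the left ideals generated by the \<open>r\<^sub>i\<close> and of \<open>I T\<^sub>+\<close>, because the right factor \<open>v\<close>
  of \<open>u r\<^sub>i v\<close> splits into a constant and multiples \<open>v' x\<close> of variables. This is the exactness of the
  minimal resolution at its second term.
\<close>

lemma I_decomp:
  "f \<in> I \<Longrightarrow> \<exists>t q. (\<forall>x. q x \<in> I) \<and> f = (\<Sum>i<m. t i * r i) + (\<Sum>x\<in>UNIV. q x * gen x)"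
proof (induction f rule: I_induct)
  case (incl s)
  then obtain i where i: "s = r i" "i < m" by auto
  show ?case
    by (rule exI[of _ "\<lambda>j. if j = i then 1 else 0"], rule exI[of _ "\<lambda>_. 0"])
      (use i in \<open>simp add: if_distrib[where f="\<lambda>x. x * _"] sum.delta cong: if_cong\<close>)
next
  case zero
  show ?case
    by (rule exI[of _ "\<lambda>_. 0"], rule exI[of _ "\<lambda>_. 0"]) simp
next
  case (add a b)
  then obtain t q t' q' where "\<forall>x. q x \<in> I" "a = (\<Sum>i<m. t i * r i) + (\<Sum>x\<in>UNIV. q x * gen x)"
    "\<forall>x. q' x \<in> I" "b = (\<Sum>i<m. t' i * r i) + (\<Sum>x\<in>UNIV. q' x * gen x)" by blast
  then show ?case
    by (intro exI[of _ "\<lambda>i. t i + t' i"] exI[of _ "\<lambda>x. q x + q' x"])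
      (auto simp: I_add distrib_right sum.distrib)
next
  case (lmult u a)
  then obtain t q where "\<forall>x. q x \<in> I" "a = (\<Sum>i<m. t i * r i) + (\<Sum>x\<in>UNIV. q x * gen x)" by blast
  then show ?case
    by (intro exI[of _ "\<lambda>i. u * t i"] exI[of _ "\<lambda>x. u * q x"])
      (auto simp: I_lmult distrib_left sum_distrib_left mult.assoc)
next
  case (rmult a v)
  then obtain t q where q: "\<forall>x. q x \<in> I" and a: "a = (\<Sum>i<m. t i * r i) + (\<Sum>x\<in>UNIV. q x * gen x)"
    by blast
  have aI: "a \<in> I"
    unfolding a using q by (intro I_add I_sum) (auto intro: I_lmult[OF I_incl] I_rmult)
  define c :: "('x, 'k) free_algebra" where "c = scal (const_coeff v)"
  have cg: "f * c = c * f" for f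
    by (simp add: c_def scal_central)
  have "a * v = a * c + (\<Sum>x\<in>UNIV. (a * rdiv x v) * gen x)"
    by (subst rdiv_decomp[of v]) (simp add: c_def distrib_left sum_distrib_left mult.assoc)
  also have "a * c = (\<Sum>i<m. (t i * c) * r i) + (\<Sum>x\<in>UNIV. (q x * c) * gen x)"
    unfolding a by (simp add: distrib_right distrib_left sum_distrib_right sum_distrib_left mult.assoc cg)
  finally have "a * v = (\<Sum>i<m. (t i * c) * r i) + (\<Sum>x\<in>UNIV. (q x * c + a * rdiv x v) * gen x)"
    by (simp add: distrib_right sum.distrib add.assoc)
  moreover have "q x * c + a * rdiv x v \<in> I" for x
    using q aI by (auto intro!: I_add I_rmult)
  ultimately show ?case
    by (intro exI[of _ "\<lambda>i. t i * c"] exI[of _ "\<lambda>x. q x * c + a * rdiv x v"]) auto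
qed

definition tupI :: "nat set \<Rightarrow> ('x, 'k) tuples set" where
  "tupI J = {f. keys f \<subseteq> J \<and> (\<forall>j. lookup f j \<in> I)}"

text \<open>
  Over \<open>A\<close> this is the kernel of \<open>e\<^sub>i \<mapsto> \<Sum> (r\<^sub>i / x) e\<^sub>x\<close>, the third syzygy module of \<open>K\<close>; here it is
  pulled back to tuples over \<open>T\<close>.
\<close>

definition syz :: "('x, 'k) tuples set" where
  "syz = {f. keys f \<subseteq> {..<m} \<and>
     (\<forall>x. (\<Sum>i<m. lookup f i * rdiv x (r i)) \<in> I)}"

text \<open>
  The quotient of the syzygies by this subspace is \<open>\<Omega> / A\<^sub>+ \<Omega>\<close>, the space of minimal generators of the
  third syzygy module.
\<close>

inductive_set decomposable :: "('x, 'k) tuples set" where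
  zero: "0 \<in> decomposable"
| add: "f \<in> decomposable \<Longrightarrow> g \<in> decomposable \<Longrightarrow> f + g \<in> decomposable"
| smult: "const_coeff t = 0 \<Longrightarrow> w \<in> syz \<Longrightarrow> tsmult t w \<in> decomposable"
| tupI: "f \<in> tupI {..<m} \<Longrightarrow> f \<in> decomposable"

lemma tuple_part_rdiv:
  assumes "keys f \<subseteq> {..<m}"
  shows "(\<Sum>i<m. lookup (tuple_part d (Suc n) f) i * rdiv x (r i))
    = hom_part n (\<Sum>i<m. lookup f i * rdiv x (r i))"
proof -
  have "lookup (tuple_part d (Suc n) f) i * rdiv x (r i)
      = hom_part n (lookup f i * rdiv x (r i))" if "i < m" for i
  proof -
    have "d i \<noteq> 0" using d_ge[OF that] by simp
    then obtain e where "d i = Suc e" by (cases "d i") auto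
    then show ?thesis
      using rdiv_r_homog[OF that, of x] by (simp add: hom_part_mult_homog lookup_tuple_part)
  qed
  then show ?thesis by (simp add: hom_part_sum)
qed

lemma tuple_part_0: "keys f \<subseteq> {..<m} \<Longrightarrow> tuple_part d 0 f = 0"
proof (rule poly_mapping_eqI)
  fix j assume k: "keys f \<subseteq> {..<m}"
  show "lookup (tuple_part d 0 f) j = lookup 0 j"
  proof (cases "j < m")
    case True then show ?thesis using d_ge[of j] by (simp add: lookup_tuple_part)
  next
    case False
    then have "lookup f j = 0" using k by (auto simp: in_keys_iff)
    then show ?thesis by (simp add: lookup_tuple_part)
  qed
qed

lemma syz_tuple_part:
  assumes w: "w \<in> syz"
  shows "tuple_part d n w \<in> syz"
proof -
  have kw: "keys w \<subseteq> {..<m}" using w by (simp add: syz_def)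
  show ?thesis
  proof (cases n)
    case 0
    then show ?thesis using w by (simp add: syz_def tuple_part_0 kw)
  next
    case (Suc k)
    have "keys (tuple_part d n w) \<subseteq> {..<m}"
      using keys_tuple_part[of d n w] kw by blast
    then show ?thesis using w unfolding Suc syz_def
      by (simp add: tuple_part_rdiv[OF kw] I_hom_part)
  qed
qed

end

section \<open>The filtered relation spaces of a deformation\<close>

locale deformed_relations = homogeneous_relations m r d
  for m :: nat and r :: "nat \<Rightarrow> ('x::finite, 'k::field) free_algebra" and d :: "nat \<Rightarrow> nat" +
  fixes l :: "nat \<Rightarrow> ('x, 'k) free_algebra"
  assumes l_deg: "i < m \<Longrightarrow> l i \<in> free_le (d i - 1)"
    and r_nonzero: "i < m \<Longrightarrow> r i \<noteq> 0"
begin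

definition p :: "nat \<Rightarrow> ('x, 'k) free_algebra" where "p i = r i + l i"

text \<open>
  The shape to which elements of \<open>V\<^sub>k\<^sub>+\<^sub>1\<close> are brought modulo \<open>V\<^sub>k\<close>.
\<close>

abbreviation combo :: "('x, 'k) tuples \<Rightarrow> ('x \<Rightarrow> ('x, 'k) free_algebra) \<Rightarrow> ('x, 'k) free_algebra" where
  "combo t Q \<equiv> (\<Sum>i<m. lookup t i * p i) + (\<Sum>x\<in>UNIV. Q x * gen x)"

text \<open>
  The image under \<open>z = 1\<close> of the degree \<open>n\<close> part of the ideal defining the central extension. The
  bound is on the degrees of the factors; after cancellation an element of \<open>V\<^sub>n\<close> may have a degree far
  below \<open>n\<close> without lying in a smaller \<open>V\<close>.
\<close>

inductive_set V :: "nat \<Rightarrow> ('x, 'k) free_algebra set" for n where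
  zero: "0 \<in> V n"
| add: "f \<in> V n \<Longrightarrow> g \<in> V n \<Longrightarrow> f + g \<in> V n"
| gen: "i < m \<Longrightarrow> u \<in> free_le a \<Longrightarrow> v \<in> free_le b \<Longrightarrow> a + d i + b \<le> n \<Longrightarrow> u * p i * v \<in> V n"

lemma p_free_le: "i < m \<Longrightarrow> p i \<in> free_le (d i)"
  unfolding p_def using free_le_mono[OF l_deg, of i "d i"] free_comp_free_le[OF r_homog, of i]
  by (auto intro: free_le_add)

lemma hom_part_p: "i < m \<Longrightarrow> hom_part (d i) (p i) = r i"
  using free_leD[OF l_deg, of i "d i"] d_ge[of i] hom_part_free_comp[OF r_homog, of i "d i"]
  by (simp add: p_def hom_part_add)

lemma V_free_le: "f \<in> V n \<Longrightarrow> f \<in> free_le n"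
  by (induction rule: V.induct)
    (auto intro: free_le_add free_le_mono[OF free_le_mult[OF free_le_mult[OF _ p_free_le]]])

lemma V_sum: "(\<And>a. a \<in> A \<Longrightarrow> f a \<in> V n) \<Longrightarrow> sum f A \<in> V n"
  by (induction A rule: infinite_finite_induct) (simp_all add: V.zero V.add)

lemma V_lmult: "f \<in> V n \<Longrightarrow> s \<in> free_le k \<Longrightarrow> k + n \<le> N \<Longrightarrow> s * f \<in> V N"
proof (induction rule: V.induct)
  case (gen i u a v b)
  have "(s * u) * p i * v \<in> V N"
    using gen by (intro V.gen[of i _ "k + a" _ b] free_le_mult) auto
  then show ?case by (simp add: mult.assoc)
qed (simp_all add: distrib_left V.zero V.add)

lemma V_rmult: "f \<in> V n \<Longrightarrow> s \<in> free_le k \<Longrightarrow> n + k \<le> N \<Longrightarrow> f * s \<in> V N"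
proof (induction rule: V.induct)
  case (gen i u a v b)
  have "u * p i * (v * s) \<in> V N"
    using gen by (intro V.gen[of i _ "a" _ "b + k"] free_le_mult) auto
  then show ?case by (simp add: mult.assoc)
qed (simp_all add: distrib_right V.zero V.add)

lemma V_uminus: "f \<in> V n \<Longrightarrow> - f \<in> V n"
  using V_lmult[of f n "-1" 0 n] free_le_uminus[OF free_comp_free_le[OF one_free_comp]] by simp

lemma V_diff: "f \<in> V n \<Longrightarrow> g \<in> V n \<Longrightarrow> f - g \<in> V n"
  using V.add[of f n "-g"] V_uminus[of g n] by simp

lemma V_p: "i < m \<Longrightarrow> u \<in> free_le a \<Longrightarrow> a + d i \<le> n \<Longrightarrow> u * p i \<in> V n"
  using V.gen[of i u a 1 0 n] free_comp_free_le[OF one_free_comp] by simp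

text \<open>
  Only the part of \<open>u\<close> of top degree matters in \<open>u p\<^sub>i\<close> modulo \<open>V\<^sub>k\<close>. If \<open>d\<^sub>i = k + 1\<close> then \<open>u\<close> is a
  constant, and there is no lower part.
\<close>

lemma V_lower:
  assumes "i < m" "u \<in> free_le (Suc k - d i)" "d i \<le> Suc k"
  shows "(u - hom_part (Suc k - d i) u) * p i \<in> V k"
proof (cases "Suc k - d i")
  case 0
  then have "u = hom_part 0 u" using sum_hom_part[of u 0] assms by simp
  then have "u - hom_part (Suc k - d i) u = 0" using 0 by simp
  then show ?thesis by (simp add: V.zero)
next
  case (Suc e)
  have "u - hom_part (Suc e) u \<in> free_le e"
  proof (rule free_leI)
    fix j assume "e < j"
    then show "hom_part j (u - hom_part (Suc e) u) = 0"
      using assms(2) Suc by (cases "j = Suc e") (auto simp: hom_part_diff hom_part_hom_part free_leD)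
  qed
  then show ?thesis using assms Suc by (intro V_p[of _ _ e]) auto
qed

lemma V_top: "f \<in> V n \<Longrightarrow> hom_part n f \<in> I"
proof (induction rule: V.induct)
  case (gen i u a v b)
  have m1: "u * p i \<in> free_le (a + d i)" using gen by (auto intro: free_le_mult p_free_le)
  show ?case
  proof (cases "a + d i + b = n")
    case True
    have "hom_part n (u * p i * v) = hom_part a u * r i * hom_part b v"
      using hom_part_mult_top[OF m1 gen(3)] hom_part_mult_top[OF gen(2) p_free_le[OF gen(1)]] True
      by (simp add: hom_part_p gen)
    then show ?thesis using gen by (simp add: I_lmult I_rmult I_incl)
  next
    case False
    then show ?thesis using free_leD[OF free_le_mult[OF m1 gen(3)], of n] gen by simp
  qed
qed (auto simp: hom_part_add I_add)

text \<open>
  Replacing \<open>r\<^sub>i\<close> by \<open>p\<^sub>i\<close> in an expression for a homogeneous element of \<open>I\<close> changes lower terms only.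
\<close>

lemma V_lift: "f \<in> I \<Longrightarrow> \<exists>b\<in>V n. hom_part n b = hom_part n f"
proof (induction f arbitrary: n rule: I_induct)
  case (incl s)
  then obtain i where i: "s = r i" "i < m" by auto
  show ?case
  proof (cases "n = d i")
    case True
    then show ?thesis using i V_p[OF i(2) free_comp_free_le[OF one_free_comp], of n]
      by (intro bexI[of _ "p i"]) (auto simp: hom_part_p hom_part_free_comp[OF r_homog])
  next
    case False
    then show ?thesis using i
      by (intro bexI[of _ 0]) (auto simp: hom_part_free_comp[OF r_homog] V.zero)
  qed
next
  case zero
  show ?case by (intro bexI[of _ 0]) (auto intro: V.zero)
next
  case (add a b)
  then obtain a' b' where "a' \<in> V n" "b' \<in> V n" "hom_part n a' = hom_part n a" "hom_part n b' = hom_part n b"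
    by metis
  then show ?case by (intro bexI[of _ "a' + b'"]) (auto simp: hom_part_add V.add)
next
  case (lmult u a)
  then obtain b where b: "\<And>k. b k \<in> V k" "\<And>k. hom_part k (b k) = hom_part k a" by metis
  let ?s = "\<Sum>i\<le>n. hom_part i u * b (n - i)"
  have "?s \<in> V n" by (intro V_sum V_lmult[OF b(1) hom_part_free_le]) auto
  moreover have "hom_part n ?s = hom_part n (u * a)"
    unfolding hom_part_mult[of n u a]
    by (simp add: hom_part_sum hom_part_homog_mult[OF hom_part_in_free_comp] b)
  ultimately show ?case by blast
next
  case (rmult a u)
  then obtain b where b: "\<And>k. b k \<in> V k" "\<And>k. hom_part k (b k) = hom_part k a" by metis
  let ?s = "\<Sum>i\<le>n. b i * hom_part (n - i) u"
  have "?s \<in> V n" by (intro V_sum V_rmult[OF b(1) hom_part_free_le]) auto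
  moreover have "hom_part n ?s = hom_part n (a * u)"
    unfolding hom_part_mult[of n a u]
    by (simp add: hom_part_sum hom_part_mult_homog[OF hom_part_in_free_comp] b)
  ultimately show ?case by blast
qed

text \<open>
  In \<open>u p\<^sub>i v\<close> split \<open>v\<close> into a constant and right multiples of variables. The constant part contributes
  to \<open>t\<close>, up to lower terms of \<open>u\<close>; the part \<open>v' x\<close> contributes \<open>u p\<^sub>i v'\<close> to \<open>Q x\<close>.
\<close>

lemma V_decomp:
  "q \<in> V (Suc k) \<Longrightarrow> \<exists>t Q q'. keys t \<subseteq> {..<m} \<and> tuple_part d (Suc k) t = t \<and>
     (\<forall>x. Q x \<in> V k) \<and> q' \<in> V k \<and>
     q = combo t Q + q'"
proof (induction rule: V.induct)
  case zero
  show ?case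
    by (rule exI[of _ 0], rule exI[of _ "\<lambda>_. 0"], rule exI[of _ 0]) (auto simp: V.zero)
next
  case (add f g)
  then obtain t Q q' s P p' where
    "keys t \<subseteq> {..<m}" "tuple_part d (Suc k) t = t" "\<forall>x. Q x \<in> V k" "q' \<in> V k"
    "f = combo t Q + q'"
    "keys s \<subseteq> {..<m}" "tuple_part d (Suc k) s = s" "\<forall>x. P x \<in> V k" "p' \<in> V k"
    "g = combo s P + p'"
    by blast
  then show ?case using keys_add[of t s]
    by (intro exI[of _ "t + s"] exI[of _ "\<lambda>x. Q x + P x"] exI[of _ "q' + p'"])
      (auto simp: tuple_part_add V.add lookup_add distrib_right sum.distrib)
next
  case (gen i u a v b)
  define u' where "u' = u * scal (const_coeff v)"
  have di: "d i \<le> Suc k" and "a \<le> Suc k - d i" using gen by auto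
  then have u': "u' \<in> free_le (Suc k - d i)"
    using free_le_mono[OF free_le_mult[OF gen(2) free_comp_free_le[OF scal_free_comp]], of "Suc k - d i" "const_coeff v"]
    by (simp add: u'_def)
  define t where "t = single i (hom_part (Suc k - d i) u')"
  have tk: "keys t \<subseteq> {..<m}" using gen by (simp add: t_def)
  have tp: "tuple_part d (Suc k) t = t"
    by (rule poly_mapping_eqI) (auto simp: lookup_tuple_part t_def lookup_single when_def hom_part_hom_part di)
  have tsum: "(\<Sum>j<m. lookup t j * p j) = hom_part (Suc k - d i) u' * p i"
  proof -
    have "(\<Sum>j<m. lookup t j * p j)
      = (\<Sum>j<m. if j = i then hom_part (Suc k - d i) u' * p i else 0)"
      by (intro sum.cong) (auto simp: t_def lookup_single when_def)
    then show ?thesis using gen by (simp add: sum.delta)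
  qed
  have Q: "u * p i * rdiv x v \<in> V k" for x
  proof (cases b)
    case 0
    then have "v = scal (const_coeff v)" using sum_hom_part[of v 0] gen by (simp add: hom_part_0)
    then have "rdiv x v = 0" by (metis rdiv_scal)
    then show ?thesis by (simp add: V.zero)
  next
    case (Suc b')
    then show ?thesis using gen rdiv_free_le[of v b' x] by (intro V.gen[of i u a _ b']) auto
  qed
  have "u * p i * v = u' * p i + (\<Sum>x\<in>UNIV. (u * p i * rdiv x v) * gen x)"
    by (subst rdiv_decomp[of v]) (simp add: u'_def distrib_left sum_distrib_left mult.assoc scal_central[of "p i"])
  then have "u * p i * v = (\<Sum>j<m. lookup t j * p j)
      + (\<Sum>x\<in>UNIV. (u * p i * rdiv x v) * gen x) + (u' - hom_part (Suc k - d i) u') * p i"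
    by (simp add: tsum left_diff_distrib)
  then show ?case using tk tp Q V_lower[OF gen(1) u' di]
    by (intro exI[of _ t] exI[of _ "\<lambda>x. u * p i * rdiv x v"]
        exI[of _ "(u' - hom_part (Suc k - d i) u') * p i"] conjI allI)
qed

text \<open>
  For the part \<open>t\<close> of \<open>f\<close> of degree \<open>k + 1\<close>, this says that \<open>\<Sum> t\<^sub>i p\<^sub>i\<close> can be moved into the span of the
  products \<open>q x\<close> with \<open>q \<in> V\<^sub>k\<close>, modulo \<open>V\<^sub>k\<close>.
\<close>

definition liftable :: "nat \<Rightarrow> ('x, 'k) tuples \<Rightarrow> bool" where
  "liftable k f \<longleftrightarrow> (\<exists>Q. (\<forall>x. Q x \<in> V k) \<and>
     combo (tuple_part d (Suc k) f) Q \<in> V k)"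

text \<open>
  Injectivity of multiplication by \<open>z\<close> on the degree \<open>k\<close> component of the central extension, after
  setting \<open>z = 1\<close>.
\<close>

definition reg :: "nat \<Rightarrow> bool" where
  "reg k \<longleftrightarrow> V (Suc k) \<inter> free_le k \<subseteq> V k"

lemma liftable_add: "liftable k f \<Longrightarrow> liftable k g \<Longrightarrow> liftable k (f + g)"
proof -
  assume "liftable k f" "liftable k g"
  then obtain Q P where "\<forall>x. Q x \<in> V k" "\<forall>x. P x \<in> V k"
     and 1: "combo (tuple_part d (Suc k) f) Q \<in> V k"
     "combo (tuple_part d (Suc k) g) P \<in> V k"
    unfolding liftable_def by blast
  then show ?thesis
    unfolding liftable_def using V.add[OF 1]
    by (intro exI[of _ "\<lambda>x. Q x + P x"])
       (auto simp: V.add tuple_part_add lookup_add distrib_right sum.distrib algebra_simps)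
qed

lemma liftable_zero: "liftable k 0"
  unfolding liftable_def by (rule exI[of _ "\<lambda>_. 0"]) (simp add: V.zero)

text \<open>
  The syzygy condition provides \<open>Q x \<in> V\<^sub>k\<close> with top part \<open>- \<Sum> t\<^sub>i (r\<^sub>i / x)\<close>. With this choice the
  combination lies in \<open>V\<^sub>k\<^sub>+\<^sub>1\<close> and its part of degree \<open>k + 1\<close> cancels, so that \<open>reg k\<close> applies to it.
\<close>

lemma liftable_syz:
  assumes w: "w \<in> syz" and reg: "reg k"
  shows "liftable k w"
proof -
  let ?w = "tuple_part d (Suc k) w"
  have "\<exists>q\<in>V k. hom_part k q = hom_part k (- (\<Sum>i<m. lookup w i * rdiv x (r i)))" for x
    using w by (intro V_lift) (auto simp: syz_def intro: I_uminus)
  then obtain Q where Q: "\<And>x. Q x \<in> V k"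
    and Qt: "\<And>x. hom_part k (Q x) = - hom_part k (\<Sum>i<m. lookup w i * rdiv x (r i))"
    unfolding hom_part_uminus by metis
  have Qw: "hom_part k (Q x) = - (\<Sum>i<m. lookup ?w i * rdiv x (r i))" for x
    unfolding Qt using w by (subst tuple_part_rdiv) (auto simp: syz_def)
  let ?z = "combo ?w Q"
  have wc: "lookup ?w i \<in> free_comp (Suc k - d i)" for i
    by (simp add: lookup_tuple_part)
  have zero: "d i > Suc k \<Longrightarrow> lookup ?w i = 0" for i
    by (simp add: lookup_tuple_part)
  have zV: "?z \<in> V (Suc k)"
  proof (intro V.add V_sum)
    fix i assume i: "i \<in> {..<m}"
    show "lookup ?w i * p i \<in> V (Suc k)"
    proof (cases "d i \<le> Suc k")
      case True
      then show ?thesis using i by (intro V_p[OF _ free_comp_free_le[OF wc]]) auto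
    qed (simp add: zero V.zero)
  next
    fix x show "Q x * gen x \<in> V (Suc k)"
      by (rule V_rmult[OF Q free_comp_free_le[OF gen_free_comp]]) simp
  qed
  have "hom_part (Suc k) (lookup ?w i * p i) = lookup ?w i * r i" if "i < m" for i
    using that by (cases "d i \<le> Suc k") (simp_all add: hom_part_homog_mult[OF wc] hom_part_p zero)
  then have "hom_part (Suc k) ?z
    = (\<Sum>i<m. lookup ?w i * r i) + (\<Sum>x\<in>UNIV. hom_part k (Q x) * gen x)"
    by (simp add: hom_part_add hom_part_sum hom_part_mult_homog[OF gen_free_comp])
  also have "(\<Sum>i<m. lookup ?w i * r i)
     = (\<Sum>x\<in>UNIV. (\<Sum>i<m. lookup ?w i * rdiv x (r i)) * gen x)"
    by (rule sum_r_rdiv)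
  also have "\<dots> + (\<Sum>x\<in>UNIV. hom_part k (Q x) * gen x) = 0"
    by (simp add: Qw sum_negf)
  finally have top: "hom_part (Suc k) ?z = 0" .
  have "?z \<in> free_le k"
  proof (rule free_leI)
    fix j assume "k < j"
    then show "hom_part j ?z = 0"
      using top free_leD[OF V_free_le[OF zV], of j] by (cases "j = Suc k") auto
  qed
  then have "?z \<in> V k" using zV reg by (auto simp: reg_def)
  then show ?thesis unfolding liftable_def using Q by blast
qed

text \<open>
  The part of degree \<open>k + 1\<close> of \<open>t w\<close> is a sum of products of parts of \<open>t\<close> of positive degree with parts
  of \<open>w\<close> of smaller degree. The latter are syzygies again, and they are liftable in their own degree.
\<close>

lemma liftable_smult:
  assumes t: "const_coeff t = 0" and w: "w \<in> syz" and reg: "\<And>j. j < k \<Longrightarrow> reg j"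
  shows "liftable k (tsmult t w)"
proof -
  have "\<exists>Q. (\<forall>x. Q x \<in> V k) \<and> combo (tsmult (hom_part a t) (tuple_part d (Suc k - a) w)) Q \<in> V k" if a: "a \<le> Suc k" for a
  proof (cases "a = 0 \<or> a = Suc k")
    case True
    then have "tsmult (hom_part a t) (tuple_part d (Suc k - a) w) = 0"
      using t w tuple_part_0[of w] by (auto simp: hom_part_0 syz_def)
    then show ?thesis by (intro exI[of _ "\<lambda>_. 0"]) (simp add: V.zero)
  next
    case False
    then have "0 < a" "a \<le> k" using a by auto
    then obtain k' where k': "Suc k - a = Suc k'" "k' < k" "k = a + k'"
      by (intro that[of "k - a"]) auto
    obtain Q where Q: "\<forall>x. Q x \<in> V k'"
      "combo (tuple_part d (Suc k') w) Q \<in> V k'"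
      using liftable_syz[OF w reg[OF k'(2)]] unfolding liftable_def by blast
    have "hom_part a t * (combo (tuple_part d (Suc k') w) Q) \<in> V k"
      by (rule V_lmult[OF Q(2) hom_part_free_le]) (simp add: k')
    then show ?thesis
      using Q(1) by (intro exI[of _ "\<lambda>x. hom_part a t * Q x"])
        (auto simp: k'(1) lookup_tsmult distrib_left sum_distrib_left mult.assoc k'(3)
          intro: V_lmult[OF _ hom_part_free_le])
  qed
  then have "\<forall>a. \<exists>Q. a \<le> Suc k \<longrightarrow> (\<forall>x. Q x \<in> V k) \<and>
      combo (tsmult (hom_part a t) (tuple_part d (Suc k - a) w)) Q \<in> V k" by blast
  from choice[OF this] obtain Q where
    "\<forall>a. a \<le> Suc k \<longrightarrow> (\<forall>x. Q a x \<in> V k) \<and>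
      combo (tsmult (hom_part a t) (tuple_part d (Suc k - a) w)) (Q a) \<in> V k" by (rule exE)
  then have Q: "\<And>a x. a \<le> Suc k \<Longrightarrow> Q a x \<in> V k"
    "\<And>a. a \<le> Suc k \<Longrightarrow> combo (tsmult (hom_part a t) (tuple_part d (Suc k - a) w)) (Q a) \<in> V k" by simp_all
  have "combo (tuple_part d (Suc k) (tsmult t w)) (\<lambda>x. \<Sum>a\<le>Suc k. Q a x)
     = (\<Sum>a\<le>Suc k. combo (tsmult (hom_part a t) (tuple_part d (Suc k - a) w)) (Q a))"
  proof -
    have "(\<Sum>i<m. lookup (tuple_part d (Suc k) (tsmult t w)) i * p i)
      = (\<Sum>a\<le>Suc k. \<Sum>i<m. lookup (tsmult (hom_part a t) (tuple_part d (Suc k - a) w)) i * p i)"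
      unfolding tuple_part_tsmult lookup_sum sum_distrib_right by (rule sum.swap)
    moreover have "(\<Sum>x\<in>UNIV. (\<Sum>a\<le>Suc k. Q a x) * gen x) = (\<Sum>a\<le>Suc k. \<Sum>x\<in>UNIV. Q a x * gen x)"
      unfolding sum_distrib_right by (rule sum.swap)
    ultimately show ?thesis by (simp only: sum.distrib)
  qed
  also have "\<dots> \<in> V k" by (intro V_sum Q) auto
  finally have *: "combo (tuple_part d (Suc k) (tsmult t w)) (\<lambda>x. \<Sum>a\<le>Suc k. Q a x) \<in> V k" .
  have "(\<Sum>a\<le>Suc k. Q a x) \<in> V k" for x by (intro V_sum Q) auto
  with * show ?thesis unfolding liftable_def
    by (intro exI[of _ "\<lambda>x. \<Sum>a\<le>Suc k. Q a x"] conjI allI)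
qed

text \<open>
  If \<open>b \<in> V\<close> has the same top part as the coefficient \<open>y\<close> of \<open>e\<^sub>i\<close>, then \<open>y p\<^sub>i \<equiv> b p\<^sub>i \<equiv> b r\<^sub>i\<close> modulo \<open>V\<^sub>k\<close>,
  because \<open>b l\<^sub>i \<in> V\<^sub>k\<close>; and \<open>b r\<^sub>i = \<Sum> b (r\<^sub>i / x) x\<close> has the required form.
\<close>

lemma liftable_tupI:
  assumes "f \<in> tupI {..<m}"
  shows "liftable k f"
proof -
  let ?f = "lookup (tuple_part d (Suc k) f)"
  have "\<exists>b \<in> V (Suc k - d i). hom_part (Suc k - d i) b = hom_part (Suc k - d i) (lookup f i)" for i
    using assms by (intro V_lift) (auto simp: tupI_def)
  then obtain b where b: "\<And>i. b i \<in> V (Suc k - d i)"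
     "\<And>i. hom_part (Suc k - d i) (b i) = hom_part (Suc k - d i) (lookup f i)" by metis
  define c where "c i = (if d i \<le> Suc k then b i else 0)" for i
  define Q where "Q x = - (\<Sum>i<m. c i * rdiv x (r i))" for x
  have Q: "Q x \<in> V k" for x
    unfolding Q_def
  proof (intro V_uminus V_sum)
    fix i assume i: "i \<in> {..<m}"
    then have "2 \<le> d i" using d_ge by simp
    then show "c i * rdiv x (r i) \<in> V k"
      using i by (auto simp: c_def V.zero intro!: V_rmult[OF b(1) free_comp_free_le[OF rdiv_r_homog]])
  qed
  have "(\<Sum>x\<in>UNIV. Q x * gen x) = - (\<Sum>x\<in>UNIV. (\<Sum>i<m. c i * rdiv x (r i)) * gen x)"
    by (simp add: Q_def sum_negf)
  also have "\<dots> = - (\<Sum>i<m. c i * r i)"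
    by (simp only: sum_r_rdiv)
  finally have "(\<Sum>i<m. ?f i * p i) + (\<Sum>x\<in>UNIV. Q x * gen x) = (\<Sum>i<m. ?f i * p i - c i * r i)"
    by (simp add: sum_subtractf)
  also have "\<dots> \<in> V k"
  proof (rule V_sum)
    fix i assume "i \<in> {..<m}"
    then have i: "i < m" by simp
    show "?f i * p i - c i * r i \<in> V k"
    proof (cases "d i \<le> Suc k")
      case True
      have "?f i = hom_part (Suc k - d i) (b i)" using True by (simp add: lookup_tuple_part b)
      then have "?f i * p i - c i * r i = b i * l i - (b i - hom_part (Suc k - d i) (b i)) * p i"
        using True by (simp add: c_def p_def algebra_simps)
      moreover have "b i * l i \<in> V k"
        using True d_ge[OF i] by (intro V_rmult[OF b(1) l_deg[OF i]]) auto
      ultimately show ?thesis using V_lower[OF i V_free_le[OF b(1)] True] by (simp add: V_diff)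
    next
      case False
      then show ?thesis by (simp add: lookup_tuple_part c_def V.zero)
    qed
  qed
  finally show ?thesis unfolding liftable_def using Q by blast
qed

lemma liftable_decomposable:
  assumes "f \<in> decomposable" "\<And>j. j < k \<Longrightarrow> reg j"
  shows "liftable k f"
  using assms(1)
proof induction
  case (smult t w)
  then show ?case using assms(2) by (rule liftable_smult)
qed (simp_all add: liftable_zero liftable_add liftable_tupI)

text \<open>
  The induction step described at the top: the coefficients of \<open>q\<close> at the variables drop to degree
  below \<open>k\<close> once the syzygy part is removed, and \<open>reg (k - 1)\<close> puts them into \<open>V\<^sub>k\<^sub>-\<^sub>1\<close>.
\<close>

lemma reg_step:
  assumes IH: "\<And>j. j < k \<Longrightarrow> reg j" and "0 < k"
    and W: "\<And>w. w \<in> syz \<Longrightarrow> tuple_part d (Suc k) w = w \<Longrightarrow> w \<in> decomposable"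
  shows "reg k"
  unfolding reg_def
proof safe
  fix q assume q: "q \<in> V (Suc k)" and qk: "q \<in> free_le k"
  obtain t Q q' where t: "keys t \<subseteq> {..<m}" "tuple_part d (Suc k) t = t"
    and Q: "\<And>x. Q x \<in> V k" and q': "q' \<in> V k" and
    qe: "q = combo t Q + q'"
    using V_decomp[OF q] by blast
  have tc: "lookup t i \<in> free_comp (Suc k - d i)" for i
    by (subst t(2)[symmetric]) (simp add: lookup_tuple_part)
  have tz: "d i > Suc k \<Longrightarrow> lookup t i = 0" for i
    by (subst t(2)[symmetric]) (simp add: lookup_tuple_part)
  have tp: "hom_part (Suc k) (lookup t i * p i) = lookup t i * r i" if "i < m" for i
    using that by (cases "d i \<le> Suc k") (simp_all add: hom_part_homog_mult[OF tc] hom_part_p tz)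
  have "hom_part (Suc k) q = (\<Sum>i<m. lookup t i * r i) + (\<Sum>x\<in>UNIV. hom_part k (Q x) * gen x)"
    using free_leD[OF V_free_le[OF q'], of "Suc k"]
    by (simp add: qe hom_part_add hom_part_sum hom_part_mult_homog[OF gen_free_comp] tp)
  then have "(\<Sum>i<m. lookup t i * r i) = - (\<Sum>x\<in>UNIV. hom_part k (Q x) * gen x)"
    using free_leD[OF qk, of "Suc k"] by (simp add: eq_neg_iff_add_eq_0)
  then have "rdiv x (\<Sum>i<m. lookup t i * r i) = - hom_part k (Q x)" for x
    by (simp add: rdiv_uminus rdiv_sum_gen)
  then have "(\<Sum>i<m. lookup t i * rdiv x (r i)) = - hom_part k (Q x)" for x
    by (simp add: rdiv_sum rdiv_r)
  moreover have "- hom_part k (Q x) \<in> I" for x by (rule I_uminus[OF V_top[OF Q]])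
  ultimately have "t \<in> syz" using t(1) by (simp add: syz_def)
  from liftable_decomposable[OF W[OF this t(2)] IH] have "liftable k t" .
  then have "\<exists>P. (\<forall>x. P x \<in> V k) \<and>
     combo t P \<in> V k"
    unfolding liftable_def t(2) .
  then obtain P where P: "\<And>x. P x \<in> V k"
     "combo t P \<in> V k" (is "?z \<in> _")
    by blast
  define s where "s = (\<Sum>x\<in>UNIV. (Q x - P x) * gen x)"
  have qs: "q = s + (?z + q')"
    by (simp add: qe s_def left_diff_distrib sum_subtractf)
  have zq: "?z + q' \<in> V k" using P(2) q' by (rule V.add)
  have "s = q - (?z + q')" unfolding qs by (simp only: add_diff_cancel_right')
  then have sk: "s \<in> free_le k" using free_le_diff[OF qk V_free_le[OF zq]] by (simp only:)
  have QP: "Q x - P x \<in> V (k - 1)" for x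
  proof -
    have "Q x - P x = rdiv x s" by (simp add: s_def rdiv_sum_gen)
    then have "Q x - P x \<in> free_le (k - 1)" using rdiv_free_le[of s "k - 1" x] sk \<open>0 < k\<close> by simp
    moreover have "Q x - P x \<in> V k" using Q P by (simp add: V_diff)
    ultimately show ?thesis using IH[of "k - 1"] \<open>0 < k\<close> by (auto simp: reg_def)
  qed
  have sV: "s \<in> V k" unfolding s_def
    using \<open>0 < k\<close> by (intro V_sum V_rmult[OF QP free_comp_free_le[OF gen_free_comp]]) simp
  show "q \<in> V k" using V.add[OF sV zq] by (simp only: qs)
qed

theorem reg_all:
  assumes low: "\<And>k. k \<le> c \<Longrightarrow> reg k"
    and W: "\<And>n w. n > c + 1 \<Longrightarrow> w \<in> syz \<Longrightarrow> tuple_part d n w = w \<Longrightarrow> w \<in> decomposable"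
  shows "reg k"
proof (induction k rule: less_induct)
  case (less k)
  show ?case
  proof (cases "k \<le> c")
    case False
    show ?thesis
    proof (rule reg_step)
      show "reg j" if "j < k" for j using that by (rule less)
      show "0 < k" using False by simp
      show "w \<in> decomposable" if "w \<in> syz" "tuple_part d (Suc k) w = w" for w
        using W[OF _ that] False by simp
    qed
  next
    case True
    then show ?thesis by (rule low)
  qed
qed

end


section \<open>Quotients of a ring type\<close>

locale ring_type_ideal =
  fixes J :: "'a::ring_1 set"
  assumes J_ideal: "ideal J ring_of_type_algebra"
begin

abbreviation cls :: "'a \<Rightarrow> 'a set" where "cls t \<equiv> J +>\<^bsub>ring_of_type_algebra\<^esub> t"
abbreviation Q :: "'a set ring" where "Q \<equiv> ring_of_type_algebra Quot J"

sublocale J: ideal J "ring_of_type_algebra :: 'a ring" by (rule J_ideal)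

lemma zero_mem: "0 \<in> J"
  using additive_subgroup.zero_closed[OF ideal.axioms(1)[OF J_ideal]] by simp

lemma add_mem: "a \<in> J \<Longrightarrow> b \<in> J \<Longrightarrow> a + b \<in> J"
  using additive_subgroup.a_closed[OF ideal.axioms(1)[OF J_ideal], of a b] by simp

lemma uminus_mem: "a \<in> J \<Longrightarrow> - a \<in> J"
  using ideal.I_l_closed[OF J_ideal, of a "-1"] by simp

lemma Q_ring: "ring Q" by (rule J.quotient_is_ring)

lemma Q_carrier: "carrier Q = range cls"
  by (auto simp: FactRing_def A_RCOSETS_def')

lemma Q_mult: "cls a \<otimes>\<^bsub>Q\<^esub> cls b = cls (a * b)"
  using J.rcoset_mult_add[of a b] by (simp add: FactRing_def)

lemma Q_add: "cls a \<oplus>\<^bsub>Q\<^esub> cls b = cls (a + b)"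
  using J.a_rcos_sum[of a b] by (simp add: FactRing_def)

lemma cls_mem: "b \<in> cls a \<longleftrightarrow> b - a \<in> J"
  by (auto simp: a_r_coset_def' ) (metis diff_add_cancel)

lemma cls_eq: "cls a = cls b \<longleftrightarrow> a - b \<in> J"
proof
  assume "cls a = cls b"
  moreover have "a \<in> cls a" by (simp add: cls_mem zero_mem)
  ultimately show "a - b \<in> J" by (simp add: cls_mem)
next
  assume ab: "a - b \<in> J"
  have "t - a \<in> J \<longleftrightarrow> t - b \<in> J" for t
  proof
    assume "t - a \<in> J" from add_mem[OF this ab] show "t - b \<in> J" by simp
  next
    assume "t - b \<in> J"
    then have "(t - b) + - (a - b) \<in> J" using uminus_mem[OF ab] by (rule add_mem)
    then show "t - a \<in> J" by simp
  qed
  then show "cls a = cls b" by (auto simp: cls_mem)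
qed

lemma Q_zero: "\<zero>\<^bsub>Q\<^esub> = cls 0"
proof -
  have "cls 0 = J" by (auto simp: cls_mem)
  then show ?thesis by (simp add: FactRing_def)
qed

lemma Q_one: "\<one>\<^bsub>Q\<^esub> = cls 1"
  by (simp add: FactRing_def)

lemma cls_zero_iff: "cls a = \<zero>\<^bsub>Q\<^esub> \<longleftrightarrow> a \<in> J"
  by (simp add: Q_zero cls_eq)

lemma cls_in_carrier [simp]: "cls a \<in> carrier Q"
  by (simp add: Q_carrier)

end

lemma ring_type_ideal_Idl: "ring_type_ideal (Idl\<^bsub>ring_of_type_algebra\<^esub> S)"
  by (rule ring_type_ideal.intro[OF ideal_Idl])

section \<open>Homogenization\<close>

text \<open>
  The degree \<open>k\<close> component of \<open>F \<in> T[z]\<close>, evaluated at \<open>z = 1\<close>. Its inverse on polynomials of degree at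
  most \<open>k\<close> is \<open>hom_to k\<close>.
\<close>

definition dehom :: "nat \<Rightarrow> ('x, 'k::field) free_algebra_z \<Rightarrow> ('x, 'k) free_algebra" where
  "dehom k F = (\<Sum>i\<le>k. hom_part (k - i) (lookup F i))"

definition hom_to :: "nat \<Rightarrow> ('x, 'k::field) free_algebra \<Rightarrow> ('x, 'k) free_algebra_z" where
  "hom_to k f = (\<Sum>i\<le>k. single (k - i) (hom_part i f))"

lemma lookup_dehom: "lookup (dehom k F) w
  = (if length w \<le> k then lookup (lookup F (k - length w)) w else 0)"
proof -
  have "lookup (dehom k F) w
    = (\<Sum>i\<le>k. if i = k - length w \<and> length w \<le> k then lookup (lookup F i) w else 0)"
    by (auto simp: dehom_def lookup_sum lookup_hom_part intro!: sum.cong)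
  also have "\<dots> = (if length w \<le> k then (\<Sum>i\<le>k. if i = k - length w then lookup (lookup F i) w else 0) else 0)"
    by auto
  finally show ?thesis by (simp add: sum.delta)
qed

lemma lookup_hom_to: "lookup (lookup (hom_to k f) j) w
  = (if j + length w = k then lookup f w else 0)"
proof -
  have "lookup (lookup (hom_to k f) j) w
    = (\<Sum>i\<le>k. if i = length w then (if j + length w = k then lookup f w else 0) else 0)"
    unfolding hom_to_def lookup_sum
    by (rule sum.cong) (auto simp: lookup_hom_part lookup_single when_def)
  then show ?thesis by (auto simp: sum.delta)
qed

lemma dehom_add: "dehom k (F + G) = dehom k F + dehom k G"
  by (simp add: dehom_def lookup_add hom_part_add sum.distrib)

lemma dehom_zero [simp]: "dehom k 0 = 0"
  by (simp add: dehom_def)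

lemma dehom_sum: "dehom k (sum f A) = (\<Sum>a\<in>A. dehom k (f a))"
  by (induction A rule: infinite_finite_induct) (simp_all add: dehom_add)

lemma dehom_single: "dehom k (single i (single w c))
  = (if i + length w = k then single w c else 0)"
  by (rule poly_mapping_eqI) (auto simp: lookup_dehom lookup_single when_def)

text \<open>
  No information is lost: \<open>z\<^sup>i w\<close> is recovered from the word \<open>w\<close> in degree \<open>i + |w|\<close>. Identities in \<open>T[z]\<close> can
  therefore be checked after \<open>dehom\<close>.
\<close>

lemma dehom_inject: "(\<And>k. dehom k F = dehom k G) \<Longrightarrow> F = G"
proof (intro poly_mapping_eqI)
  fix i w assume *: "\<And>k. dehom k F = dehom k G"
  show "lookup (lookup F i) w = lookup (lookup G i) w"
    using lookup_dehom[of "i + length w" F w] lookup_dehom[of "i + length w" G w] * by simp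
qed

lemma dehom_free_le: "dehom k F \<in> free_le k"
  by (auto simp: free_le_def poly_mapping_eq_iff fun_eq_iff lookup_hom_part lookup_dehom)

lemma dehom_hom_to: "f \<in> free_le k \<Longrightarrow> dehom j (hom_to k f) = (if j = k then f else 0)"
proof (rule poly_mapping_eqI)
  fix w assume "f \<in> free_le k"
  then have "lookup f w = 0" if "length w > k"
    using free_leD[of f k "length w"] lookup_hom_part[of "length w" f w] that by simp
  then show "lookup (dehom j (hom_to k f)) w = lookup (if j = k then f else 0) w"
    by (auto simp: lookup_dehom lookup_hom_to)
qed

lemma free_z_induct [case_names zero single add]:
  fixes F :: "('x, 'k::field) free_algebra_z"
  assumes "P 0" "\<And>i w c. P (single i (single w c))"
    "\<And>F G. P F \<Longrightarrow> P G \<Longrightarrow> P (F + G)"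
  shows "P F"
proof (induction F rule: poly_mapping_additive_induct)
  case (single i u)
  show ?case
    by (induction u rule: poly_mapping_additive_induct) (simp_all add: assms single_add)
qed (simp_all add: assms)

lemma dehom_mult: "dehom n (F * G) = (\<Sum>a\<le>n. dehom a F * dehom (n - a) G)"
proof (induction F rule: free_z_induct)
  case (single i v c)
  show ?case
  proof (induction G rule: free_z_induct)
    case (single j w e)
    have "(\<Sum>a\<le>n. dehom a (single i (single v c))
         * dehom (n - a) (single j (single w e)))
      = (\<Sum>a\<le>n. if a = i + length v
           then dehom n (single (i + j) (single (v @ w) (c * e))) else 0)"
      by (rule sum.cong) (auto simp: dehom_single mult_single plus_list_def)
    then show ?case
      by (auto simp: dehom_single mult_single plus_list_def sum.delta)
  qed (simp_all add: dehom_add distrib_left sum.distrib)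
qed (simp_all add: dehom_add distrib_right sum.distrib)

lemma hom_to_add: "hom_to k (f + g) = hom_to k f + hom_to k g"
  by (simp add: hom_to_def hom_part_add single_add sum.distrib)

lemma hom_to_zero [simp]: "hom_to k 0 = 0"
  by (simp add: hom_to_def)

lemma hom_to_mult:
  assumes "f \<in> free_le a" "g \<in> free_le b"
  shows "hom_to (a + b) (f * g) = hom_to a f * hom_to b g"
proof (rule dehom_inject)
  fix k
  have "(\<Sum>c\<le>k. dehom c (hom_to a f) * dehom (k - c) (hom_to b g))
    = (\<Sum>c\<le>k. if c = a then (if k = a + b then f * g else 0) else 0)"
    by (rule sum.cong) (auto simp: dehom_hom_to[OF assms(1)] dehom_hom_to[OF assms(2)])
  then show "dehom k (hom_to (a + b) (f * g)) = dehom k (hom_to a f * hom_to b g)"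
    by (auto simp: dehom_mult dehom_hom_to[OF free_le_mult[OF assms]] sum.delta)
qed

lemma dehom_bounded: "\<exists>N. \<forall>k>N. dehom k F = 0"
proof (induction F rule: free_z_induct)
  case (single i w c)
  show ?case by (rule exI[of _ "i + length w"]) (simp add: dehom_single)
next
  case (add F G)
  then obtain N M where "\<forall>k>N. dehom k F = 0" "\<forall>k>M. dehom k G = 0" by blast
  then show ?case by (intro exI[of _ "max N M"]) (simp add: dehom_add)
qed simp

lemma hom_to_dehom: "\<exists>N. F = (\<Sum>k\<le>N. hom_to k (dehom k F))"
proof -
  obtain N where N: "\<And>k. k > N \<Longrightarrow> dehom k F = 0" using dehom_bounded[of F] by blast
  have "F = (\<Sum>k\<le>N. hom_to k (dehom k F))"
  proof (rule dehom_inject)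
    fix j
    show "dehom j F = dehom j (\<Sum>k\<le>N. hom_to k (dehom k F))"
      using N[of j] by (auto simp: dehom_sum dehom_hom_to[OF dehom_free_le] sum.delta)
  qed
  then show ?thesis ..
qed

lemma homogenize_hom_to: "homogenize f = hom_to (free_deg f) f"
  by (simp add: homogenize_def hom_to_def)

lemma dehom_z_var: "dehom k (z_var :: ('x, 'k::field) free_algebra_z) = (if k = 1 then 1 else 0)"
proof -
  have "(z_var :: ('x, 'k) free_algebra_z) = single 1 (single [] 1)"
    by (simp add: z_var_def single_Nil_one)
  moreover have "dehom k (single 1 (single [] 1))
      = (if k = 1 then 1 else (0 :: ('x, 'k) free_algebra))"
    unfolding dehom_single by (auto simp: single_Nil_one)
  ultimately show ?thesis by simp
qed

lemma dehom_z_mult: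
  "dehom 0 (z_var * F) = 0" "dehom (Suc k) (z_var * F) = dehom k F"
  "dehom 0 (F * z_var) = 0" "dehom (Suc k) (F * z_var) = dehom k F"
proof -
  show "dehom 0 (z_var * F) = 0" "dehom 0 (F * z_var) = 0"
    by (simp_all add: dehom_mult dehom_z_var)
  have "dehom (Suc k) (z_var * F) = (\<Sum>a\<le>Suc k. if a = 1 then dehom k F else 0)"
    unfolding dehom_mult by (rule sum.cong) (auto simp: dehom_z_var)
  then show "dehom (Suc k) (z_var * F) = dehom k F" by (simp only: sum.delta finite_atMost) simp
  have "dehom (Suc k) (F * z_var) = (\<Sum>a\<le>Suc k. if a = k then dehom k F else 0)"
    unfolding dehom_mult by (rule sum.cong) (auto simp: dehom_z_var)
  then show "dehom (Suc k) (F * z_var) = dehom k F" by (simp only: sum.delta finite_atMost) simp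
qed

lemma free_z_comp_iff: "F \<in> free_z_comp k \<longleftrightarrow> (\<forall>j. j \<noteq> k \<longrightarrow> dehom j F = 0)"
proof -
  have "F \<in> free_z_comp k \<longleftrightarrow>
      (\<forall>i w. lookup (lookup F i) w \<noteq> 0 \<longrightarrow> i + length w = k)"
    unfolding free_z_comp_def mem_Collect_eq
    by (metis (no_types, lifting) lookup_zero in_keys_iff)
  also have "\<dots> \<longleftrightarrow> (\<forall>j w. j \<noteq> k \<longrightarrow> lookup (dehom j F) w = 0)"
  proof safe
    fix i w assume *: "\<forall>j w. j \<noteq> k \<longrightarrow> lookup (dehom j F) w = 0"
      and "lookup (lookup F i) w \<noteq> 0"
    then show "i + length w = k"
      using *[rule_format, of "i + length w" w] by (auto simp: lookup_dehom)
  next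
    fix j w assume "\<forall>i w. lookup (lookup F i) w \<noteq> 0 \<longrightarrow> i + length w = k" "j \<noteq> k"
    then show "lookup (dehom j F) w = 0"
      unfolding lookup_dehom by (metis le_add_diff_inverse2)
  qed
  also have "\<dots> \<longleftrightarrow> (\<forall>j. j \<noteq> k \<longrightarrow> dehom j F = 0)"
    by (auto simp: poly_mapping_eq_iff fun_eq_iff)
  finally show ?thesis .
qed

section \<open>Regularity of the central variable\<close>

context deformed_relations
begin

abbreviation H :: "('x, 'k) free_algebra_z set" where "H \<equiv> ext_ideal m r l"

lemma p_deg: "i < m \<Longrightarrow> free_deg (r i + l i) = d i"
proof -
  assume i: "i < m"
  have "free_deg (p i) \<le> d i" by (rule free_deg_least[OF p_free_le[OF i]])
  moreover have "\<not> free_deg (p i) < d i"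
    using free_leD[OF free_deg_le, of "p i" "d i"] hom_part_p[OF i] r_nonzero[OF i] by auto
  ultimately show ?thesis by (simp add: p_def)
qed

lemma homogenize_p: "i < m \<Longrightarrow> homogenize (r i + l i) = hom_to (d i) (p i)"
  by (simp add: homogenize_hom_to p_deg p_def)

lemma H_dehom: "F \<in> H \<Longrightarrow> dehom k F \<in> V k"
  unfolding ext_ideal_def
proof (induction F arbitrary: k rule: Idl_induct)
  case (incl s)
  then obtain i where i: "i < m" "s = hom_to (d i) (p i)" by (auto simp: homogenize_p)
  have "p i \<in> V (d i)"
    using V_p[OF i(1) free_comp_free_le[OF one_free_comp], of "d i"] by simp
  with i show ?case
    by (simp add: dehom_hom_to[OF p_free_le] V.zero)
next
  case zero
  show ?case by (simp add: V.zero)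
next
  case (add a b)
  then show ?case by (simp add: dehom_add V.add)
next
  case (lmult a b)
  show ?case unfolding dehom_mult
    by (intro V_sum V_lmult[OF lmult dehom_free_le]) simp
next
  case (rmult a b)
  show ?case unfolding dehom_mult
    by (intro V_sum V_rmult[OF rmult dehom_free_le]) simp
qed

text \<open>
  The slack \<open>k - (a + d\<^sub>i + b)\<close> of a generator \<open>u p\<^sub>i v\<close> becomes a power of \<open>z\<close>.
\<close>

lemma V_hom_to: "f \<in> V k \<Longrightarrow> hom_to k f \<in> H"
proof (induction rule: V.induct)
  case zero
  show ?case unfolding ext_ideal_def by (simp add: Idl_zero)
next
  case (add f g)
  then show ?case unfolding ext_ideal_def by (simp add: hom_to_add Idl_add)
next
  case (gen i u a v b)
  let ?e = "k - (a + d i + b)"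
  have up: "u * p i \<in> free_le (a + d i)" by (rule free_le_mult[OF gen(2) p_free_le[OF gen(1)]])
  have "hom_to k (u * p i * v) = hom_to (?e + (a + d i + b)) (1 * (u * p i * v))" using gen by simp
  also have "\<dots> = hom_to ?e 1 * (hom_to a u * hom_to (d i) (p i) * hom_to b v)"
    by (simp only: hom_to_mult[OF free_le_mono[OF free_comp_free_le[OF one_free_comp] le0] free_le_mult[OF up gen(3)]]
        hom_to_mult[OF up gen(3)] hom_to_mult[OF gen(2) p_free_le[OF gen(1)]])
  also have "\<dots> \<in> H" unfolding ext_ideal_def using gen(1)
    by (intro Idl_lmult Idl_rmult Idl_incl) (auto simp: homogenize_p)
  finally show ?case .
qed

lemma H_iff: "F \<in> H \<longleftrightarrow> (\<forall>k. dehom k F \<in> V k)"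
proof
  assume "\<forall>k. dehom k F \<in> V k"
  then have *: "hom_to k (dehom k F) \<in> H" for k by (simp add: V_hom_to)
  obtain N where N: "F = (\<Sum>k\<le>N. hom_to k (dehom k F))" using hom_to_dehom[of F] by blast
  have "(\<Sum>k\<le>N. hom_to k (dehom k F)) \<in> H"
    using * unfolding ext_ideal_def by (intro Idl_sum)
  then show "F \<in> H" using N by simp
qed (simp add: H_dehom)

lemma z_mult_H: "z_var * F \<in> H \<longleftrightarrow> (\<forall>k. dehom k F \<in> V (Suc k))"
  "F * z_var \<in> H \<longleftrightarrow> (\<forall>k. dehom k F \<in> V (Suc k))"
proof -
  have *: "(\<forall>k. P k) \<longleftrightarrow> P 0 \<and> (\<forall>k. P (Suc k))" for P :: "nat \<Rightarrow> bool"
  proof safe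
    fix k assume "P 0" "\<forall>k. P (Suc k)"
    then show "P k" by (cases k) simp_all
  qed simp_all
  show "z_var * F \<in> H \<longleftrightarrow> (\<forall>k. dehom k F \<in> V (Suc k))"
    "F * z_var \<in> H \<longleftrightarrow> (\<forall>k. dehom k F \<in> V (Suc k))"
    unfolding H_iff by (subst *, simp add: dehom_z_mult V.zero)+
qed

sublocale H: ring_type_ideal H
  unfolding ext_ideal_def by (rule ring_type_ideal_Idl)

lemma not_zero_divisor_upto_iff:
  "not_zero_divisor_upto (central_ext m r l) (central_ext_comp m r l) c (central_ext_z m r l)
    \<longleftrightarrow> (\<forall>k\<le>c. reg k)"
proof
  assume nz: "not_zero_divisor_upto (central_ext m r l) (central_ext_comp m r l) c (central_ext_z m r l)"
  show "\<forall>k\<le>c. reg k"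
    unfolding reg_def
  proof safe
    fix k f assume k: "k \<le> c" and f: "f \<in> V (Suc k)" "f \<in> free_le k"
    let ?F = "hom_to k f"
    have "?F \<in> free_z_comp k" by (simp add: free_z_comp_iff dehom_hom_to[OF f(2)])
    then have mem: "H.cls ?F \<in> central_ext_comp m r l k"
      by (simp add: central_ext_comp_def quot_comp_def)
    have "z_var * ?F \<in> H" using f by (simp add: z_mult_H dehom_hom_to V.zero)
    then have "central_ext_z m r l \<otimes>\<^bsub>central_ext m r l\<^esub> H.cls ?F = \<zero>\<^bsub>central_ext m r l\<^esub>"
      by (simp add: central_ext_z_def central_ext_def H.Q_mult H.cls_zero_iff)
    then have "H.cls ?F = \<zero>\<^bsub>central_ext m r l\<^esub>"
      using nz k mem unfolding not_zero_divisor_upto_def by blast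
    then have "?F \<in> H" by (simp add: central_ext_def H.cls_zero_iff)
    then have "dehom k ?F \<in> V k" by (rule H_dehom)
    then show "f \<in> V k" by (simp add: dehom_hom_to[OF f(2)])
  qed
next
  assume reg: "\<forall>k\<le>c. reg k"
  show "not_zero_divisor_upto (central_ext m r l) (central_ext_comp m r l) c (central_ext_z m r l)"
    unfolding not_zero_divisor_upto_def
  proof clarify
    fix k x assume k: "k \<le> c" and x: "x \<in> central_ext_comp m r l k" "x \<noteq> \<zero>\<^bsub>central_ext m r l\<^esub>"
      and zx: "central_ext_z m r l \<otimes>\<^bsub>central_ext m r l\<^esub> x = \<zero>\<^bsub>central_ext m r l\<^esub>"
    obtain F where F: "F \<in> free_z_comp k" "x = H.cls F"
      using x by (auto simp: central_ext_comp_def quot_comp_def)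
    have "z_var * F \<in> H" using zx F
      by (simp add: central_ext_z_def central_ext_def H.Q_mult H.cls_zero_iff)
    then have "dehom k F \<in> V (Suc k)" by (simp add: z_mult_H)
    then have kk: "dehom k F \<in> V k" using reg k dehom_free_le[of k F] by (auto simp: reg_def)
    have "dehom j F \<in> V j" for j
      using F(1) kk by (cases "j = k") (simp_all add: free_z_comp_iff V.zero)
    then have "F \<in> H" by (simp add: H_iff)
    then show False using x F by (simp add: central_ext_def H.cls_zero_iff)
  qed
qed

lemma regular_element_iff:
  "regular_element (central_ext m r l) (central_ext_z m r l) \<longleftrightarrow> (\<forall>k. reg k)"
proof
  assume reg: "regular_element (central_ext m r l) (central_ext_z m r l)"
  have "not_zero_divisor_upto (central_ext m r l) (central_ext_comp m r l) c (central_ext_z m r l)" for c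
    unfolding not_zero_divisor_upto_def
  proof clarify
    fix k x assume "x \<in> central_ext_comp m r l k" and x: "x \<noteq> \<zero>\<^bsub>central_ext m r l\<^esub>"
      "central_ext_z m r l \<otimes>\<^bsub>central_ext m r l\<^esub> x = \<zero>\<^bsub>central_ext m r l\<^esub>"
    then obtain F where "x = H.cls F" by (auto simp: central_ext_comp_def quot_comp_def)
    then have "x \<in> carrier (central_ext m r l)" by (simp add: central_ext_def)
    then show False using reg x by (simp add: regular_element_def)
  qed
  then have "\<forall>k\<le>c. reg k" for c by (simp only: not_zero_divisor_upto_iff)
  then show "\<forall>k. reg k" by blast
next
  assume reg: "\<forall>k. reg k"
  have F: "F \<in> H" if *: "\<forall>k. dehom k F \<in> V (Suc k)" for F
    unfolding H_iff
  proof
    fix k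
    have "dehom k F \<in> V (Suc k) \<inter> free_le k" using * dehom_free_le by simp
    then show "dehom k F \<in> V k" using reg unfolding reg_def by (metis subsetD)
  qed
  show "regular_element (central_ext m r l) (central_ext_z m r l)"
    unfolding regular_element_def
  proof (intro conjI ballI impI)
    show "central_ext_z m r l \<in> carrier (central_ext m r l)"
      by (simp add: central_ext_z_def central_ext_def)
    fix x assume "x \<in> carrier (central_ext m r l)"
      and x: "central_ext_z m r l \<otimes>\<^bsub>central_ext m r l\<^esub> x = \<zero>\<^bsub>central_ext m r l\<^esub> \<or>
        x \<otimes>\<^bsub>central_ext m r l\<^esub> central_ext_z m r l = \<zero>\<^bsub>central_ext m r l\<^esub>"
    then obtain G where G: "x = H.cls G" by (auto simp: central_ext_def H.Q_carrier)
    have "z_var * G \<in> H \<or> G * z_var \<in> H"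
      using x unfolding G central_ext_z_def central_ext_def H.Q_mult H.cls_zero_iff .
    then have "\<forall>k. dehom k G \<in> V (Suc k)" by (simp only: z_mult_H simp_thms)
    then have "G \<in> H" by (rule F)
    then show "x = \<zero>\<^bsub>central_ext m r l\<^esub>" by (simp add: G central_ext_def H.cls_zero_iff)
  qed
qed

end


section \<open>Linear maps between spaces of tuples\<close>

text \<open>
  The \<open>T\<close>-linear map sending \<open>e\<^sub>j\<close> to \<open>b j\<close>.
\<close>

definition tlin :: "(nat \<Rightarrow> ('x, 'k::field) tuples) \<Rightarrow> ('x, 'k) tuples \<Rightarrow> ('x, 'k) tuples" where
  "tlin b f = (\<Sum>j\<in>keys f. tsmult (lookup f j) (b j))"

lemma tlin_superset:
  assumes "finite A" "keys f \<subseteq> A"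
  shows "tlin b f = (\<Sum>j\<in>A. tsmult (lookup f j) (b j))"
  unfolding tlin_def using assms
  by (intro sum.mono_neutral_left) (auto simp: in_keys_iff)

lemma tlin_zero [simp]: "tlin b 0 = 0"
  by (simp add: tlin_def)

lemma tlin_add: "tlin b (f + g) = tlin b f + tlin b g"
proof -
  let ?A = "keys f \<union> keys g"
  have "keys (f + g) \<subseteq> ?A" by (rule keys_add)
  then show ?thesis
    by (simp add: tlin_superset[of ?A] lookup_add tsmult_add_left sum.distrib)
qed

lemma tlin_tsmult: "tlin b (tsmult t f) = tsmult t (tlin b f)"
proof -
  have "tlin b (tsmult t f) = (\<Sum>j\<in>keys f. tsmult (lookup (tsmult t f) j) (b j))"
    by (rule tlin_superset[OF finite_keys keys_tsmult])
  then show ?thesis by (simp add: lookup_tsmult tlin_def tsmult_sum_right tsmult_tsmult)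
qed

lemma tlin_single: "tlin b (single j u) = tsmult u (b j)"
  by (simp add: tlin_def)

lemma tlin_uminus: "tlin b (- f) = - tlin b f"
  using tlin_add[of b f "- f"] by (simp add: eq_neg_iff_add_eq_0 add.commute)

lemma tlin_diff: "tlin b (f - g) = tlin b f - tlin b g"
  using tlin_add[of b f "- g"] by (simp add: tlin_uminus)

lemma tlin_sum: "tlin b (sum f A) = (\<Sum>a\<in>A. tlin b (f a))"
  by (induction A rule: infinite_finite_induct) (simp_all add: tlin_add)

lemma lookup_tlin: "lookup (tlin b f) i
    = (\<Sum>j\<in>keys f. lookup f j * lookup (b j) i)"
  by (simp add: tlin_def lookup_sum lookup_tsmult)

definition supp :: "nat set \<Rightarrow> ('x, 'k::field) tuples set" where
  "supp J = {f. keys f \<subseteq> J}"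

lemma supp_zero [simp]: "0 \<in> supp J" by (simp add: supp_def)
lemma supp_add: "f \<in> supp J \<Longrightarrow> g \<in> supp J \<Longrightarrow> f + g \<in> supp J"
  using keys_add[of f g] by (auto simp: supp_def)
lemma supp_diff: "f \<in> supp J \<Longrightarrow> g \<in> supp J \<Longrightarrow> f - g \<in> supp J"
  unfolding supp_def mem_Collect_eq subset_iff in_keys_iff lookup_minus by (metis diff_self)
lemma supp_tsmult: "f \<in> supp J \<Longrightarrow> tsmult t f \<in> supp J"
  using keys_tsmult[of t f] by (auto simp: supp_def)
lemma supp_sum: "(\<And>a. a \<in> A \<Longrightarrow> f a \<in> supp J) \<Longrightarrow> sum f A \<in> supp J"
  by (induction A rule: infinite_finite_induct) (simp_all add: supp_add)
lemma supp_single: "j \<in> J \<Longrightarrow> single j u \<in> supp J"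
  by (simp add: supp_def)
lemma supp_UNIV [simp]: "f \<in> supp UNIV" by (simp add: supp_def)
lemma supp_lookup: "f \<in> supp J \<Longrightarrow> j \<notin> J \<Longrightarrow> lookup f j = 0"
  by (auto simp: supp_def in_keys_iff)
lemma supp_tuple_part: "f \<in> supp J \<Longrightarrow> tuple_part \<delta> n f \<in> supp J"
  using keys_tuple_part[of \<delta> n f] by (auto simp: supp_def)

lemma supp_tlin: "f \<in> supp J' \<Longrightarrow> (\<And>j. j \<in> J' \<Longrightarrow> b j \<in> supp J) \<Longrightarrow> tlin b f \<in> supp J"
  unfolding tlin_def by (intro supp_sum supp_tsmult) (auto simp: supp_def)

lemma tuple_eq_sum_single:
  "f = (\<Sum>j\<in>keys f. single j (lookup f j))"
  by (rule poly_mapping_eqI) (simp add: lookup_sum lookup_single when_def sum.delta in_keys_iff)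

lemma tuple_part_sum: "tuple_part \<delta> n (sum f A) = (\<Sum>a\<in>A. tuple_part \<delta> n (f a))"
  by (induction A rule: infinite_finite_induct) (simp_all add: tuple_part_add)

lemma tuple_part_tlin:
  assumes f: "f \<in> supp J'" and b: "\<And>j. j \<in> J' \<Longrightarrow> tuple_part \<delta> (\<delta>' j) (b j) = b j"
  shows "tuple_part \<delta> n (tlin b f) = tlin b (tuple_part \<delta>' n f)"
proof -
  have *: "tuple_part \<delta> n (tsmult u (b j))
      = (if \<delta>' j \<le> n then tsmult (hom_part (n - \<delta>' j) u) (b j) else 0)" if "j \<in> J'" for j u
  proof -
    have bj: "tuple_part \<delta> k (b j) = (if k = \<delta>' j then b j else 0)" for k
      using b[OF that] tuple_part_tuple_part[of \<delta> k "\<delta>' j" "b j"] by auto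
    have "tuple_part \<delta> n (tsmult u (b j))
        = (\<Sum>a\<le>n. if a = n - \<delta>' j then (if \<delta>' j \<le> n then tsmult (hom_part (n - \<delta>' j) u) (b j) else 0) else 0)"
      unfolding tuple_part_tsmult by (rule sum.cong) (auto simp: bj)
    then show ?thesis by (simp add: sum.delta)
  qed
  have "tuple_part \<delta> n (tlin b f) = (\<Sum>j\<in>keys f.
      if \<delta>' j \<le> n then tsmult (hom_part (n - \<delta>' j) (lookup f j)) (b j) else 0)"
    unfolding tlin_def tuple_part_sum using f by (intro sum.cong) (auto simp: * supp_def)
  also have "\<dots> = tlin b (tuple_part \<delta>' n f)"
    unfolding tlin_superset[OF finite_keys keys_tuple_part]
    by (intro sum.cong) (auto simp: lookup_tuple_part)
  finally show ?thesis .
qed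

lemma sum_tuple_part: "\<exists>K. \<forall>K'\<ge>K. f = (\<Sum>k\<le>K'. tuple_part \<delta> k f)"
proof (induction f rule: free_z_induct)
  case (single i w c)
  have "tuple_part \<delta> k (single i (single w c))
     = (if k = \<delta> i + length w then single i (single w c) else 0)" for k
    by (rule poly_mapping_eqI)
      (auto simp: lookup_tuple_part lookup_single when_def hom_part_single)
  then show ?case by (intro exI[of _ "\<delta> i + length w"]) (simp add: sum.delta)
next
  case (add f g)
  then obtain K L where K: "\<forall>K'\<ge>K. f = (\<Sum>k\<le>K'. tuple_part \<delta> k f)"
    and L: "\<forall>K'\<ge>L. g = (\<Sum>k\<le>K'. tuple_part \<delta> k g)" by blast
  have "f + g = (\<Sum>k\<le>K'. tuple_part \<delta> k (f + g))" if K': "K' \<ge> max K L" for K'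
  proof -
    have "(\<Sum>k\<le>K'. tuple_part \<delta> k (f + g)) = (\<Sum>k\<le>K'. tuple_part \<delta> k f) + (\<Sum>k\<le>K'. tuple_part \<delta> k g)"
      by (simp add: tuple_part_add sum.distrib)
    also have "(\<Sum>k\<le>K'. tuple_part \<delta> k f) = f" using K K' by (metis max.boundedE)
    also have "(\<Sum>k\<le>K'. tuple_part \<delta> k g) = g" using L K' by (metis max.boundedE)
    finally show ?thesis by simp
  qed
  then show ?case by blast
qed (simp add: exI[of _ 0])

section \<open>Countable homogeneous generating families\<close>

text \<open>
  The coefficients of a tuple in the countable basis of all \<open>w e\<^sub>j\<close>, listed by one natural number. Numbers
  that do not encode a pair get the coefficient 0.
\<close>

definition coord :: "('x::countable, 'k::field) tuples \<Rightarrow> nat \<Rightarrow> 'k" where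
  "coord f p = (case (from_nat p :: nat \<times> 'x list) of (j, w) \<Rightarrow>
     if to_nat (j, w) = p then lookup (lookup f j) w else 0)"

lemma coord_zero [simp]: "coord 0 p = 0"
  by (simp add: coord_def split: prod.split)
lemma coord_diff: "coord (f - g) p = coord f p - coord g p"
  by (simp add: coord_def lookup_minus split: prod.split)
lemma coord_add: "coord (f + g) p = coord f p + coord g p"
  by (simp add: coord_def lookup_add split: prod.split)

lemma lookup_scal_mult: "lookup (scal c * u) w = c * lookup u w"
proof (induction u rule: poly_mapping_additive_induct)
  case (single v e)
  show ?case by (simp add: scal_def mult_single plus_list_def lookup_single when_def)
qed (simp_all add: distrib_left lookup_add)

lemma coord_scal: "coord (tsmult (scal c) f) p = c * coord f p"
  by (simp add: coord_def lookup_tsmult lookup_scal_mult split: prod.split)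

lemma coord_all_zero:
  fixes f :: "('x::countable, 'k::field) tuples"
  shows "(\<And>p. coord f p = 0) \<Longrightarrow> f = 0"
proof (rule poly_mapping_eqI, rule poly_mapping_eqI)
  fix j :: nat and w :: "'x list" assume "\<And>p. coord f p = 0"
  from this[of "to_nat (j, w)"]
  show "lookup (lookup f j) w = lookup (lookup 0 j) w"
    by (simp add: coord_def)
qed

lemma coord_bounded: "\<exists>M. \<forall>p\<ge>M. coord f p = 0"
proof (induction f rule: free_z_induct)
  case (single i w c)
  show ?case
    by (rule exI[of _ "Suc (to_nat (i, w))"])
      (auto simp: coord_def lookup_single when_def split: prod.split)
next
  case (add f g)
  then obtain N M where "\<forall>p\<ge>N. coord f p = 0" "\<forall>p\<ge>M. coord g p = 0" by blast
  then show ?case by (intro exI[of _ "max N M"]) (simp add: coord_add)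
qed simp

text \<open>
  A homogeneous generating family indexed by the natural numbers, together with its degrees. Entries may
  be 0; this saves treating finite families separately.
\<close>

definition covers ::
    "('x, 'k::field) tuples set \<Rightarrow> (nat \<Rightarrow> nat) \<Rightarrow> (nat \<Rightarrow> ('x, 'k) tuples) \<times> (nat \<Rightarrow> nat) \<Rightarrow> bool" where
  "covers N \<delta> c \<longleftrightarrow> (\<forall>p. fst c p \<in> N \<and> tuple_part \<delta> (snd c p) (fst c p) = fst c p) \<and>
     (\<forall>f\<in>N. \<exists>g. f = tlin (fst c) g)"

definition graded_sub :: "(nat \<Rightarrow> nat) \<Rightarrow> ('x, 'k::field) tuples set \<Rightarrow> bool" where
  "graded_sub \<delta> N \<longleftrightarrow> 0 \<in> N \<and> (\<forall>f\<in>N. \<forall>g\<in>N. f + g \<in> N) \<and> (\<forall>f\<in>N. \<forall>t. tsmult t f \<in> N) \<and>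
     (\<forall>f\<in>N. \<forall>n. tuple_part \<delta> n f \<in> N)"

lemma graded_sub_tlin:
  assumes "graded_sub \<delta> N" "\<And>j. b j \<in> N"
  shows "tlin b f \<in> N"
proof -
  have "(\<Sum>j\<in>A. tsmult (lookup f j) (b j)) \<in> N" if "finite A" for A
    using that by induction (use assms in \<open>simp_all add: graded_sub_def\<close>)
  then show ?thesis by (simp add: tlin_def)
qed

text \<open>
  Choose for every degree \<open>k\<close> and every basis number \<open>M\<close> an element of degree \<open>k\<close> whose last nonzero
  coordinate is \<open>M\<close>, if there is one. Subtracting multiples of the chosen elements removes the last
  coordinate of a homogeneous element again and again. The argument gives a countable family
  whatever the cardinality of \<open>K\<close>.
\<close>

lemma covers_exist:
  fixes N :: "('x::finite, 'k::field) tuples set"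
  assumes N: "graded_sub \<delta> N"
  shows "\<exists>c. covers N \<delta> c"
proof -
  define P where "P k M e \<longleftrightarrow> e \<in> N \<and> tuple_part \<delta> k e = e \<and> coord e M \<noteq> 0 \<and> (\<forall>p>M. coord e p = 0)"
    for k M and e :: "('x, 'k) tuples"
  define b where "b q = (case prod_decode q of (k, M) \<Rightarrow> if \<exists>e. P k M e then SOME e. P k M e else 0)" for q
  define \<delta>' where "\<delta>' q = fst (prod_decode q)" for q
  have b1: "P k M (b (prod_encode (k, M)))" if "P k M e" for k M e
    using that by (auto simp: b_def intro: someI)
  have hom: "b q \<in> N \<and> tuple_part \<delta> (\<delta>' q) (b q) = b q" for q
  proof (cases "prod_decode q")
    case (Pair k M)
    show ?thesis
    proof (cases "\<exists>e. P k M e")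
      case True
      define e where "e = (SOME e. P k M e)"
      have "P k M e" unfolding e_def using True by (rule someI_ex)
      moreover have "b q = e" using True by (simp add: b_def Pair e_def)
      ultimately show ?thesis by (simp add: \<delta>'_def Pair P_def)
    next
      case False
      then have "b q = 0" by (auto simp: b_def Pair)
      then show ?thesis using N by (simp add: graded_sub_def)
    qed
  qed
  have homog: "\<exists>g. f = tlin b g"
    if "f \<in> N" "tuple_part \<delta> k f = f" "\<forall>p\<ge>M. coord f p = 0" for f k M
    using that
  proof (induction M arbitrary: f)
    case 0
    then have "f = 0" by (intro coord_all_zero) simp
    then show ?case by (intro exI[of _ 0]) simp
  next
    case (Suc M)
    show ?case
    proof (cases "coord f M = 0")
      case True
      then have "\<forall>p\<ge>M. coord f p = 0" using Suc.prems(3) by (metis le_neq_implies_less Suc_leI)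
      then show ?thesis using Suc by blast
    next
      case False
      then have "P k M f" using Suc.prems by (simp add: P_def)
      from b1[OF this] obtain e where e: "e = b (prod_encode (k, M))" "P k M e" by blast
      define c where "c = coord f M / coord e M"
      let ?f = "f - tsmult (scal c) e"
      have fe: "?f = f + tsmult (scal (- c)) e" by (simp add: scal_uminus tsmult_uminus_left)
      have "tsmult (scal (- c)) e \<in> N" "tuple_part \<delta> k (tsmult (scal (- c)) e) = tsmult (scal (- c)) e"
      proof -
        show "tsmult (scal (- c)) e \<in> N" using N e by (simp add: graded_sub_def P_def)
        have "tuple_part \<delta> k (tsmult (scal (- c)) e)
          = (\<Sum>a\<le>k. if a = 0 then tsmult (scal (- c)) e else 0)"
          unfolding tuple_part_tsmult
          by (rule sum.cong) (use e in \<open>auto simp: hom_part_free_comp[OF scal_free_comp] P_def\<close>)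
        then show "tuple_part \<delta> k (tsmult (scal (- c)) e) = tsmult (scal (- c)) e"
          by (simp add: sum.delta)
      qed
      then have 1: "?f \<in> N" and 2: "tuple_part \<delta> k ?f = ?f"
        using N Suc.prems unfolding fe by (simp_all add: graded_sub_def tuple_part_add)
      have 3: "\<forall>p\<ge>M. coord ?f p = 0"
      proof safe
        fix p assume "p \<ge> M"
        then show "coord ?f p = 0"
          using e Suc.prems(3) by (cases "p = M") (auto simp: coord_diff coord_scal c_def P_def)
      qed
      from Suc.IH[OF 1 2 3] obtain g where g: "?f = tlin b g" by blast
      have "f = tlin b (g + single (prod_encode (k, M)) (scal c))"
        unfolding tlin_add tlin_single g[symmetric] by (simp add: e)
      then show ?thesis by blast
    qed
  qed
  have "\<exists>g. f = tlin b g" if f: "f \<in> N" for f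
  proof -
    have "\<exists>g. tuple_part \<delta> k f = tlin b g" for k
    proof -
      obtain M where M: "\<forall>p\<ge>M. coord (tuple_part \<delta> k f) p = 0" using coord_bounded by blast
      show ?thesis
        by (rule homog[where k = k, OF _ _ M]) (use N f in \<open>simp_all add: graded_sub_def tuple_part_tuple_part\<close>)
    qed
    then obtain g where g: "\<And>k. tuple_part \<delta> k f = tlin b (g k)" by metis
    obtain K where "\<forall>K'\<ge>K. f = (\<Sum>k\<le>K'. tuple_part \<delta> k f)" using sum_tuple_part by blast
    then have "f = (\<Sum>k\<le>K. tuple_part \<delta> k f)" by blast
    then have "f = tlin b (\<Sum>k\<le>K. g k)" by (simp add: tlin_sum g)
    then show ?thesis by blast
  qed
  then have "covers N \<delta> (b, \<delta>')" using hom by (simp add: covers_def)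
  then show ?thesis by blast
qed

section \<open>Free modules over the quotient algebra\<close>

context homogeneous_relations
begin

sublocale A: ring_type_ideal I
  unfolding I_def rel_ideal_def by (rule ring_type_ideal_Idl)

abbreviation comp :: "nat \<Rightarrow> ('x, 'k) free_algebra set set" where
  "comp \<equiv> quot_algebra_comp m r"

lemma comp_eq: "comp n = A.cls ` free_comp n"
  by (simp add: quot_algebra_comp_def quot_comp_def I_def)

lemma Q_eq: "quot_algebra m r = A.Q"
  by (simp add: quot_algebra_def I_def)

text \<open>
  The tuples that vanish over \<open>A\<close>, without restriction on the support.
\<close>

definition TI :: "('x, 'k) tuples set" where
  "TI = {f. \<forall>j. lookup f j \<in> I}"

lemma TI_zero [simp]: "0 \<in> TI" by (simp add: TI_def)
lemma TI_add: "f \<in> TI \<Longrightarrow> g \<in> TI \<Longrightarrow> f + g \<in> TI"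
  by (simp add: TI_def lookup_add I_add)
lemma TI_diff: "f \<in> TI \<Longrightarrow> g \<in> TI \<Longrightarrow> f - g \<in> TI"
  by (simp add: TI_def lookup_minus I_diff)
lemma TI_tsmult: "f \<in> TI \<Longrightarrow> tsmult t f \<in> TI"
  by (simp add: TI_def lookup_tsmult I_lmult)
lemma TI_tsmult_I: "t \<in> I \<Longrightarrow> tsmult t f \<in> TI"
  by (simp add: TI_def lookup_tsmult I_rmult)
lemma TI_sum: "(\<And>a. a \<in> A \<Longrightarrow> f a \<in> TI) \<Longrightarrow> sum f A \<in> TI"
  by (induction A rule: infinite_finite_induct) (simp_all add: TI_add)
lemma TI_tlin: "f \<in> TI \<Longrightarrow> tlin b f \<in> TI"
  unfolding tlin_def by (intro TI_sum TI_tsmult_I) (simp add: TI_def)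
lemma TI_tlin_right: "(\<And>j. j \<in> keys f \<Longrightarrow> b j \<in> TI) \<Longrightarrow> tlin b f \<in> TI"
  unfolding tlin_def by (intro TI_sum TI_tsmult)
lemma TI_tuple_part: "f \<in> TI \<Longrightarrow> tuple_part \<delta> n f \<in> TI"
  by (simp add: TI_def lookup_tuple_part I_hom_part)

definition tcls :: "('x, 'k) tuples \<Rightarrow> nat \<Rightarrow> ('x, 'k) free_algebra set" where
  "tcls f = (\<lambda>j. A.cls (lookup f j))"

abbreviation F :: "nat set \<Rightarrow> (('x, 'k) free_algebra set, nat \<Rightarrow> ('x, 'k) free_algebra set) module" where
  "F J \<equiv> free_module A.Q J"

lemma tcls_eq: "tcls f = tcls g \<longleftrightarrow> f - g \<in> TI"
  by (simp add: tcls_def fun_eq_iff A.cls_eq TI_def lookup_minus)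

lemma F_zero: "\<zero>\<^bsub>F J\<^esub> = tcls 0"
  by (simp add: free_module_def tcls_def A.Q_zero)

lemma tcls_zero_iff: "tcls f = \<zero>\<^bsub>F J\<^esub> \<longleftrightarrow> f \<in> TI"
  by (simp add: F_zero tcls_eq)

lemma F_add: "tcls f \<oplus>\<^bsub>F J\<^esub> tcls g = tcls (f + g)"
  by (simp add: free_module_def tcls_def A.Q_add lookup_add)

lemma F_smult: "A.cls t \<odot>\<^bsub>F J\<^esub> tcls f = tcls (tsmult t f)"
  by (simp add: free_module_def tcls_def A.Q_mult lookup_tsmult)

text \<open>
  Outside the finite support the representative 0 is chosen, so that the lifted family is a tuple.
\<close>

lemma lift_family:
  assumes "finite {j. x j \<noteq> \<zero>\<^bsub>A.Q\<^esub>}" and "\<And>j. x j \<noteq> \<zero>\<^bsub>A.Q\<^esub> \<Longrightarrow> \<exists>u. x j = A.cls u \<and> P j u"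
  obtains f where "tcls f = x" "\<And>j. j \<in> keys f \<Longrightarrow> x j \<noteq> \<zero>\<^bsub>A.Q\<^esub> \<and> P j (lookup f j)"
proof -
  define u where "u j = (if x j = \<zero>\<^bsub>A.Q\<^esub> then 0 else SOME u. x j = A.cls u \<and> P j u)" for j
  have u: "x j = A.cls (u j) \<and> P j (u j)" if "x j \<noteq> \<zero>\<^bsub>A.Q\<^esub>" for j
    using someI_ex[OF assms(2)[OF that]] that by (simp add: u_def)
  have fin: "finite {j. u j \<noteq> 0}"
    by (rule finite_subset[OF _ assms(1)]) (auto simp: u_def)
  let ?f = "Abs_poly_mapping u"
  have lf: "lookup ?f = u" by (rule lookup_Abs_poly_mapping[OF fin])
  have "tcls ?f = x"
  proof
    fix j show "tcls ?f j = x j"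
      using u[of j] by (cases "x j = \<zero>\<^bsub>A.Q\<^esub>") (simp_all add: tcls_def lf u_def A.Q_zero)
  qed
  moreover have "x j \<noteq> \<zero>\<^bsub>A.Q\<^esub> \<and> P j (lookup ?f j)" if "j \<in> keys ?f" for j
    using that u[of j] by (auto simp: in_keys_iff lf u_def split: if_splits)
  ultimately show thesis by (rule that)
qed

lemma F_carrier_iff: "x \<in> carrier (F J) \<longleftrightarrow> (\<exists>f\<in>supp J. x = tcls f)"
proof
  assume "x \<in> carrier (F J)"
  then have x: "finite {j. x j \<noteq> \<zero>\<^bsub>A.Q\<^esub>}" "\<And>j. j \<in> J \<Longrightarrow> x j \<in> carrier A.Q" "\<And>j. j \<notin> J \<Longrightarrow> x j = \<zero>\<^bsub>A.Q\<^esub>"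
    by (auto simp: free_module_def)
  obtain f where "tcls f = x" "\<And>j. j \<in> keys f \<Longrightarrow> x j \<noteq> \<zero>\<^bsub>A.Q\<^esub> \<and> True"
  proof (rule lift_family[OF x(1), where P="\<lambda>_ _. True"])
    fix j assume "x j \<noteq> \<zero>\<^bsub>A.Q\<^esub>"
    then have "x j \<in> carrier A.Q" using x by blast
    then show "\<exists>u. x j = A.cls u \<and> True" by (auto simp: A.Q_carrier)
  qed blast
  then show "\<exists>f\<in>supp J. x = tcls f"
    using x(3) by (intro bexI[of _ f]) (auto simp: supp_def)
next
  assume "\<exists>f\<in>supp J. x = tcls f"
  then obtain f where f: "f \<in> supp J" "x = tcls f" by blast
  have "finite {j. tcls f j \<noteq> \<zero>\<^bsub>A.Q\<^esub>}"
    by (rule finite_subset[OF _ finite_keys[of f]]) (auto simp: tcls_def in_keys_iff A.Q_zero)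
  moreover have "tcls f j = \<zero>\<^bsub>A.Q\<^esub>" if "j \<notin> J" for j
    using supp_lookup[OF f(1) that] by (simp add: tcls_def A.Q_zero)
  ultimately show "x \<in> carrier (F J)"
    by (auto simp: free_module_def f(2)) (simp add: tcls_def)
qed

lemma F_carrier: "carrier (F J) = tcls ` supp J"
  using F_carrier_iff by blast

lemma tcls_carrier: "f \<in> supp J \<Longrightarrow> tcls f \<in> carrier (F J)"
  by (auto simp: F_carrier)

abbreviation Fc :: "nat set \<Rightarrow> (nat \<Rightarrow> nat) \<Rightarrow> nat \<Rightarrow> (nat \<Rightarrow> ('x, 'k) free_algebra set) set" where
  "Fc J \<delta> \<equiv> free_module_comp A.Q comp J \<delta>"

lemma Fc_iff: "x \<in> Fc J \<delta> n \<longleftrightarrow> (\<exists>f\<in>supp J. tuple_part \<delta> n f = f \<and> x = tcls f)"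
proof
  assume x: "x \<in> Fc J \<delta> n"
  then have xc: "x \<in> carrier (F J)" by (simp add: free_module_comp_def)
  then have fin: "finite {j. x j \<noteq> \<zero>\<^bsub>A.Q\<^esub>}" "\<And>j. j \<notin> J \<Longrightarrow> x j = \<zero>\<^bsub>A.Q\<^esub>"
    by (auto simp: free_module_def)
  obtain f where f: "tcls f = x" "\<And>j. j \<in> keys f \<Longrightarrow>
      x j \<noteq> \<zero>\<^bsub>A.Q\<^esub> \<and> \<delta> j \<le> n \<and> lookup f j \<in> free_comp (n - \<delta> j)"
  proof (rule lift_family[OF fin(1), where P="\<lambda>j u. \<delta> j \<le> n \<and> u \<in> free_comp (n - \<delta> j)"])
    fix j assume j: "x j \<noteq> \<zero>\<^bsub>A.Q\<^esub>"
    then have "j \<in> J" using fin by blast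
    then have "if \<delta> j \<le> n then x j \<in> comp (n - \<delta> j) else x j = \<zero>\<^bsub>A.Q\<^esub>"
      using x unfolding free_module_comp_def by blast
    then have "\<delta> j \<le> n" "x j \<in> comp (n - \<delta> j)" using j by (auto split: if_splits)
    then show "\<exists>u. x j = A.cls u \<and> \<delta> j \<le> n \<and> u \<in> free_comp (n - \<delta> j)"
      unfolding comp_eq by blast
  qed blast
  have "tuple_part \<delta> n f = f"
  proof (rule poly_mapping_eqI)
    fix j show "lookup (tuple_part \<delta> n f) j = lookup f j"
      using f(2)[of j] by (cases "j \<in> keys f")
        (auto simp: lookup_tuple_part hom_part_free_comp in_keys_iff)
  qed
  moreover have "f \<in> supp J" using f(2) fin(2) by (auto simp: supp_def)
  ultimately show "\<exists>f\<in>supp J. tuple_part \<delta> n f = f \<and> x = tcls f" using f(1) by blast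
next
  assume "\<exists>f\<in>supp J. tuple_part \<delta> n f = f \<and> x = tcls f"
  then obtain f where f: "f \<in> supp J" "tuple_part \<delta> n f = f" "x = tcls f" by blast
  have "if \<delta> j \<le> n then x j \<in> comp (n - \<delta> j) else x j = \<zero>\<^bsub>A.Q\<^esub>" for j
  proof (cases "\<delta> j \<le> n")
    case True
    then have "lookup f j \<in> free_comp (n - \<delta> j)"
      using lookup_tuple_part[of \<delta> n f j] unfolding f(2) by (metis hom_part_in_free_comp)
    then show ?thesis using True by (simp add: f(3) tcls_def comp_eq)
  next
    case False
    then show ?thesis
      using lookup_tuple_part[of \<delta> n f j] unfolding f(2) by (simp add: f(3) tcls_def A.Q_zero)
  qed
  moreover have "x \<in> carrier (F J)" using tcls_carrier[OF f(1)] f(3) by simp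
  ultimately show "x \<in> Fc J \<delta> n" unfolding free_module_comp_def by blast
qed

lemma F_left_module: "left_module A.Q (F J)"
proof -
  interpret Q: ring A.Q by (rule A.Q_ring)
  have neg: "\<exists>y\<in>carrier (F J). y \<oplus>\<^bsub>F J\<^esub> x = \<zero>\<^bsub>F J\<^esub>" if "x \<in> carrier (F J)" for x
  proof -
    obtain f where f: "f \<in> supp J" "x = tcls f" using \<open>x \<in> carrier (F J)\<close> F_carrier_iff by blast
    have "0 - f \<in> supp J" using supp_diff[OF supp_zero f(1)] .
    then have "tcls (0 - f) \<in> carrier (F J)" by (rule tcls_carrier)
    moreover have "tcls (0 - f) \<oplus>\<^bsub>F J\<^esub> x = \<zero>\<^bsub>F J\<^esub>" by (simp add: f F_add F_zero)
    ultimately show ?thesis by blast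
  qed
  have ab: "abelian_group (F J)"
  proof (rule abelian_groupI)
    show "\<exists>y\<in>carrier (F J). y \<oplus>\<^bsub>F J\<^esub> x = \<zero>\<^bsub>F J\<^esub>" if "x \<in> carrier (F J)" for x
      using that by (rule neg)
  qed (auto simp: F_carrier F_add F_zero supp_add add.commute add.left_commute)
  show ?thesis
    by (intro left_module.intro A.Q_ring ab left_module_axioms.intro)
      (auto simp: F_carrier F_add F_smult supp_tsmult A.Q_carrier A.Q_add A.Q_mult A.Q_one
        tsmult_add_left tsmult_add_right tsmult_tsmult)
qed

text \<open>
  The map of free modules over \<open>A\<close> induced by \<open>tlin b\<close>. Any representative may be used, because \<open>tlin b\<close>
  preserves \<open>TI\<close>.
\<close>

definition dmap :: "(nat \<Rightarrow> ('x, 'k) tuples) \<Rightarrow> (nat \<Rightarrow> ('x, 'k) free_algebra set) \<Rightarrow> (nat \<Rightarrow> ('x, 'k) free_algebra set)" where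
  "dmap b x = tcls (tlin b (SOME f. tcls f = x))"

lemma dmap_tcls: "dmap b (tcls f) = tcls (tlin b f)"
proof -
  have "tcls (SOME g. tcls g = tcls f) = tcls f" by (rule someI[of "\<lambda>g. tcls g = tcls f" f]) simp
  then have "(SOME g. tcls g = tcls f) - f \<in> TI" by (simp only: tcls_eq)
  then have "tlin b (SOME g. tcls g = tcls f) - tlin b f \<in> TI"
    unfolding tlin_diff[symmetric] by (rule TI_tlin)
  then show ?thesis by (simp add: dmap_def tcls_eq)
qed

lemma dmap_hom:
  assumes "\<And>j. j \<in> J' \<Longrightarrow> b j \<in> supp J"
  shows "dmap b \<in> left_module_hom A.Q (F J') (F J)"
proof -
  have "tlin b f \<in> supp J" if "f \<in> supp J'" for f using supp_tlin[OF that assms] .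
  then show ?thesis
    unfolding left_module_hom_def
    by (auto simp: F_carrier dmap_tcls F_add tlin_add A.Q_carrier F_smult tlin_tsmult)
qed

lemma dmap_graded_hom:
  assumes "\<And>j. j \<in> J' \<Longrightarrow> b j \<in> supp J" "\<And>j. j \<in> J' \<Longrightarrow> tuple_part \<delta> (\<delta>' j) (b j) = b j"
  shows "dmap b \<in> graded_hom A.Q (F J') (Fc J' \<delta>') (F J) (Fc J \<delta>) 0"
proof -
  have "dmap b x \<in> Fc J \<delta> k" if "x \<in> Fc J' \<delta>' k" for x k
  proof -
    obtain f where f: "f \<in> supp J'" "tuple_part \<delta>' k f = f" "x = tcls f"
      using \<open>x \<in> Fc J' \<delta>' k\<close>[unfolded Fc_iff] by (elim bexE conjE)
    have "tuple_part \<delta> k (tlin b f) = tlin b (tuple_part \<delta>' k f)"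
      by (rule tuple_part_tlin[OF f(1) assms(2)])
    then have "tuple_part \<delta> k (tlin b f) = tlin b f" by (simp only: f(2))
    then show ?thesis unfolding f(3) dmap_tcls Fc_iff
      by (intro bexI[of _ "tlin b f"] conjI refl supp_tlin[OF f(1) assms(1)])
  qed
  then have "\<forall>k. dmap b ` Fc J' \<delta>' k \<subseteq> Fc J \<delta> k" by (simp only: image_subset_iff) simp
  moreover have "dmap b \<in> left_module_hom A.Q (F J') (F J)" by (rule dmap_hom[OF assms(1)])
  ultimately show ?thesis unfolding graded_hom_def mem_Collect_eq by simp
qed

text \<open>
  Exactness between free modules over \<open>A\<close>, stated for tuples over \<open>T\<close>.
\<close>

lemma dmap_exact:
  assumes "\<And>f. f \<in> supp J' \<Longrightarrow> tlin b f \<in> TI \<longleftrightarrow> (\<exists>g\<in>supp J''. f - tlin b' g \<in> TI)"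
    and b': "\<And>j. j \<in> J'' \<Longrightarrow> b' j \<in> supp J'"
  shows "dmap b' ` carrier (F J'') = {x \<in> carrier (F J'). dmap b x = \<zero>\<^bsub>F J\<^esub>}"
proof safe
  fix x assume "x \<in> carrier (F J'')"
  then obtain g where g: "g \<in> supp J''" "x = tcls g" using F_carrier_iff by blast
  then have s: "tlin b' g \<in> supp J'" using supp_tlin[OF g(1) b'] by simp
  then show "dmap b' x \<in> carrier (F J')" using g by (simp add: dmap_tcls tcls_carrier)
  have "tlin b (tlin b' g) \<in> TI" unfolding assms(1)[OF s] using g by (intro bexI[of _ g]) simp_all
  then show "dmap b (dmap b' x) = \<zero>\<^bsub>F J\<^esub>" by (simp add: g dmap_tcls tcls_zero_iff)
next
  fix x assume "x \<in> carrier (F J')" "dmap b x = \<zero>\<^bsub>F J\<^esub>"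
  then obtain f where f: "f \<in> supp J'" "x = tcls f" "tlin b f \<in> TI"
    using F_carrier_iff by (auto simp: dmap_tcls tcls_zero_iff)
  then obtain g where "g \<in> supp J''" "f - tlin b' g \<in> TI" using assms(1) by blast
  then show "x \<in> dmap b' ` carrier (F J'')"
    using f by (intro image_eqI[of _ _ "tcls g"]) (simp_all add: dmap_tcls tcls_eq tcls_carrier)
qed

section \<open>The start of the minimal resolution\<close>

text \<open>
  The differentials at the start of the minimal resolution of \<open>K\<close>: \<open>b0\<close> sends the basis element of the
  variable \<open>x\<close>, which has index \<open>to_nat x\<close>, to \<open>x\<close>, and \<open>b1\<close> sends \<open>e\<^sub>i\<close> to the row of all \<open>r\<^sub>i / x\<close>.
\<close>

definition b0 :: "nat \<Rightarrow> ('x, 'k) tuples" where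
  "b0 j = single 0 (gen (from_nat j))"

definition b1 :: "nat \<Rightarrow> ('x, 'k) tuples" where
  "b1 i = (\<Sum>x\<in>UNIV. single (to_nat x) (rdiv x (r i)))"

lemma b0_supp: "b0 j \<in> supp {0}"
  by (simp add: b0_def supp_single)

lemma b1_supp: "b1 i \<in> supp (range (to_nat :: 'x \<Rightarrow> nat))"
  unfolding b1_def by (intro supp_sum supp_single) simp

lemma lookup_b1: "lookup (b1 i) (to_nat x) = rdiv x (r i)"
proof -
  have "lookup (b1 i) (to_nat x) = (\<Sum>y\<in>UNIV. if y = x then rdiv x (r i) else 0)"
    unfolding b1_def lookup_sum by (rule sum.cong) (auto simp: lookup_single when_def)
  then show ?thesis by (simp add: sum.delta)
qed

lemma b0_homog: "tuple_part (\<lambda>_. 0) 1 (b0 j) = b0 j"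
  by (rule poly_mapping_eqI)
    (auto simp: lookup_tuple_part b0_def lookup_single when_def hom_part_free_comp[OF gen_free_comp])

lemma b1_homog: "i < m \<Longrightarrow> tuple_part (\<lambda>_. 1) (d i) (b1 i) = b1 i"
proof (rule poly_mapping_eqI)
  fix j assume i: "i < m"
  show "lookup (tuple_part (\<lambda>_. 1) (d i) (b1 i)) j = lookup (b1 i) j"
  proof (cases "j \<in> (range (to_nat :: 'x \<Rightarrow> nat))")
    case True
    then obtain x :: 'x where "j = to_nat x" by blast
    then show ?thesis using d_ge[OF i] rdiv_r_homog[OF i, of x]
      by (simp add: lookup_tuple_part lookup_b1 hom_part_free_comp)
  next
    case False
    then show ?thesis using supp_lookup[OF b1_supp False] by (simp add: lookup_tuple_part)
  qed
qed

lemma tlin_b0: "f \<in> supp (range (to_nat :: 'x \<Rightarrow> nat)) \<Longrightarrow> tlin b0 f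
   = single 0 (\<Sum>x\<in>UNIV. lookup f (to_nat x) * gen x)"
proof -
  assume f: "f \<in> supp (range (to_nat :: 'x \<Rightarrow> nat))"
  have "tlin b0 f = (\<Sum>j\<in>(range (to_nat :: 'x \<Rightarrow> nat)). tsmult (lookup f j) (b0 j))"
    using f by (intro tlin_superset) (auto simp: supp_def)
  also have "\<dots> = (\<Sum>x\<in>UNIV. tsmult (lookup f (to_nat x)) (b0 (to_nat (x::'x))))"
    by (subst sum.reindex) (simp_all add: inj_on_def)
  also have "\<dots> = (\<Sum>x\<in>UNIV. single 0 (lookup f (to_nat x) * gen (x::'x)))"
    by (simp add: b0_def tsmult_single)
  also have "\<dots> = single 0 (\<Sum>x\<in>UNIV. lookup f (to_nat x) * gen x)"
    by (rule poly_mapping_eqI) (simp add: lookup_sum lookup_single when_def)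
  finally show ?thesis .
qed

lemma lookup_tlin_b1: "f \<in> supp {..<m} \<Longrightarrow>
  lookup (tlin b1 f) (to_nat x) = (\<Sum>i<m. lookup f i * rdiv x (r i))"
  by (simp add: tlin_superset[of "{..<m}"] supp_def lookup_sum lookup_tsmult lookup_b1)

lemma tlin_b1_supp: "tlin b1 f \<in> supp (range (to_nat :: 'x \<Rightarrow> nat))"
  by (rule supp_tlin[of f UNIV]) (simp_all add: b1_supp)

lemma syz_iff: "f \<in> syz \<longleftrightarrow> f \<in> supp {..<m} \<and> tlin b1 f \<in> TI"
proof -
  have "tlin b1 f \<in> TI \<longleftrightarrow> (\<forall>x. lookup (tlin b1 f) (to_nat (x::'x)) \<in> I)"
  proof safe
    assume *: "\<forall>x. lookup (tlin b1 f) (to_nat (x::'x)) \<in> I"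
    have "lookup (tlin b1 f) j \<in> I" for j
      using * supp_lookup[OF tlin_b1_supp, of j] by (cases "j \<in> (range (to_nat :: 'x \<Rightarrow> nat))") auto
    then show "tlin b1 f \<in> TI" by (simp add: TI_def)
  qed (simp add: TI_def)
  then show ?thesis
    unfolding syz_def mem_Collect_eq by (auto simp: supp_def lookup_tlin_b1)
qed

lemma exact_0:
  assumes f: "f \<in> supp {0}"
  shows "const_coeff (lookup f 0) = 0 \<longleftrightarrow> (\<exists>g\<in>supp (range (to_nat :: 'x \<Rightarrow> nat)). f - tlin b0 g \<in> TI)"
proof
  assume c: "const_coeff (lookup f 0) = 0"
  let ?u = "lookup f 0"
  define g where "g = (\<Sum>x\<in>UNIV. single (to_nat (x::'x)) (rdiv x ?u))"
  have gl: "lookup g (to_nat x) = rdiv x ?u" for x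
  proof -
    have "lookup g (to_nat x) = (\<Sum>y\<in>UNIV. if y = x then rdiv x ?u else 0)"
      unfolding g_def lookup_sum by (rule sum.cong) (auto simp: lookup_single when_def)
    then show ?thesis by (simp add: sum.delta)
  qed
  have g: "g \<in> supp (range (to_nat :: 'x \<Rightarrow> nat))" unfolding g_def by (intro supp_sum supp_single) simp
  have "tlin b0 g = single 0 ?u"
    unfolding tlin_b0[OF g] gl using rdiv_decomp[of ?u] c by simp
  also have "\<dots> = f"
    using supp_lookup[OF f] by (intro poly_mapping_eqI) (auto simp: lookup_single when_def)
  finally show "\<exists>g\<in>supp (range (to_nat :: 'x \<Rightarrow> nat)). f - tlin b0 g \<in> TI" using g by (intro bexI[of _ g]) simp_all
next
  assume "\<exists>g\<in>supp (range (to_nat :: 'x \<Rightarrow> nat)). f - tlin b0 g \<in> TI"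
  then obtain g where g: "g \<in> supp (range (to_nat :: 'x \<Rightarrow> nat))" "f - tlin b0 g \<in> TI" by blast
  then have "const_coeff (lookup (f - tlin b0 g) 0) = 0" by (auto simp: TI_def I_const)
  then show "const_coeff (lookup f 0) = 0"
    by (simp add: lookup_minus tlin_b0[OF g(1)] const_coeff_diff const_coeff_sum const_coeff_mult)
qed

text \<open>
  Expanding \<open>\<Sum> f\<^sub>x x \<in> I\<close> by \<open>I_decomp\<close> and comparing the coefficients at \<open>x\<close> on the right gives
  \<open>f\<^sub>x = \<Sum> t\<^sub>i (r\<^sub>i / x)\<close> modulo \<open>I\<close>.
\<close>

lemma exact_1:
  assumes f: "f \<in> supp (range (to_nat :: 'x \<Rightarrow> nat))"
  shows "tlin b0 f \<in> TI \<longleftrightarrow> (\<exists>g\<in>supp {..<m}. f - tlin b1 g \<in> TI)"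
proof -
  have 0: "tlin b0 h \<in> TI \<longleftrightarrow> (\<Sum>x\<in>UNIV. lookup h (to_nat x) * gen x) \<in> I"
    if "h \<in> supp (range (to_nat :: 'x \<Rightarrow> nat))" for h
    by (auto simp: tlin_b0[OF that] TI_def lookup_single when_def)
  show ?thesis
  proof
    assume "tlin b0 f \<in> TI"
    then obtain t q where q: "\<forall>x. q x \<in> I" and
      *: "(\<Sum>x\<in>UNIV. lookup f (to_nat x) * gen x) = (\<Sum>i<m. t i * r i) + (\<Sum>x\<in>UNIV. q x * gen x)"
      using I_decomp unfolding 0[OF f] by blast
    have fx: "lookup f (to_nat x) = (\<Sum>i<m. t i * rdiv x (r i)) + q x" for x
      using arg_cong[OF *, of "rdiv x"] unfolding rdiv_sum_gen rdiv_add
      by (simp add: rdiv_sum rdiv_r)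
    define g where "g = (\<Sum>i<m. single i (t i))"
    have g: "g \<in> supp {..<m}" unfolding g_def by (intro supp_sum supp_single)
    have gl: "lookup g i = t i" if "i < m" for i
      using that by (simp add: g_def lookup_sum lookup_single when_def sum.delta)
    have s: "f - tlin b1 g \<in> supp (range (to_nat :: 'x \<Rightarrow> nat))" using f tlin_b1_supp by (rule supp_diff)
    have "lookup (f - tlin b1 g) j \<in> I" for j
    proof (cases "j \<in> (range (to_nat :: 'x \<Rightarrow> nat))")
      case True
      then obtain x :: 'x where "j = to_nat x" by blast
      then show ?thesis using q by (simp add: lookup_minus lookup_tlin_b1[OF g] gl fx)
    qed (simp add: supp_lookup[OF s])
    then show "\<exists>g\<in>supp {..<m}. f - tlin b1 g \<in> TI" using g unfolding TI_def by blast
  next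
    assume "\<exists>g\<in>supp {..<m}. f - tlin b1 g \<in> TI"
    then obtain g where g: "g \<in> supp {..<m}" "f - tlin b1 g \<in> TI" by blast
    have "(\<Sum>x\<in>UNIV. lookup (tlin b1 g) (to_nat x) * gen x)
        = (\<Sum>i<m. lookup g i * r i)"
      unfolding lookup_tlin_b1[OF g(1)] sum_r_rdiv ..
    also have "\<dots> \<in> I" by (intro I_sum I_lmult I_incl) simp
    finally have "tlin b0 (tlin b1 g) \<in> TI" unfolding 0[OF tlin_b1_supp] .
    moreover have "tlin b0 (f - tlin b1 g) \<in> TI" using g(2) by (rule TI_tlin)
    ultimately have "tlin b0 (f - tlin b1 g) + tlin b0 (tlin b1 g) \<in> TI" by (rule TI_add[rotated])
    then show "tlin b0 f \<in> TI" by (simp add: tlin_diff)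
  qed
qed

end


section \<open>One-dimensional modules\<close>

context homogeneous_relations
begin

definition class_const :: "('x, 'k) free_algebra set \<Rightarrow> 'k" where
  "class_const x = const_coeff (SOME t. A.cls t = x)"

lemma class_const_cls: "class_const (A.cls t) = const_coeff t"
proof -
  have "A.cls (SOME s. A.cls s = A.cls t) = A.cls t" by (rule someI[of "\<lambda>s. A.cls s = A.cls t" t]) simp
  then have "(SOME s. A.cls s = A.cls t) - t \<in> I" by (simp only: A.cls_eq)
  from I_const[OF this] show ?thesis by (simp add: class_const_def const_coeff_diff)
qed

text \<open>
  The trivial module up to isomorphism. Two copies of it occur: Ext uses the module of cosets of the
  augmentation ideal, and global dimension needs a copy inside a prescribed type.
\<close>

definition one_dim :: "('k \<Rightarrow> 'a) \<Rightarrow> (('x, 'k) free_algebra set, 'a) module \<Rightarrow> bool" where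
  "one_dim \<kappa> M \<longleftrightarrow> inj \<kappa> \<and> carrier M = range \<kappa> \<and> \<zero>\<^bsub>M\<^esub> = \<kappa> 0 \<and>
     (\<forall>a b. \<kappa> a \<oplus>\<^bsub>M\<^esub> \<kappa> b = \<kappa> (a + b)) \<and>
     (\<forall>t c. A.cls t \<odot>\<^bsub>M\<^esub> \<kappa> c = \<kappa> (const_coeff t * c))"

definition augmentation :: "('k \<Rightarrow> 'a) \<Rightarrow> (nat \<Rightarrow> ('x, 'k) free_algebra set) \<Rightarrow> 'a" where
  "augmentation \<kappa> x = \<kappa> (class_const (x 0))"

lemma augmentation_tcls: "augmentation \<kappa> (tcls f) = \<kappa> (const_coeff (lookup f 0))"
  by (simp add: augmentation_def tcls_def class_const_cls)

lemma one_dim_left_module: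
  assumes "one_dim \<kappa> M"
  shows "left_module A.Q M"
proof -
  note M = assms[unfolded one_dim_def]
  have ab: "abelian_group M"
  proof (rule abelian_groupI)
    fix x assume "x \<in> carrier M"
    then obtain c where "x = \<kappa> c" using M by auto
    then show "\<exists>y\<in>carrier M. y \<oplus>\<^bsub>M\<^esub> x = \<zero>\<^bsub>M\<^esub>"
      using M by (intro bexI[of _ "\<kappa> (- c)"]) simp_all
  qed (use M in \<open>auto simp: add.commute add.left_commute\<close>)
  show ?thesis
    by (intro left_module.intro A.Q_ring ab left_module_axioms.intro)
      (use M in \<open>auto simp: A.Q_carrier A.Q_add A.Q_mult A.Q_one
        const_coeff_add const_coeff_mult algebra_simps const_coeff_scal[of 1, simplified]\<close>)
qed

lemma augmentation_hom:
  assumes "one_dim \<kappa> M"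
  shows "augmentation \<kappa> \<in> left_module_hom A.Q (F {0}) M"
  using assms unfolding one_dim_def left_module_hom_def
  by (auto simp: F_carrier augmentation_tcls F_add F_smult A.Q_carrier
      lookup_add lookup_tsmult const_coeff_add const_coeff_mult)

lemma augmentation_surj:
  assumes "one_dim \<kappa> M"
  shows "augmentation \<kappa> ` carrier (F {0}) = carrier M"
proof -
  have "\<kappa> c \<in> augmentation \<kappa> ` tcls ` supp {0}" for c
    by (intro image_eqI[OF _ image_eqI[OF refl, of "single 0 (scal c)"]])
      (simp_all add: augmentation_tcls supp_single)
  then show ?thesis using assms by (auto simp: one_dim_def F_carrier augmentation_tcls)
qed

lemma augmentation_exact:
  assumes "one_dim \<kappa> M"
  shows "dmap b0 ` carrier (F (range (to_nat :: 'x \<Rightarrow> nat))) = {x \<in> carrier (F {0}). augmentation \<kappa> x = \<zero>\<^bsub>M\<^esub>}"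
proof (intro equalityI subsetI)
  have M: "\<zero>\<^bsub>M\<^esub> = \<kappa> 0" "\<kappa> a = \<kappa> b \<longleftrightarrow> a = b" for a b
    using assms by (auto simp: one_dim_def inj_def)
  {
    fix x assume "x \<in> dmap b0 ` carrier (F (range (to_nat :: 'x \<Rightarrow> nat)))"
    then obtain g where g: "g \<in> supp (range (to_nat :: 'x \<Rightarrow> nat))" "x = tcls (tlin b0 g)"
      by (auto simp: F_carrier dmap_tcls)
    have s: "tlin b0 g \<in> supp {0}" by (rule supp_tlin[OF g(1) b0_supp])
    have "const_coeff (lookup (tlin b0 g) 0) = 0"
      unfolding exact_0[OF s] using g(1) by (intro bexI[of _ g]) simp_all
    then show "x \<in> {x \<in> carrier (F {0}). augmentation \<kappa> x = \<zero>\<^bsub>M\<^esub>}"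
      using s by (simp add: g(2) tcls_carrier augmentation_tcls M)
  next
    fix x assume "x \<in> {x \<in> carrier (F {0}). augmentation \<kappa> x = \<zero>\<^bsub>M\<^esub>}"
    then obtain f where f: "f \<in> supp {0}" "x = tcls f" "const_coeff (lookup f 0) = 0"
      by (auto simp: F_carrier augmentation_tcls M)
    then obtain g where "g \<in> supp (range (to_nat :: 'x \<Rightarrow> nat))" "f - tlin b0 g \<in> TI"
      using exact_0[OF f(1)] by blast
    then show "x \<in> dmap b0 ` carrier (F (range (to_nat :: 'x \<Rightarrow> nat)))"
      using f(2) by (intro image_eqI[of _ _ "tcls g"]) (simp_all add: dmap_tcls tcls_eq tcls_carrier)
  }
qed

end

section \<open>The trivial module\<close>

lemma Quot_simps:
  "carrier (R Quot J) = a_rcosets\<^bsub>R\<^esub> J"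
  "x \<otimes>\<^bsub>R Quot J\<^esub> y = [mod J:] x \<Otimes>\<^bsub>R\<^esub> y"
  "x \<oplus>\<^bsub>R Quot J\<^esub> y = x <+>\<^bsub>R\<^esub> y"
  "\<zero>\<^bsub>R Quot J\<^esub> = J"
  by (simp_all add: FactRing_def)

context homogeneous_relations
begin

definition aug :: "('x, 'k) free_algebra set set" where
  "aug = {A.cls t |t. const_coeff t = 0}"

lemma cls_aug: "A.cls t \<in> aug \<longleftrightarrow> const_coeff t = 0"
proof
  assume "A.cls t \<in> aug"
  then obtain s where "A.cls t = A.cls s" and s: "const_coeff s = 0" unfolding aug_def by blast
  then have "t - s \<in> I" by (simp add: A.cls_eq)
  then show "const_coeff t = 0" using I_const[of "t - s"] s by (simp add: const_coeff_diff)
qed (auto simp: aug_def)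

lemma aug_ideal: "ideal aug A.Q"
proof -
  interpret Q: ring A.Q by (rule A.Q_ring)
  have el: "\<exists>t. x = A.cls t \<and> const_coeff t = 0" if "x \<in> aug" for x
    using that by (auto simp: aug_def)
  have "subgroup aug (add_monoid A.Q)"
  proof (rule Q.add.subgroupI)
    show "aug \<subseteq> carrier A.Q" by (auto simp: aug_def)
    show "aug \<noteq> {}" using cls_aug[of 0] by auto
  next
    fix x assume "x \<in> aug"
    then obtain t where t: "x = A.cls t" "const_coeff t = 0" using el by blast
    have "\<ominus>\<^bsub>A.Q\<^esub> x = A.cls (- t)"
      by (rule Q.minus_equality) (simp_all add: t A.Q_add A.Q_zero)
    then show "\<ominus>\<^bsub>A.Q\<^esub> x \<in> aug" using t by (simp add: cls_aug const_coeff_uminus)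
  next
    fix x y assume "x \<in> aug" "y \<in> aug"
    then obtain t u where "x = A.cls t" "const_coeff t = 0" "y = A.cls u" "const_coeff u = 0" using el by metis
    then show "x \<oplus>\<^bsub>A.Q\<^esub> y \<in> aug" by (simp add: A.Q_add cls_aug const_coeff_add)
  qed
  moreover have "a \<otimes>\<^bsub>A.Q\<^esub> x \<in> aug" "x \<otimes>\<^bsub>A.Q\<^esub> a \<in> aug" if "x \<in> aug" "a \<in> carrier A.Q" for x a
  proof -
    obtain t u where "x = A.cls t" "const_coeff t = 0" "a = A.cls u"
      using el \<open>x \<in> aug\<close> \<open>a \<in> carrier A.Q\<close> unfolding A.Q_carrier by blast
    then show "a \<otimes>\<^bsub>A.Q\<^esub> x \<in> aug" "x \<otimes>\<^bsub>A.Q\<^esub> a \<in> aug"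
      by (simp_all add: A.Q_mult cls_aug const_coeff_mult)
  qed
  ultimately show ?thesis by (intro idealI A.Q_ring)
qed

lemma augmentation_ideal_eq: "augmentation_ideal A.Q comp = aug"
proof -
  interpret Q: ring A.Q by (rule A.Q_ring)
  let ?G = "\<Union>d\<in>{1..}. comp d"
  have sub: "?G \<subseteq> aug"
    by (auto simp: comp_eq cls_aug const_coeff_free_comp)
  have car: "?G \<subseteq> carrier A.Q" by (auto simp: comp_eq)
  have "Idl\<^bsub>A.Q\<^esub> ?G \<subseteq> aug"
    by (rule Q.genideal_minimal[OF aug_ideal sub])
  moreover have "aug \<subseteq> Idl\<^bsub>A.Q\<^esub> ?G"
  proof
    fix x assume "x \<in> aug"
    then obtain t where t: "x = A.cls t" "const_coeff t = 0" by (auto simp: aug_def)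
    have id: "ideal (Idl\<^bsub>A.Q\<^esub> ?G) A.Q" by (rule Q.genideal_ideal[OF car])
    have hp: "A.cls (hom_part i t) \<in> Idl\<^bsub>A.Q\<^esub> ?G" for i
    proof (cases i)
      case 0
      then show ?thesis
        using additive_subgroup.zero_closed[OF ideal.axioms(1)[OF id]] t
        by (simp add: hom_part_0 A.Q_zero)
    next
      case (Suc j)
      then have "A.cls (hom_part i t) \<in> comp i" "i \<in> {1..}" by (simp_all add: comp_eq)
      then have "A.cls (hom_part i t) \<in> ?G" by blast
      then show ?thesis using Q.genideal_self[OF car] by blast
    qed
    have "A.cls (\<Sum>i\<le>n. hom_part i t) \<in> Idl\<^bsub>A.Q\<^esub> ?G" for n
    proof (induction n)
      case 0
      show ?case using hp[of 0] by simp
    next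
      case (Suc n)
      have "A.cls (\<Sum>i\<le>n. hom_part i t) \<oplus>\<^bsub>A.Q\<^esub> A.cls (hom_part (Suc n) t) \<in> Idl\<^bsub>A.Q\<^esub> ?G"
        using additive_subgroup.a_closed[OF ideal.axioms(1)[OF id] Suc hp] .
      then show ?case by (simp add: A.Q_add)
    qed
    from this[of "free_deg t"] show "x \<in> Idl\<^bsub>A.Q\<^esub> ?G"
      using sum_hom_part[OF free_deg_le, of t] t by simp
  qed
  ultimately show ?thesis unfolding augmentation_ideal_def by (rule equalityI)
qed

abbreviation Kmod :: "(('x, 'k) free_algebra set, ('x, 'k) free_algebra set set) module" where
  "Kmod \<equiv> trivial_module A.Q comp"

definition kap :: "'k \<Rightarrow> ('x, 'k) free_algebra set set" where
  "kap c = aug +>\<^bsub>A.Q\<^esub> A.cls (scal c)"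

lemma aug_coset: "aug +>\<^bsub>A.Q\<^esub> A.cls t = kap (const_coeff t)"
  and kap_inj: "kap a = kap b \<longleftrightarrow> a = b"
proof -
  interpret Q: ring A.Q by (rule A.Q_ring)
  have "A.cls s \<ominus>\<^bsub>A.Q\<^esub> A.cls t = A.cls (s - t)" for s t
  proof -
    have "\<ominus>\<^bsub>A.Q\<^esub> A.cls t = A.cls (- t)"
      by (rule Q.minus_equality) (simp_all add: A.Q_add A.Q_zero)
    then show ?thesis by (simp add: a_minus_def A.Q_add)
  qed
  then have *: "aug +>\<^bsub>A.Q\<^esub> A.cls s = aug +>\<^bsub>A.Q\<^esub> A.cls t \<longleftrightarrow> const_coeff s = const_coeff t" for s t
    using Q.quotient_eq_iff_same_a_r_cos[OF aug_ideal, of "A.cls s" "A.cls t"]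
    by (simp add: cls_aug const_coeff_diff)
  show "aug +>\<^bsub>A.Q\<^esub> A.cls t = kap (const_coeff t)"
    unfolding kap_def * by simp
  show "kap a = kap b \<longleftrightarrow> a = b"
    unfolding kap_def * by simp
qed

lemma Kmod_fields:
  "carrier Kmod = carrier (A.Q Quot aug)"
  "\<zero>\<^bsub>Kmod\<^esub> = \<zero>\<^bsub>A.Q Quot aug\<^esub>"
  "x \<oplus>\<^bsub>Kmod\<^esub> y = x \<oplus>\<^bsub>A.Q Quot aug\<^esub> y"
  "a \<odot>\<^bsub>Kmod\<^esub> y = (aug +>\<^bsub>A.Q\<^esub> a) \<otimes>\<^bsub>A.Q Quot aug\<^esub> y"
  unfolding trivial_module_def augmentation_ideal_eq Let_def
  by (simp_all add: ring.defs module.defs)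

lemma Kmod_carrier: "carrier Kmod = range kap"
proof -
  have "carrier Kmod = (\<lambda>a. aug +>\<^bsub>A.Q\<^esub> a) ` range A.cls"
    unfolding Kmod_fields by (auto simp: FactRing_def A_RCOSETS_def' A.Q_carrier)
  also have "\<dots> = range kap"
  proof safe
    fix t show "aug +>\<^bsub>A.Q\<^esub> A.cls t \<in> range kap" by (simp add: aug_coset)
  next
    fix c show "kap c \<in> (\<lambda>a. aug +>\<^bsub>A.Q\<^esub> a) ` range A.cls" by (auto simp: kap_def)
  qed
  finally show ?thesis .
qed

lemma Kmod_add: "kap a \<oplus>\<^bsub>Kmod\<^esub> kap b = kap (a + b)"
proof -
  interpret Q: ring A.Q by (rule A.Q_ring)
  have "(aug +>\<^bsub>A.Q\<^esub> A.cls (scal a)) <+>\<^bsub>A.Q\<^esub> (aug +>\<^bsub>A.Q\<^esub> A.cls (scal b))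
      = aug +>\<^bsub>A.Q\<^esub> (A.cls (scal a) \<oplus>\<^bsub>A.Q\<^esub> A.cls (scal b))"
    by (rule abelian_subgroup.a_rcos_sum[OF abelian_subgroupI3[OF ideal.axioms(1)[OF aug_ideal]
          Q.abelian_group_axioms] A.cls_in_carrier A.cls_in_carrier])
  then show ?thesis unfolding Kmod_fields kap_def Quot_simps[where J = aug] by (simp only: A.Q_add scal_add)
qed

lemma Kmod_zero: "\<zero>\<^bsub>Kmod\<^esub> = kap 0"
proof -
  interpret Q: ring A.Q by (rule A.Q_ring)
  have "aug +>\<^bsub>A.Q\<^esub> \<zero>\<^bsub>A.Q\<^esub> = aug"
    using aug_ideal by (intro Q.a_coset_add_zero additive_subgroup.a_subset ideal.axioms(1))
  then show ?thesis unfolding Kmod_fields kap_def Quot_simps[where J = aug] by (simp only: A.Q_zero scal_0)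
qed

lemma Kmod_smult: "A.cls t \<odot>\<^bsub>Kmod\<^esub> kap c = kap (const_coeff t * c)"
proof -
  have "A.cls t \<odot>\<^bsub>Kmod\<^esub> kap c = [mod aug:] (aug +>\<^bsub>A.Q\<^esub> A.cls t) \<Otimes>\<^bsub>A.Q\<^esub> (aug +>\<^bsub>A.Q\<^esub> A.cls (scal c))"
    unfolding Kmod_fields kap_def Quot_simps[where J = aug] ..
  also have "\<dots> = aug +>\<^bsub>A.Q\<^esub> (A.cls t \<otimes>\<^bsub>A.Q\<^esub> A.cls (scal c))"
    by (rule ideal.rcoset_mult_add[OF aug_ideal A.cls_in_carrier A.cls_in_carrier])
  also have "\<dots> = kap (const_coeff t * c)"
    by (simp add: A.Q_mult aug_coset const_coeff_mult)
  finally show ?thesis .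
qed

lemma Kmod_one_dim: "one_dim kap Kmod"
  by (simp add: one_dim_def inj_def kap_inj Kmod_carrier Kmod_zero Kmod_add Kmod_smult)

abbreviation Kcomp :: "nat \<Rightarrow> ('x, 'k) free_algebra set set set" where
  "Kcomp \<equiv> trivial_comp A.Q comp"

lemma Kcomp_eq: "Kcomp n = kap ` const_coeff ` (free_comp n :: ('x, 'k) free_algebra set)"
  unfolding trivial_comp_def augmentation_ideal_eq quot_comp_def comp_eq image_image aug_coset by (rule refl)

lemma kap_Kcomp_0: "kap c \<in> Kcomp 0"
  unfolding Kcomp_eq by (intro image_eqI[OF refl] image_eqI[of _ _ "scal c"]) simp_all

lemma kap_zero_Kcomp: "kap 0 \<in> Kcomp n"
  unfolding Kcomp_eq by (intro image_eqI[OF refl] image_eqI[of _ _ 0]) simp_all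

lemma augmentation_graded: "augmentation kap \<in> graded_hom A.Q (F {0}) (Fc {0} (\<lambda>_. 0)) Kmod Kcomp 0"
proof -
  have "augmentation kap x \<in> Kcomp k" if x: "x \<in> Fc {0} (\<lambda>_. 0) k" for x k
  proof -
    obtain f where f: "tuple_part (\<lambda>_. 0) k f = f" "x = tcls f"
      using x[unfolded Fc_iff] by (elim bexE conjE)
    have "lookup f 0 \<in> free_comp k"
      by (subst f(1)[symmetric]) (simp add: lookup_tuple_part)
    then show ?thesis unfolding f(2) augmentation_tcls Kcomp_eq by blast
  qed
  then have "\<forall>k. augmentation kap ` Fc {0} (\<lambda>_. 0) k \<subseteq> Kcomp k" by (simp only: image_subset_iff) simp
  then show ?thesis
    using augmentation_hom[OF Kmod_one_dim] unfolding graded_hom_def mem_Collect_eq by simp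
qed

section \<open>A free resolution of the trivial module with countable bases\<close>

lemma graded_sub_kernel:
  assumes "\<And>j. j \<in> J' \<Longrightarrow> tuple_part \<delta> (\<delta>' j) (b j) = b j"
  shows "graded_sub \<delta>' {f \<in> supp J'. tlin b f \<in> TI}"
proof -
  have "tlin b (tuple_part \<delta>' n f) \<in> TI" if f: "f \<in> supp J'" "tlin b f \<in> TI" for f n
  proof -
    have "tuple_part \<delta> n (tlin b f) = tlin b (tuple_part \<delta>' n f)"
      by (rule tuple_part_tlin[OF f(1) assms])
    then show ?thesis using TI_tuple_part[OF f(2), of \<delta> n] by simp
  qed
  then show ?thesis
    unfolding graded_sub_def
    by (simp add: supp_add supp_tsmult supp_tuple_part tlin_add tlin_tsmult TI_add TI_tsmult)
qed

lemma covers_exact: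
  assumes c: "covers {f \<in> supp J. tlin b f \<in> TI} \<delta> c"
    and gr: "graded_sub \<delta> {f \<in> supp J. tlin b f \<in> TI}" and f: "f \<in> supp J"
  shows "tlin b f \<in> TI \<longleftrightarrow> (\<exists>g\<in>supp UNIV. f - tlin (fst c) g \<in> TI)"
proof
  assume "tlin b f \<in> TI"
  then obtain g where "f = tlin (fst c) g" using c f unfolding covers_def by blast
  then show "\<exists>g\<in>supp UNIV. f - tlin (fst c) g \<in> TI" by (intro bexI[of _ g]) simp_all
next
  assume "\<exists>g\<in>supp UNIV. f - tlin (fst c) g \<in> TI"
  then obtain g where g: "f - tlin (fst c) g \<in> TI" by blast
  have "tlin (fst c) g \<in> {f \<in> supp J. tlin b f \<in> TI}"
    by (rule graded_sub_tlin[OF gr]) (use c in \<open>simp add: covers_def\<close>)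
  then have "tlin b (f - tlin (fst c) g) + tlin b (tlin (fst c) g) \<in> TI"
    using TI_tlin[OF g] by (intro TI_add) simp_all
  then show "tlin b f \<in> TI" by (simp add: tlin_diff)
qed

lemma syz_kernel: "syz = {f \<in> supp {..<m}. tlin b1 f \<in> TI}"
  using syz_iff by blast

lemma syz_graded: "graded_sub d syz"
  unfolding syz_kernel by (rule graded_sub_kernel[where \<delta>="\<lambda>_. 1"]) (rule b1_homog, simp)

definition resolution_family ::
    "(nat \<Rightarrow> nat set) \<Rightarrow> (nat \<Rightarrow> nat \<Rightarrow> nat) \<Rightarrow> (nat \<Rightarrow> nat \<Rightarrow> ('x, 'k) tuples) \<Rightarrow> bool" where
  "resolution_family J \<delta> b \<longleftrightarrow>
    J 0 = {0} \<and> J 1 = range (to_nat :: 'x \<Rightarrow> nat) \<and> J 2 = {..<m} \<and> J 3 = UNIV \<and>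
    \<delta> 0 = (\<lambda>_. 0) \<and> \<delta> 2 = d \<and> b 0 = b0 \<and> b 1 = b1 \<and>
    (\<forall>i. \<forall>j\<in>J (Suc i). b i j \<in> supp (J i) \<and> tuple_part (\<delta> i) (\<delta> (Suc i) j) (b i j) = b i j) \<and>
    (\<forall>i. \<forall>f\<in>supp (J (Suc i)). tlin (b i) f \<in> TI \<longleftrightarrow>
        (\<exists>g\<in>supp (J (Suc (Suc i))). f - tlin (b (Suc i)) g \<in> TI)) \<and>
    (\<forall>p. b 2 p \<in> syz) \<and> (\<forall>f\<in>syz. \<exists>g. f = tlin (b 2) g)"

text \<open>
  After the three explicit terms, each kernel is covered by a countable free module, whose kernel is
  covered in turn. Every kernel stays graded, since the covering maps are homogeneous.
\<close>

lemma resolution_family_exists: "\<exists>J \<delta> b. resolution_family J \<delta> b"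
proof -
  define ker where "ker x = {f \<in> supp UNIV. tlin (fst x) f \<in> TI}"
    for x :: "(nat \<Rightarrow> ('x, 'k) tuples) \<times> (nat \<Rightarrow> nat)"
  define P where "P n x \<longleftrightarrow> (\<exists>\<delta>. \<forall>p. tuple_part \<delta> (snd x p) (fst x p) = fst x p) \<and>
      (n = 0 \<longrightarrow> covers syz d x)" for n :: nat and x :: "(nat \<Rightarrow> ('x, 'k) tuples) \<times> (nat \<Rightarrow> nat)"
  have kg: "graded_sub (snd x) (ker x)" if "P n x" for n x
  proof -
    obtain \<delta> where "\<And>p. tuple_part \<delta> (snd x p) (fst x p) = fst x p"
      using \<open>P n x\<close> unfolding P_def by blast
    then show ?thesis unfolding ker_def by (rule graded_sub_kernel)
  qed
  have "\<exists>st. \<forall>n. P n (st n) \<and> covers (ker (st n)) (snd (st n)) (st (Suc n))"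
  proof (rule dependent_nat_choice)
    obtain c where c: "covers syz d c" using covers_exist[OF syz_graded] by blast
    then have "\<forall>p. tuple_part d (snd c p) (fst c p) = fst c p" by (simp add: covers_def)
    then show "\<exists>x. P 0 x" using c unfolding P_def by blast
  next
    fix x n assume "P n x"
    from covers_exist[OF kg[OF this]] obtain c where c: "covers (ker x) (snd x) c" by blast
    then have "\<forall>p. tuple_part (snd x) (snd c p) (fst c p) = fst c p" by (simp add: covers_def)
    then have "P (Suc n) c" unfolding P_def by blast
    then show "\<exists>y. P (Suc n) y \<and> covers (ker x) (snd x) y" using c by blast
  qed
  then obtain st where st: "\<And>n. P n (st n)" "\<And>n. covers (ker (st n)) (snd (st n)) (st (Suc n))"
    by blast
  have st0: "covers syz d (st 0)" using st(1)[of 0] by (simp add: P_def)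
  define J where "J i = (if i = 0 then {0} else if i = 1 then range (to_nat :: 'x \<Rightarrow> nat)
      else if i = 2 then {..<m} else UNIV)" for i :: nat
  define \<delta> where "\<delta> i = (if i = 0 then (\<lambda>_. 0) else if i = 1 then (\<lambda>_. 1)
      else if i = 2 then d else snd (st (i - 3)))" for i :: nat
  define b where "b i = (if i = 0 then b0 else if i = 1 then b1 else fst (st (i - 2)))" for i :: nat
  have b_st: "b (Suc (Suc k)) = fst (st k)" for k by (simp add: b_def)
  have d_st: "\<delta> (Suc (Suc (Suc k))) = snd (st k)" for k by (simp add: \<delta>_def numeral_3_eq_3)
  have cases3: "i = 0 \<or> i = 1 \<or> i = 2 \<or> (\<exists>k. i = Suc (Suc (Suc k)))" for i :: nat
    by presburger
  have "resolution_family J \<delta> b"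
    unfolding resolution_family_def
  proof (intro conjI allI ballI)
    fix i j assume j: "j \<in> J (Suc i)"
    have s0: "fst (st 0) j \<in> syz" "tuple_part d (snd (st 0) j) (fst (st 0) j) = fst (st 0) j"
      using st0 by (simp_all add: covers_def)
    have s1: "tuple_part (snd (st k)) (snd (st (Suc k)) j) (fst (st (Suc k)) j) = fst (st (Suc k)) j" for k
      using st(2)[of k] by (simp add: covers_def)
    show "b i j \<in> supp (J i)"
      using cases3[of i] s0 b0_supp b1_supp by (auto simp: b_def J_def syz_iff)
    show "tuple_part (\<delta> i) (\<delta> (Suc i) j) (b i j) = b i j"
      using cases3[of i]
    proof (elim disjE exE)
      assume "i = 0" then show ?thesis using b0_homog by (simp add: b_def \<delta>_def)
    next
      assume "i = 1" then show ?thesis using b1_homog[of j] j by (simp add: b_def \<delta>_def J_def)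
    next
      assume "i = 2" then show ?thesis using s0 by (simp add: b_def \<delta>_def)
    next
      fix k assume i: "i = Suc (Suc (Suc k))"
      show ?thesis unfolding i b_st d_st by (rule s1)
    qed
  next
    fix i and f :: "('x, 'k) tuples" assume f: "f \<in> supp (J (Suc i))"
    show "tlin (b i) f \<in> TI \<longleftrightarrow> (\<exists>g\<in>supp (J (Suc (Suc i))). f - tlin (b (Suc i)) g \<in> TI)"
    proof (cases i)
      case 0
      then show ?thesis using exact_1[of f] f by (simp add: b_def J_def numeral_2_eq_2)
    next
      case (Suc k)
      show ?thesis
      proof (cases k)
        case 0
        have "tlin b1 f \<in> TI \<longleftrightarrow> (\<exists>g\<in>supp UNIV. f - tlin (fst (st 0)) g \<in> TI)"
          by (rule covers_exact[OF st0[unfolded syz_kernel] syz_graded[unfolded syz_kernel]])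
            (use f in \<open>simp add: J_def Suc 0 numeral_2_eq_2\<close>)
        then show ?thesis using 0 Suc by (simp add: b_def J_def)
      next
        case (Suc k')
        have "tlin (fst (st k')) f \<in> TI \<longleftrightarrow> (\<exists>g\<in>supp UNIV. f - tlin (fst (st (Suc k'))) g \<in> TI)"
          by (rule covers_exact[OF st(2)[unfolded ker_def] kg[OF st(1), unfolded ker_def]]) simp
        then show ?thesis using \<open>i = Suc k\<close> Suc by (simp add: b_st J_def)
      qed
    qed
  next
    show "b 2 p \<in> syz" for p using st0 by (simp add: b_def covers_def)
    show "\<exists>g. f = tlin (b 2) g" if "f \<in> syz" for f
      using st0 that by (simp add: b_def covers_def)
  qed (simp_all add: J_def \<delta>_def b_def)
  then show ?thesis by blast
qed

end

section \<open>Indecomposable syzygies and Ext\<close>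

text \<open>
  Extend a basis of \<open>S\<close> by \<open>w\<close> and prescribe the values 0 on \<open>S\<close> and 1 at \<open>w\<close>.
\<close>

lemma separating_functional:
  fixes S :: "('x, 'k::field) tuples set"
  assumes S: "0 \<in> S" "\<And>f g. f \<in> S \<Longrightarrow> g \<in> S \<Longrightarrow> f + g \<in> S" "\<And>c f. f \<in> S \<Longrightarrow> tsmult (scal c) f \<in> S"
    and w: "w \<notin> S"
  shows "\<exists>\<phi>. (\<forall>f g. \<phi> (f + g) = \<phi> f + \<phi> g) \<and> (\<forall>c f. \<phi> (tsmult (scal c) f) = c * \<phi> f) \<and>
    (\<forall>f\<in>S. \<phi> f = 0) \<and> \<phi> w = (1::'k)"
proof -
  interpret vs: vector_space_pair "\<lambda>c f. tsmult (scal c :: ('x, 'k) free_algebra) f" "(*) :: 'k \<Rightarrow> 'k \<Rightarrow> 'k"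
    by unfold_locales
      (simp_all add: tsmult_add_left tsmult_add_right scal_add tsmult_tsmult scal_mult algebra_simps)
  have sub: "vs.vs1.subspace S" unfolding vs.vs1.subspace_def using S by blast
  obtain B where B: "B \<subseteq> S" "vs.vs1.independent B" "S \<subseteq> vs.vs1.span B"
    using vs.vs1.maximal_independent_subset[of S] by blast
  have "vs.vs1.span B \<subseteq> S" by (rule vs.vs1.span_minimal[OF B(1) sub])
  then have "w \<notin> vs.vs1.span B" using w by blast
  then have ind: "vs.vs1.independent (insert w B)"
    using B(2) by (rule vs.vs1.independent_insertI)
  obtain g where g: "Vector_Spaces.linear (\<lambda>c f. tsmult (scal c) f) (*) g"
    "\<forall>x\<in>insert w B. g x = (if x = w then 1 else 0)"
    using vs.linear_independent_extend[OF ind, of "\<lambda>x. if x = w then 1 else 0"] by blast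
  interpret g: Vector_Spaces.linear "\<lambda>c f. tsmult (scal c) f" "(*)" g by (rule g(1))
  have "w \<notin> B" using B(1) w by blast
  then have gB: "g x = 0" if "x \<in> B" for x using g(2) that by auto
  have "g f = 0" if "f \<in> S" for f
    using g.eq_0_on_span[OF gB] B(3) that by blast
  then show ?thesis
    using g(2) by (intro exI[of _ g]) (simp add: g.add g.scale)
qed

context homogeneous_relations
begin

lemma decomposable_scal: "f \<in> decomposable \<Longrightarrow> tsmult (scal c) f \<in> decomposable"
proof (induction rule: decomposable.induct)
  case zero
  then show ?case by (simp add: decomposable.zero)
next
  case (add f g)
  then show ?case by (simp add: tsmult_add_right decomposable.add)
next
  case (smult t w)
  then show ?case unfolding tsmult_tsmult
    by (intro decomposable.smult) (simp_all add: const_coeff_mult)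
next
  case (tupI f)
  have "tsmult (scal c) f \<in> tupI {..<m}"
    using tupI keys_tsmult[of "scal c" f] by (auto simp: tupI_def lookup_tsmult I_lmult)
  then show ?case by (rule decomposable.tupI)
qed

lemma tupI_iff: "f \<in> tupI J \<longleftrightarrow> f \<in> supp J \<and> f \<in> TI"
  by (simp add: tupI_def supp_def TI_def)

text \<open>
  \<open>A\<^sub>+\<close> acts as zero on \<open>K\<close>, so homomorphisms to \<open>K\<close> kill all tuples with coefficients in \<open>A\<^sub>+\<close>.
\<close>

lemma hom_vanishes:
  assumes \<psi>: "\<psi> \<in> left_module_hom A.Q (F J) Kmod" and f: "f \<in> supp J"
    and c: "\<And>j. const_coeff (lookup f j) = 0"
  shows "\<psi> (tcls f) = kap 0"
proof -
  have hom: "\<psi> (tcls (f + g)) = \<psi> (tcls f) \<oplus>\<^bsub>Kmod\<^esub> \<psi> (tcls g)"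
    "\<psi> (tcls (tsmult t f)) = A.cls t \<odot>\<^bsub>Kmod\<^esub> \<psi> (tcls f)" "\<exists>c. \<psi> (tcls f) = kap c"
    if "f \<in> supp J" "g \<in> supp J" for f g t
  proof -
    have *: "tcls f \<in> carrier (F J)" "tcls g \<in> carrier (F J)" using that by (simp_all add: tcls_carrier)
    show "\<psi> (tcls (f + g)) = \<psi> (tcls f) \<oplus>\<^bsub>Kmod\<^esub> \<psi> (tcls g)"
      using \<psi> * unfolding left_module_hom_def F_add[of J f g, symmetric] by simp
    show "\<psi> (tcls (tsmult t f)) = A.cls t \<odot>\<^bsub>Kmod\<^esub> \<psi> (tcls f)"
      using \<psi> * unfolding left_module_hom_def F_smult[of J t f, symmetric] by simp
    have "\<psi> (tcls f) \<in> carrier Kmod" using \<psi> * unfolding left_module_hom_def by blast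
    then show "\<exists>c. \<psi> (tcls f) = kap c" by (auto simp: Kmod_carrier)
  qed
  have z: "\<psi> (tcls 0) = kap 0"
  proof -
    obtain c where "\<psi> (tcls 0) = kap c" using hom(3)[OF supp_zero supp_zero] by blast
    then show ?thesis using hom(2)[OF supp_zero supp_zero, of 0] by (simp add: Kmod_smult)
  qed
  have "\<psi> (tcls (\<Sum>j\<in>B. single j (lookup f j))) = kap 0"
    if "finite B" "B \<subseteq> J" for B
    using that
  proof (induction B)
    case empty
    then show ?case by (simp add: z)
  next
    case (insert j B)
    have j: "j \<in> J" and B: "(\<Sum>j\<in>B. single j (lookup f j)) \<in> supp J"
      using insert.prems by (auto intro!: supp_sum supp_single)
    have s: "single j u \<in> supp J" for u :: "('x, 'k) free_algebra" using j by (rule supp_single)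
    obtain e where e: "\<psi> (tcls (single j 1)) = kap e" using hom(3)[OF s s] by blast
    have "single j (lookup f j) = tsmult (lookup f j) (single j 1)"
      by (simp add: tsmult_single)
    then have "\<psi> (tcls (single j (lookup f j))) = kap 0"
      using hom(2)[OF s s] by (simp add: e Kmod_smult c)
    then show ?case using insert hom(1)[OF s B] by (simp add: Kmod_add)
  qed
  from this[of "keys f"] show ?thesis
    using f by (simp add: supp_def tuple_eq_sum_single[of f, symmetric])
qed

end

locale minimal_homogeneous_relations = homogeneous_relations m r d
  for m :: nat and r :: "nat \<Rightarrow> ('x::finite, 'k::field) free_algebra" and d :: "nat \<Rightarrow> nat" +
  assumes minimal: "minimal_relations m r"
begin

text \<open>
  If \<open>t\<^sub>i\<close> had a nonzero constant term, the part of degree \<open>d\<^sub>i\<close> of \<open>\<Sum> t\<^sub>j r\<^sub>j \<in> I T\<^sub>+\<close> would express \<open>r\<^sub>i\<close>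
  by the other relations: an element of \<open>I\<close> of degree below \<open>d\<^sub>i\<close> does not involve \<open>r\<^sub>i\<close>.
\<close>

lemma syz_const:
  assumes w: "w \<in> syz"
  shows "const_coeff (lookup w i) = 0"
proof (cases "i < m")
  case False
  then have "lookup w i = 0" using w by (intro supp_lookup[of w "{..<m}"]) (auto simp: syz_iff)
  then show ?thesis by simp
next
  case i: True
  show ?thesis
  proof (rule ccontr)
    assume c: "const_coeff (lookup w i) \<noteq> 0" (is "?c \<noteq> 0")
    let ?S = "{..<m} - {i}"
    let ?I = "Idl\<^bsub>ring_of_type_algebra\<^esub> (r ` ?S)"
    have low: "hom_part e y \<in> ?I" if "y \<in> I" "e < d i" for y e
      using that
    proof (induction y arbitrary: e rule: I_induct)
      case (incl s)
      then obtain j where j: "s = r j" "j < m" by auto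
      show ?case
      proof (cases "j = i")
        case True
        then show ?thesis using j incl(2) by (simp add: hom_part_free_comp[OF r_homog[OF i]] Idl_zero)
      next
        case False
        then have "r j \<in> ?I" using j by (intro Idl_incl) auto
        then show ?thesis using j by (simp add: hom_part_free_comp[OF r_homog] Idl_zero)
      qed
    next
      case (lmult a b)
      show ?case unfolding hom_part_mult
        by (intro Idl_sum Idl_lmult lmult(1)) (use lmult(2) in simp)
    next
      case (rmult a b)
      show ?case unfolding hom_part_mult
        by (intro Idl_sum Idl_rmult rmult(1)) (use rmult(2) in simp)
    qed (simp_all add: Idl_zero Idl_add hom_part_add)
    let ?w = "lookup (tuple_part d (d i) w)"
    obtain e where e: "d i = Suc e" using d_ge[OF i] by (cases "d i") auto
    have "(\<Sum>j<m. ?w j * rdiv x (r j)) \<in> ?I" for x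
    proof -
      have "(\<Sum>j<m. ?w j * rdiv x (r j)) = hom_part e (\<Sum>j<m. lookup w j * rdiv x (r j))"
        unfolding e using w by (intro tuple_part_rdiv) (simp add: syz_def)
      also have "\<dots> \<in> ?I" using w e by (intro low) (simp_all add: syz_def)
      finally show ?thesis .
    qed
    then have "(\<Sum>j<m. ?w j * r j) \<in> ?I"
      unfolding sum_r_rdiv by (rule Idl_sum[OF Idl_rmult])
    moreover have "(\<Sum>j\<in>?S. ?w j * r j) \<in> ?I"
      by (intro Idl_sum Idl_lmult Idl_incl) simp
    moreover have "(\<Sum>j<m. ?w j * r j) = ?w i * r i + (\<Sum>j\<in>?S. ?w j * r j)"
      using i by (intro sum.remove) simp_all
    ultimately have "?w i * r i \<in> ?I" using Idl_diff by fastforce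
    then have "scal (inverse ?c) * (?w i * r i) \<in> ?I" by (rule Idl_lmult)
    moreover have "?w i = scal ?c" by (simp add: lookup_tuple_part hom_part_0)
    moreover have "scal (inverse ?c) * (scal ?c * r i) = r i"
      unfolding mult.assoc[symmetric] scal_mult[symmetric] using c by simp
    ultimately have ri: "r i \<in> ?I" by simp
    have "r ` {..<m} \<subseteq> ?I"
    proof safe
      fix j assume "j < m"
      then show "r j \<in> ?I" using ri by (cases "j = i") (auto intro: Idl_incl)
    qed
    then have "Idl\<^bsub>ring_of_type_algebra\<^esub> (r ` {..<m}) \<subseteq> ?I"
      by (intro ring.genideal_minimal[OF ring_type_algebra] ideal_Idl)
    moreover have "?I \<subseteq> Idl\<^bsub>ring_of_type_algebra\<^esub> (r ` {..<m})"
      by (intro ring.genideal_minimal[OF ring_type_algebra] ideal_Idl) (auto intro: Idl_incl)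
    ultimately have "?I = Idl\<^bsub>ring_of_type_algebra\<^esub> (r ` {..<m})" by simp
    moreover have "?S \<subset> {..<m}" using i by auto
    ultimately show False using minimal unfolding minimal_relations_def by blast
  qed
qed

text \<open>
  The functional, applied to the part of degree \<open>n\<close>, defines a homomorphism from the syzygies to \<open>K\<close>:
  multiplication by \<open>T\<^sub>+\<close> leads to decomposable tuples, where it vanishes. Composed with the cover of the
  syzygies it is a cocycle on the third term of the resolution. A coboundary factors through a homomorphism
  \<open>A\<^sup>m \<rightarrow> K\<close>, which vanishes on syzygies by \<open>syz_const\<close>, whereas the cocycle is 1 at a preimage of \<open>w\<close>.
\<close>

theorem ext_nonzero_of_indecomposable:
  assumes w: "w \<in> syz" and wn: "tuple_part d n w = w" and nd: "w \<notin> decomposable"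
  shows "ext_nonzero (quot_algebra m r) comp 3 n"
proof -
  obtain J \<delta> b where "resolution_family J \<delta> b" using resolution_family_exists by (elim exE)
  note fam = this[unfolded resolution_family_def]
  have J: "J 0 = {0}" "J 1 = range (to_nat :: 'x \<Rightarrow> nat)" "J 2 = {..<m}" "J 3 = UNIV"
    and \<delta>: "\<delta> 0 = (\<lambda>_. 0)" "\<delta> 2 = d" and b: "b 0 = b0" "b 1 = b1"
    using fam by simp_all
  have bs: "\<And>i j. j \<in> J (Suc i) \<Longrightarrow> b i j \<in> supp (J i)" and
    bh: "\<And>i j. j \<in> J (Suc i) \<Longrightarrow> tuple_part (\<delta> i) (\<delta> (Suc i) j) (b i j) = b i j"
    using fam by simp_all
  have ex: "\<And>i f. f \<in> supp (J (Suc i)) \<Longrightarrow> tlin (b i) f \<in> TI \<longleftrightarrow>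
        (\<exists>g\<in>supp (J (Suc (Suc i))). f - tlin (b (Suc i)) g \<in> TI)"
    using fam by (elim conjE) (drule spec, drule bspec, assumption+)
  have b2: "\<And>p. b 2 p \<in> syz" and b2c: "\<And>f. f \<in> syz \<Longrightarrow> \<exists>g. f = tlin (b 2) g"
    using fam by simp_all
  have res: "graded_free_resolution A.Q comp J \<delta> (\<lambda>i. dmap (b i)) (augmentation kap) Kmod Kcomp"
    unfolding graded_free_resolution_def is_resolution_def
  proof (intro conjI allI F_left_module one_dim_left_module[OF Kmod_one_dim])
    show "dmap (b i) \<in> left_module_hom A.Q (F (J (Suc i))) (F (J i))" for i
      by (rule dmap_hom[OF bs])
    show "augmentation kap \<in> left_module_hom A.Q (F (J 0)) Kmod"
      unfolding J by (rule augmentation_hom[OF Kmod_one_dim])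
    show "augmentation kap ` carrier (F (J 0)) = carrier Kmod"
      unfolding J by (rule augmentation_surj[OF Kmod_one_dim])
    show "dmap (b 0) ` carrier (F (J 1)) = {x \<in> carrier (F (J 0)). augmentation kap x = \<zero>\<^bsub>Kmod\<^esub>}"
      unfolding J b by (rule augmentation_exact[OF Kmod_one_dim])
    show "dmap (b (Suc i)) ` carrier (F (J (Suc (Suc i))))
        = {x \<in> carrier (F (J (Suc i))). dmap (b i) x = \<zero>\<^bsub>F (J i)\<^esub>}" for i
      by (rule dmap_exact[OF ex bs])
    show "dmap (b i) \<in> graded_hom A.Q (F (J (Suc i))) (Fc (J (Suc i)) (\<delta> (Suc i))) (F (J i)) (Fc (J i) (\<delta> i)) 0" for i
      by (rule dmap_graded_hom[OF bs bh])
    show "augmentation kap \<in> graded_hom A.Q (F (J 0)) (Fc (J 0) (\<delta> 0)) Kmod Kcomp 0"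
      unfolding J \<delta> by (rule augmentation_graded)
  qed
  obtain \<phi> :: "('x, 'k) tuples \<Rightarrow> 'k" where \<phi>: "\<And>f g. \<phi> (f + g) = \<phi> f + \<phi> g"
    "\<And>c f. \<phi> (tsmult (scal c) f) = c * \<phi> f" "\<And>f. f \<in> decomposable \<Longrightarrow> \<phi> f = 0" "\<phi> w = 1"
    using separating_functional[OF decomposable.zero decomposable.add decomposable_scal nd] by blast
  define \<Phi> where "\<Phi> f = \<phi> (tuple_part d n f)" for f
  have \<phi>0: "\<phi> 0 = 0" using \<phi>(3)[OF decomposable.zero] .
  have \<Phi>_add: "\<Phi> (f + g) = \<Phi> f + \<Phi> g" for f g by (simp add: \<Phi>_def tuple_part_add \<phi>)
  have \<phi>_sum: "\<phi> (sum f B) = (\<Sum>a\<in>B. \<phi> (f a))" for f :: "nat \<Rightarrow> ('x, 'k) tuples" and B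
    by (induction B rule: infinite_finite_induct) (simp_all add: \<phi> \<phi>0)
  have \<Phi>_tupI: "\<Phi> f = 0" if "f \<in> supp {..<m}" "f \<in> TI" for f
  proof -
    have "tuple_part d n f \<in> tupI {..<m}"
      using that by (simp add: tupI_iff supp_tuple_part TI_tuple_part)
    then show ?thesis unfolding \<Phi>_def by (intro \<phi>(3) decomposable.tupI)
  qed
  have \<Phi>_smult: "\<Phi> (tsmult t f) = const_coeff t * \<Phi> f" if f: "f \<in> syz" for t f
  proof -
    have "\<Phi> (tsmult t f) = (\<Sum>a\<le>n. \<phi> (tsmult (hom_part a t) (tuple_part d (n - a) f)))"
      by (simp add: \<Phi>_def tuple_part_tsmult \<phi>_sum)
    also have "\<dots> = (\<Sum>a\<le>n. if a = 0 then const_coeff t * \<Phi> f else 0)"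
    proof (rule sum.cong)
      fix a
      show "\<phi> (tsmult (hom_part a t) (tuple_part d (n - a) f)) = (if a = 0 then const_coeff t * \<Phi> f else 0)"
      proof (cases "a = 0")
        case True
        then show ?thesis by (simp add: hom_part_0 \<phi> \<Phi>_def)
      next
        case False
        have "tsmult (hom_part a t) (tuple_part d (n - a) f) \<in> decomposable"
          by (intro decomposable.smult syz_tuple_part f) (simp add: const_coeff_hom_part False)
        then show ?thesis using False by (simp add: \<phi>)
      qed
    qed simp
    finally show ?thesis by (simp add: sum.delta)
  qed
  have b2_syz: "tlin (b 2) g \<in> syz" for g by (rule graded_sub_tlin[OF syz_graded b2])
  define \<kappa> where "\<kappa> x = kap (\<Phi> (tlin (b 2) (SOME g. tcls g = x)))" for x
  have \<kappa>: "\<kappa> (tcls g) = kap (\<Phi> (tlin (b 2) g))" for g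
  proof -
    let ?g = "SOME h. tcls h = tcls g"
    have "tcls ?g = tcls g" by (rule someI[of "\<lambda>h. tcls h = tcls g" g]) simp
    then have "?g - g \<in> TI" by (simp only: tcls_eq)
    then have TI: "tlin (b 2) (?g - g) \<in> TI" by (rule TI_tlin)
    have "tlin (b 2) (?g - g) \<in> supp {..<m}" using b2_syz[of "?g - g"] by (simp add: syz_iff)
    then have "\<Phi> (tlin (b 2) (?g - g)) = 0" using TI by (rule \<Phi>_tupI)
    then have "\<Phi> (tlin (b 2) ?g) = \<Phi> (tlin (b 2) g)"
      using \<Phi>_add[of "tlin (b 2) (?g - g)" "tlin (b 2) g"] by (simp add: tlin_diff)
    then show ?thesis by (simp add: \<kappa>_def)
  qed
  have \<kappa>_hom: "\<kappa> \<in> left_module_hom A.Q (F (J 3)) Kmod"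
    unfolding left_module_hom_def F_carrier
    by (auto simp: \<kappa> Kmod_carrier F_add F_smult Kmod_add Kmod_smult A.Q_carrier tlin_add tlin_tsmult
        \<Phi>_add \<Phi>_smult[OF b2_syz])
  have \<kappa>_graded: "\<kappa> x \<in> (if n \<le> k then Kcomp (k - n) else {\<zero>\<^bsub>Kmod\<^esub>})" if x: "x \<in> Fc (J 3) (\<delta> 3) k" for x k
  proof -
    obtain g where g: "g \<in> supp (J 3)" "tuple_part (\<delta> 3) k g = g" "x = tcls g"
      using x[unfolded Fc_iff] by (elim bexE conjE)
    have "tuple_part d k (tlin (b 2) g) = tlin (b 2) (tuple_part (\<delta> 3) k g)"
      by (rule tuple_part_tlin[OF g(1)]) (use bh[of _ 2] in \<open>simp add: \<delta>\<close>)
    then have *: "tuple_part d k (tlin (b 2) g) = tlin (b 2) g" by (simp only: g(2))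
    show ?thesis
    proof (cases "k = n")
      case True
      then show ?thesis by (simp add: g(3) \<kappa> kap_Kcomp_0)
    next
      case False
      have "tuple_part d n (tlin (b 2) g) = 0"
        by (subst *[symmetric]) (simp add: tuple_part_tuple_part False[symmetric])
      then have "\<kappa> x = kap 0" by (simp add: g(3) \<kappa> \<Phi>_def \<phi>0)
      then show ?thesis by (simp add: kap_zero_Kcomp Kmod_zero)
    qed
  qed
  have "\<kappa> \<in> ext_cochains A.Q comp J \<delta> 3 n"
    unfolding ext_cochains_def graded_hom_def mem_Collect_eq image_subset_iff
  proof (intro conjI allI ballI)
    show "\<kappa> \<in> left_module_hom A.Q (F (J 3)) Kmod" by (rule \<kappa>_hom)
    fix k x assume "x \<in> Fc (J 3) (\<delta> 3) k"
    then show "\<kappa> x \<in> (if n \<le> k then Kcomp (k - n) else {\<zero>\<^bsub>Kmod\<^esub>})" by (rule \<kappa>_graded)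
  qed
  moreover have "\<kappa> (dmap (b 3) x) = \<zero>\<^bsub>Kmod\<^esub>" if x: "x \<in> carrier (F (J (Suc 3)))" for x
  proof -
    obtain g where g: "g \<in> supp (J (Suc 3))" "x = tcls g"
      using x[unfolded F_carrier_iff] by (elim bexE)
    have s: "tlin (b 3) g \<in> supp (J (Suc 2))" by (simp add: J)
    have "\<exists>g'\<in>supp (J (Suc (Suc 2))). tlin (b 3) g - tlin (b (Suc 2)) g' \<in> TI"
      using g(1) by (intro bexI[of _ g]) simp_all
    then have "tlin (b 2) (tlin (b 3) g) \<in> TI" by (rule iffD2[OF ex[OF s]])
    moreover have "tlin (b 2) (tlin (b 3) g) \<in> supp {..<m}" using b2_syz by (simp add: syz_iff)
    ultimately have "\<Phi> (tlin (b 2) (tlin (b 3) g)) = 0" by (intro \<Phi>_tupI)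
    then show ?thesis by (simp add: g(2) dmap_tcls \<kappa> Kmod_zero)
  qed
  ultimately have coc: "\<kappa> \<in> ext_cocycles A.Q comp J \<delta> (\<lambda>i. dmap (b i)) 3 n"
    unfolding ext_cocycles_def by simp
  have cob: "\<kappa> \<notin> ext_coboundaries A.Q comp J \<delta> (\<lambda>i. dmap (b i)) 3 n"
  proof
    assume "\<kappa> \<in> ext_coboundaries A.Q comp J \<delta> (\<lambda>i. dmap (b i)) 3 n"
    then obtain \<psi> where \<psi>: "\<psi> \<in> ext_cochains A.Q comp J \<delta> 2 n"
      "\<And>x. x \<in> carrier (F (J 3)) \<Longrightarrow> \<kappa> x = \<psi> (dmap (b 2) x)"
      unfolding ext_coboundaries_def by auto
    obtain g where g: "w = tlin (b 2) g" using b2c[OF w] by blast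
    have "tcls g \<in> carrier (F (J 3))" by (simp add: J tcls_carrier)
    then have \<kappa>w: "\<kappa> (tcls g) = \<psi> (tcls w)" using \<psi>(2) by (simp add: dmap_tcls g)
    have "\<psi> \<in> left_module_hom A.Q (F {..<m}) Kmod"
      using \<psi>(1) unfolding ext_cochains_def graded_hom_def J by simp
    moreover have "w \<in> supp {..<m}" using w unfolding syz_iff by (rule conjunct1)
    ultimately have "\<psi> (tcls w) = kap 0" by (intro hom_vanishes syz_const[OF w])
    moreover have "\<kappa> (tcls g) = kap 1" by (simp add: \<kappa> g[symmetric] \<Phi>_def wn \<phi>(4))
    ultimately show False using \<kappa>w by (simp add: kap_inj)
  qed
  show ?thesis
    unfolding ext_nonzero_def Q_eq using res coc cob by blast
qed

end


section \<open>Lifting along surjections from free and projective modules\<close>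

lemma left_module_homD:
  assumes "f \<in> left_module_hom R M N"
  shows "x \<in> carrier M \<Longrightarrow> f x \<in> carrier N"
    "x \<in> carrier M \<Longrightarrow> y \<in> carrier M \<Longrightarrow> f (x \<oplus>\<^bsub>M\<^esub> y) = f x \<oplus>\<^bsub>N\<^esub> f y"
    "a \<in> carrier R \<Longrightarrow> x \<in> carrier M \<Longrightarrow> f (a \<odot>\<^bsub>M\<^esub> x) = a \<odot>\<^bsub>N\<^esub> f x"
  using assms unfolding left_module_hom_def by auto

lemma left_module_hom_comp:
  assumes f: "f \<in> left_module_hom R M N" and g: "g \<in> left_module_hom R N P"
  shows "(\<lambda>x. g (f x)) \<in> left_module_hom R M P"
  unfolding left_module_hom_def
  by (simp add: left_module_homD[OF f] left_module_homD[OF g])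

context left_module
begin

lemma smult_l_null: "x \<in> carrier M \<Longrightarrow> \<zero>\<^bsub>R\<^esub> \<odot>\<^bsub>M\<^esub> x = \<zero>\<^bsub>M\<^esub>"
proof -
  assume x: "x \<in> carrier M"
  have c: "\<zero>\<^bsub>R\<^esub> \<odot>\<^bsub>M\<^esub> x \<in> carrier M" using x by (intro smult_closed) simp_all
  have "\<zero>\<^bsub>R\<^esub> \<odot>\<^bsub>M\<^esub> x = \<zero>\<^bsub>R\<^esub> \<odot>\<^bsub>M\<^esub> x \<oplus>\<^bsub>M\<^esub> \<zero>\<^bsub>R\<^esub> \<odot>\<^bsub>M\<^esub> x"
    using smult_l_distr[of "\<zero>\<^bsub>R\<^esub>" "\<zero>\<^bsub>R\<^esub>" x] x by simp
  then show ?thesis using c by (metis M.add.l_cancel_one')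
qed

lemma smult_r_null: "a \<in> carrier R \<Longrightarrow> a \<odot>\<^bsub>M\<^esub> \<zero>\<^bsub>M\<^esub> = \<zero>\<^bsub>M\<^esub>"
proof -
  assume a: "a \<in> carrier R"
  have c: "a \<odot>\<^bsub>M\<^esub> \<zero>\<^bsub>M\<^esub> \<in> carrier M" using a by (intro smult_closed) simp_all
  have "a \<odot>\<^bsub>M\<^esub> \<zero>\<^bsub>M\<^esub> = a \<odot>\<^bsub>M\<^esub> \<zero>\<^bsub>M\<^esub> \<oplus>\<^bsub>M\<^esub> a \<odot>\<^bsub>M\<^esub> \<zero>\<^bsub>M\<^esub>"
    using smult_r_distr[of a "\<zero>\<^bsub>M\<^esub>" "\<zero>\<^bsub>M\<^esub>"] a by simp
  then show ?thesis using c by (metis M.add.l_cancel_one')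
qed

lemma hom_zero:
  assumes N: "left_module R N" and f: "f \<in> left_module_hom R M N"
  shows "f \<zero>\<^bsub>M\<^esub> = \<zero>\<^bsub>N\<^esub>"
proof -
  interpret N: left_module R N by (rule N)
  have "f (\<zero>\<^bsub>R\<^esub> \<odot>\<^bsub>M\<^esub> \<zero>\<^bsub>M\<^esub>) = \<zero>\<^bsub>R\<^esub> \<odot>\<^bsub>N\<^esub> f \<zero>\<^bsub>M\<^esub>"
    by (rule left_module_homD(3)[OF f]) simp_all
  then show ?thesis using left_module_homD(1)[OF f, of "\<zero>\<^bsub>M\<^esub>"]
    by (simp add: smult_l_null N.smult_l_null)
qed

definition lin_ext :: "('j \<Rightarrow> 'b) \<Rightarrow> ('j \<Rightarrow> 'a) \<Rightarrow> 'b" where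
  "lin_ext u x = finsum M (\<lambda>j. x j \<odot>\<^bsub>M\<^esub> u j) {j. x j \<noteq> \<zero>\<^bsub>R\<^esub>}"

lemma lin_ext_superset:
  assumes "finite S" "{j. x j \<noteq> \<zero>\<^bsub>R\<^esub>} \<subseteq> S" "\<And>j. j \<in> S \<Longrightarrow> u j \<in> carrier M" "\<And>j. j \<in> S \<Longrightarrow> x j \<in> carrier R"
  shows "lin_ext u x = finsum M (\<lambda>j. x j \<odot>\<^bsub>M\<^esub> u j) S"
  unfolding lin_ext_def
proof (rule M.add.finprod_mono_neutral_cong_left)
  show "x j \<odot>\<^bsub>M\<^esub> u j = \<zero>\<^bsub>M\<^esub>" if "j \<in> S - {j. x j \<noteq> \<zero>\<^bsub>R\<^esub>}" for j
    using that assms(3)[of j] by (simp add: smult_l_null)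
  show "(\<lambda>j. x j \<odot>\<^bsub>M\<^esub> u j) \<in> S \<rightarrow> carrier M"
    using assms by (auto intro: smult_closed)
qed (use assms in auto)

lemma finsum_smult:
  assumes "finite S" "a \<in> carrier R" "g \<in> S \<rightarrow> carrier M"
  shows "a \<odot>\<^bsub>M\<^esub> finsum M g S = finsum M (\<lambda>j. a \<odot>\<^bsub>M\<^esub> g j) S"
  using assms
proof (induction S)
  case empty
  then show ?case by (simp add: smult_r_null)
next
  case (insert k S)
  then have g: "g k \<in> carrier M" "g \<in> S \<rightarrow> carrier M" by auto
  have "(\<lambda>j. a \<odot>\<^bsub>M\<^esub> g j) \<in> S \<rightarrow> carrier M" "a \<odot>\<^bsub>M\<^esub> g k \<in> carrier M"
    using g insert.prems by (auto intro: smult_closed)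
  then show ?case using insert g by (simp add: smult_r_distr)
qed

lemma free_module_mem:
  "x \<in> carrier (free_module R J) \<longleftrightarrow>
     finite {j. x j \<noteq> \<zero>\<^bsub>R\<^esub>} \<and> (\<forall>j\<in>J. x j \<in> carrier R) \<and> (\<forall>j. j \<notin> J \<longrightarrow> x j = \<zero>\<^bsub>R\<^esub>)"
  by (simp add: free_module_def)

lemma free_module_ops:
  "x \<oplus>\<^bsub>free_module R J\<^esub> y = (\<lambda>j. x j \<oplus>\<^bsub>R\<^esub> y j)"
  "a \<odot>\<^bsub>free_module R J\<^esub> x = (\<lambda>j. a \<otimes>\<^bsub>R\<^esub> x j)"
  by (simp_all add: free_module_def)

lemma lin_ext_hom:
  assumes u: "\<And>j. j \<in> J \<Longrightarrow> u j \<in> carrier M"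
  shows "lin_ext u \<in> left_module_hom R (free_module R J) M"
proof -
  have supp: "finite {j. x j \<noteq> \<zero>\<^bsub>R\<^esub>}" "{j. x j \<noteq> \<zero>\<^bsub>R\<^esub>} \<subseteq> J" "j \<in> J \<Longrightarrow> x j \<in> carrier R"
    if "x \<in> carrier (free_module R J)" for x j
    using that unfolding free_module_mem by auto
  have ext: "lin_ext u x = finsum M (\<lambda>j. x j \<odot>\<^bsub>M\<^esub> u j) S"
    if "x \<in> carrier (free_module R J)" "finite S" "{j. x j \<noteq> \<zero>\<^bsub>R\<^esub>} \<subseteq> S" "S \<subseteq> J" for x S
    using that u supp(3)[OF that(1)] by (intro lin_ext_superset) auto
  have fc: "(\<lambda>j. x j \<odot>\<^bsub>M\<^esub> u j) \<in> S \<rightarrow> carrier M" if "x \<in> carrier (free_module R J)" "S \<subseteq> J" for x S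
    using that u supp(3)[OF that(1)] by (auto intro: smult_closed)
  show ?thesis
    unfolding left_module_hom_def
  proof (intro CollectI conjI ballI)
    show "lin_ext u \<in> carrier (free_module R J) \<rightarrow> carrier M"
    proof
      fix x assume x: "x \<in> carrier (free_module R J)"
      show "lin_ext u x \<in> carrier M"
        unfolding lin_ext_def by (rule M.finsum_closed[OF fc[OF x supp(2)[OF x]]])
    qed
  next
    fix x y assume x: "x \<in> carrier (free_module R J)" and y: "y \<in> carrier (free_module R J)"
    let ?S = "{j. x j \<noteq> \<zero>\<^bsub>R\<^esub>} \<union> {j. y j \<noteq> \<zero>\<^bsub>R\<^esub>}"
    have S: "finite ?S" "?S \<subseteq> J" using supp[OF x] supp[OF y] by auto
    have xy: "{j. (x \<oplus>\<^bsub>free_module R J\<^esub> y) j \<noteq> \<zero>\<^bsub>R\<^esub>} \<subseteq> ?S"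
      by (auto simp: free_module_ops)
    have "lin_ext u (x \<oplus>\<^bsub>free_module R J\<^esub> y) = finsum M (\<lambda>j. (x \<oplus>\<^bsub>free_module R J\<^esub> y) j \<odot>\<^bsub>M\<^esub> u j) ?S"
      using S xy u supp(3)[OF x] supp(3)[OF y]
      by (intro lin_ext_superset) (auto simp: free_module_ops)
    also have "\<dots> = finsum M (\<lambda>j. x j \<odot>\<^bsub>M\<^esub> u j \<oplus>\<^bsub>M\<^esub> y j \<odot>\<^bsub>M\<^esub> u j) ?S"
    proof (rule M.finsum_cong')
      show "(\<lambda>j. x j \<odot>\<^bsub>M\<^esub> u j \<oplus>\<^bsub>M\<^esub> y j \<odot>\<^bsub>M\<^esub> u j) \<in> ?S \<rightarrow> carrier M"
        using fc[OF x S(2)] fc[OF y S(2)] by (auto simp: Pi_iff)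
      fix j assume "j \<in> ?S"
      then have "j \<in> J" using S by blast
      then show "(x \<oplus>\<^bsub>free_module R J\<^esub> y) j \<odot>\<^bsub>M\<^esub> u j = x j \<odot>\<^bsub>M\<^esub> u j \<oplus>\<^bsub>M\<^esub> y j \<odot>\<^bsub>M\<^esub> u j"
        unfolding free_module_ops using u supp(3)[OF x] supp(3)[OF y] by (intro smult_l_distr)
    qed simp
    also have "\<dots> = finsum M (\<lambda>j. x j \<odot>\<^bsub>M\<^esub> u j) ?S \<oplus>\<^bsub>M\<^esub> finsum M (\<lambda>j. y j \<odot>\<^bsub>M\<^esub> u j) ?S"
      by (rule M.finsum_addf[OF fc[OF x S(2)] fc[OF y S(2)]])
    also have "\<dots> = lin_ext u x \<oplus>\<^bsub>M\<^esub> lin_ext u y"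
      using ext[OF x S(1) _ S(2)] ext[OF y S(1) _ S(2)] by simp
    finally show "lin_ext u (x \<oplus>\<^bsub>free_module R J\<^esub> y) = lin_ext u x \<oplus>\<^bsub>M\<^esub> lin_ext u y" .
  next
    fix a x assume a: "a \<in> carrier R" and x: "x \<in> carrier (free_module R J)"
    let ?S = "{j. x j \<noteq> \<zero>\<^bsub>R\<^esub>}"
    have ax: "{j. (a \<odot>\<^bsub>free_module R J\<^esub> x) j \<noteq> \<zero>\<^bsub>R\<^esub>} \<subseteq> ?S" using a by (auto simp: free_module_ops)
    have "lin_ext u (a \<odot>\<^bsub>free_module R J\<^esub> x) = finsum M (\<lambda>j. (a \<odot>\<^bsub>free_module R J\<^esub> x) j \<odot>\<^bsub>M\<^esub> u j) ?S"
      using ax u supp[OF x] a by (intro lin_ext_superset) (auto simp: free_module_ops)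
    also have "\<dots> = finsum M (\<lambda>j. a \<odot>\<^bsub>M\<^esub> (x j \<odot>\<^bsub>M\<^esub> u j)) ?S"
    proof (rule M.finsum_cong')
      show "(\<lambda>j. a \<odot>\<^bsub>M\<^esub> (x j \<odot>\<^bsub>M\<^esub> u j)) \<in> ?S \<rightarrow> carrier M"
        using fc[OF x supp(2)[OF x]] a by (auto simp: Pi_iff intro: smult_closed)
      fix j assume "j \<in> ?S"
      then have "j \<in> J" using supp[OF x] by blast
      then show "(a \<odot>\<^bsub>free_module R J\<^esub> x) j \<odot>\<^bsub>M\<^esub> u j = a \<odot>\<^bsub>M\<^esub> (x j \<odot>\<^bsub>M\<^esub> u j)"
        unfolding free_module_ops using u supp(3)[OF x] a by (intro smult_assoc1)
    qed simp
    also have "\<dots> = a \<odot>\<^bsub>M\<^esub> lin_ext u x"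
      unfolding lin_ext_def by (rule finsum_smult[symmetric, OF supp(1)[OF x] a fc[OF x supp(2)[OF x]]])
    finally show "lin_ext u (a \<odot>\<^bsub>free_module R J\<^esub> x) = a \<odot>\<^bsub>M\<^esub> lin_ext u x" .
  qed
qed

end

text \<open>
  Induction over the support of \<open>x\<close>, splitting off one basis element at a time.
\<close>

lemma free_homs_agree:
  assumes N: "left_module R N" and \<alpha>: "\<alpha> \<in> left_module_hom R (free_module R J) N"
    and \<beta>: "\<beta> \<in> left_module_hom R (free_module R J) N"
    and eq: "\<And>j. j \<in> J \<Longrightarrow> \<alpha> (\<lambda>i. if i = j then \<one>\<^bsub>R\<^esub> else \<zero>\<^bsub>R\<^esub>) = \<beta> (\<lambda>i. if i = j then \<one>\<^bsub>R\<^esub> else \<zero>\<^bsub>R\<^esub>)"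
    and x: "x \<in> carrier (free_module R J)"
  shows "\<alpha> x = \<beta> x"
proof -
  interpret N: left_module R N by (rule N)
  let ?F = "free_module R J"
  let ?e = "\<lambda>j i. if i = j then \<one>\<^bsub>R\<^esub> else \<zero>\<^bsub>R\<^esub>"
  have e: "?e j \<in> carrier ?F" if "j \<in> J" for j
    using that unfolding N.free_module_mem by auto
  have z: "(\<lambda>_. \<zero>\<^bsub>R\<^esub>) \<in> carrier ?F" unfolding N.free_module_mem by simp
  have zero: "\<gamma> (\<lambda>_. \<zero>\<^bsub>R\<^esub>) = \<zero>\<^bsub>N\<^esub>" if \<gamma>: "\<gamma> \<in> left_module_hom R ?F N" for \<gamma>
  proof -
    have "\<zero>\<^bsub>R\<^esub> \<odot>\<^bsub>?F\<^esub> (\<lambda>_. \<zero>\<^bsub>R\<^esub>) = (\<lambda>_. \<zero>\<^bsub>R\<^esub>)" by (simp add: N.free_module_ops)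
    then have "\<gamma> (\<lambda>_. \<zero>\<^bsub>R\<^esub>) = \<zero>\<^bsub>R\<^esub> \<odot>\<^bsub>N\<^esub> \<gamma> (\<lambda>_. \<zero>\<^bsub>R\<^esub>)"
      using left_module_homD(3)[OF \<gamma> _ z, of "\<zero>\<^bsub>R\<^esub>"] by simp
    then show ?thesis using left_module_homD(1)[OF \<gamma> z] N.smult_l_null by simp
  qed
  have "\<alpha> y = \<beta> y" if "finite S" "y \<in> carrier ?F" "{j. y j \<noteq> \<zero>\<^bsub>R\<^esub>} \<subseteq> S" for S y
    using that
  proof (induction S arbitrary: y)
    case empty
    then have "y = (\<lambda>_. \<zero>\<^bsub>R\<^esub>)" by auto
    then show ?case using zero[OF \<alpha>] zero[OF \<beta>] by simp
  next
    case (insert k S)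
    note yF = insert.prems(1)[unfolded N.free_module_mem]
    show ?case
    proof (cases "k \<in> J")
      case False
      then have "{j. y j \<noteq> \<zero>\<^bsub>R\<^esub>} \<subseteq> S" using insert.prems(2) yF by auto
      then show ?thesis using insert by blast
    next
      case True
      define y' where "y' = y(k := \<zero>\<^bsub>R\<^esub>)"
      have yk: "y k \<in> carrier R" using True yF by blast
      have yc: "y j \<in> carrier R" for j using yF by (cases "j \<in> J") auto
      have y': "y' \<in> carrier ?F" unfolding N.free_module_mem y'_def
        using yF by (auto elim: finite_subset[rotated])
      have "\<alpha> y' = \<beta> y'" by (rule insert.IH[OF y']) (use insert.prems(2) in \<open>auto simp: y'_def\<close>)
      moreover have s: "y k \<odot>\<^bsub>?F\<^esub> ?e k \<in> carrier ?F"
        using True yk unfolding N.free_module_mem N.free_module_ops by auto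
      moreover have "y = y' \<oplus>\<^bsub>?F\<^esub> (y k \<odot>\<^bsub>?F\<^esub> ?e k)"
        using yc by (auto simp: y'_def N.free_module_ops fun_eq_iff)
      moreover have "\<alpha> (y k \<odot>\<^bsub>?F\<^esub> ?e k) = \<beta> (y k \<odot>\<^bsub>?F\<^esub> ?e k)"
        using left_module_homD(3)[OF \<alpha> yk e[OF True]] left_module_homD(3)[OF \<beta> yk e[OF True]] eq[OF True]
        by simp
      ultimately show ?thesis
        using left_module_homD(2)[OF \<alpha> y' s] left_module_homD(2)[OF \<beta> y' s] by metis
    qed
  qed
  then show ?thesis using x unfolding N.free_module_mem by blast
qed

lemma free_lift:
  assumes M: "left_module R M" and N: "left_module R N"
    and \<beta>: "\<beta> \<in> left_module_hom R M N" and \<alpha>: "\<alpha> \<in> left_module_hom R (free_module R J) N"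
    and im: "\<alpha> ` carrier (free_module R J) \<subseteq> \<beta> ` carrier M"
  shows "\<exists>\<gamma>\<in>left_module_hom R (free_module R J) M. \<forall>x\<in>carrier (free_module R J). \<beta> (\<gamma> x) = \<alpha> x"
proof -
  interpret M: left_module R M by (rule M)
  let ?F = "free_module R J"
  let ?e = "\<lambda>j i. if i = j then \<one>\<^bsub>R\<^esub> else \<zero>\<^bsub>R\<^esub>"
  have e: "?e j \<in> carrier ?F" if "j \<in> J" for j
    using that unfolding M.free_module_mem by auto
  have "\<forall>j. \<exists>u. j \<in> J \<longrightarrow> u \<in> carrier M \<and> \<beta> u = \<alpha> (?e j)"
  proof
    fix j show "\<exists>u. j \<in> J \<longrightarrow> u \<in> carrier M \<and> \<beta> u = \<alpha> (?e j)"
    proof (cases "j \<in> J")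
      case True
      then have "\<alpha> (?e j) \<in> \<beta> ` carrier M" using im e by blast
      then show ?thesis by (metis imageE)
    qed simp
  qed
  from choice[OF this] obtain u where u: "\<And>j. j \<in> J \<Longrightarrow> u j \<in> carrier M" "\<And>j. j \<in> J \<Longrightarrow> \<beta> (u j) = \<alpha> (?e j)"
    by blast
  have \<gamma>: "M.lin_ext u \<in> left_module_hom R ?F M" by (rule M.lin_ext_hom[OF u(1)])
  have "\<beta> (M.lin_ext u x) = \<alpha> x" if x: "x \<in> carrier ?F" for x
  proof (rule free_homs_agree[OF N left_module_hom_comp[OF \<gamma> \<beta>] \<alpha> _ x])
    fix j assume j: "j \<in> J"
    have "M.lin_ext u (?e j) = finsum M (\<lambda>i. ?e j i \<odot>\<^bsub>M\<^esub> u i) {j}"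
      using j u(1) by (intro M.lin_ext_superset) auto
    also have "\<dots> = u j" using j u(1)
      by (simp add: M.smult_one)
    finally show "\<beta> (M.lin_ext u (?e j)) = \<alpha> (?e j)" using u(2)[OF j] by simp
  qed
  then show ?thesis using \<gamma> by blast
qed

lemma projective_lift:
  fixes P :: "('a, 'p, 'c) module_scheme"
  assumes P: "projective_module R P" and M: "left_module R M" and N: "left_module R N"
    and \<beta>: "\<beta> \<in> left_module_hom R M N" and \<alpha>: "\<alpha> \<in> left_module_hom R P N"
    and im: "\<alpha> ` carrier P \<subseteq> \<beta> ` carrier M"
  shows "\<exists>\<gamma>\<in>left_module_hom R P M. \<forall>x\<in>carrier P. \<beta> (\<gamma> x) = \<alpha> x"
proof -
  from P obtain J :: "'p set" and s q where s: "s \<in> left_module_hom R P (free_module R J)"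
    and q: "q \<in> left_module_hom R (free_module R J) P" and sq: "\<And>x. x \<in> carrier P \<Longrightarrow> q (s x) = x"
    unfolding projective_module_def by blast
  have "(\<lambda>x. \<alpha> (q x)) ` carrier (free_module R J) \<subseteq> \<beta> ` carrier M"
    using im left_module_homD(1)[OF q] by blast
  from free_lift[OF M N \<beta> left_module_hom_comp[OF q \<alpha>] this]
  obtain \<gamma> where \<gamma>: "\<gamma> \<in> left_module_hom R (free_module R J) M"
    "\<And>x. x \<in> carrier (free_module R J) \<Longrightarrow> \<beta> (\<gamma> x) = \<alpha> (q x)" by blast
  show ?thesis
    by (rule bexI[OF _ left_module_hom_comp[OF s \<gamma>(1)]])
      (simp add: \<gamma>(2) left_module_homD(1)[OF s] sq)
qed

section \<open>Comparison with a short projective resolution\<close>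

text \<open>
  Lift the identity of \<open>K\<close> to chain maps from the free to the projective resolution and back. Their
  composites \<open>C\<^sub>i\<close> commute with the differentials, and \<open>C\<^sub>2\<close> kills the kernel of \<open>d\<^sub>1\<close> because the projective
  resolution ends in degree 2: its last differential is injective.
\<close>

lemma short_resolution_comparison:
  assumes F: "left_module R (free_module R J0)" "left_module R (free_module R J1)" "left_module R (free_module R J2)"
    and e: "e \<in> left_module_hom R (free_module R J0) K" "e ` carrier (free_module R J0) = carrier K"
    and d0: "d0 \<in> left_module_hom R (free_module R J1) (free_module R J0)"
      "d0 ` carrier (free_module R J1) = {x \<in> carrier (free_module R J0). e x = \<zero>\<^bsub>K\<^esub>}"
    and d1: "d1 \<in> left_module_hom R (free_module R J2) (free_module R J1)"
      "d1 ` carrier (free_module R J2) = {x \<in> carrier (free_module R J1). d0 x = \<zero>\<^bsub>free_module R J0\<^esub>}"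
    and res: "is_resolution R P dP \<eta> K" and proj: "\<And>i. projective_module R (P i)"
    and short: "carrier (P 3) = {\<zero>\<^bsub>P 3\<^esub>}"
  shows "\<exists>C0 C1 C2. C0 \<in> left_module_hom R (free_module R J0) (free_module R J0) \<and>
    C1 \<in> left_module_hom R (free_module R J1) (free_module R J1) \<and>
    C2 \<in> left_module_hom R (free_module R J2) (free_module R J2) \<and>
    (\<forall>x\<in>carrier (free_module R J0). e (C0 x) = e x) \<and>
    (\<forall>x\<in>carrier (free_module R J1). d0 (C1 x) = C0 (d0 x)) \<and>
    (\<forall>x\<in>carrier (free_module R J2). d1 (C2 x) = C1 (d1 x)) \<and>
    (\<forall>x\<in>carrier (free_module R J2). d1 x = \<zero>\<^bsub>free_module R J1\<^esub> \<longrightarrow> C2 x = \<zero>\<^bsub>free_module R J2\<^esub>)"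
proof -
  let ?F0 = "free_module R J0" and ?F1 = "free_module R J1" and ?F2 = "free_module R J2"
  note r = res[unfolded is_resolution_def]
  have Pm: "\<And>i. left_module R (P i)" and K: "left_module R K" and
    dh: "\<And>i. dP i \<in> left_module_hom R (P (Suc i)) (P i)" and
    \<eta>: "\<eta> \<in> left_module_hom R (P 0) K" "\<eta> ` carrier (P 0) = carrier K" and
    ex0: "dP 0 ` carrier (P 1) = {x \<in> carrier (P 0). \<eta> x = \<zero>\<^bsub>K\<^esub>}" and
    ex1: "\<And>i. dP (Suc i) ` carrier (P (Suc (Suc i))) = {x \<in> carrier (P (Suc i)). dP i x = \<zero>\<^bsub>P i\<^esub>}"
    using r by blast+
  have dh0: "dP 0 \<in> left_module_hom R (P 1) (P 0)" and dh1: "dP 1 \<in> left_module_hom R (P 2) (P 1)"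
    and dh2: "dP 2 \<in> left_module_hom R (P 3) (P 2)"
    using dh[of 0] dh[of 1] dh[of 2] by (simp_all add: numeral_2_eq_2 numeral_3_eq_3)
  have ex1': "dP 1 ` carrier (P 2) = {x \<in> carrier (P 1). dP 0 x = \<zero>\<^bsub>P 0\<^esub>}"
    and ex2: "dP 2 ` carrier (P 3) = {x \<in> carrier (P 2). dP 1 x = \<zero>\<^bsub>P 1\<^esub>}"
    using ex1[of 0] ex1[of 1] by (simp_all add: numeral_2_eq_2 numeral_3_eq_3)
  \<comment> \<open>A chain map from the projective resolution to the free one, built degree by degree.\<close>
  have "\<eta> ` carrier (P 0) \<subseteq> e ` carrier ?F0" using \<eta> e by simp
  from projective_lift[OF proj F(1) K e(1) \<eta>(1) this]
  obtain f0 where f0: "f0 \<in> left_module_hom R (P 0) ?F0" "\<And>x. x \<in> carrier (P 0) \<Longrightarrow> e (f0 x) = \<eta> x" by blast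
  have "f0 (dP 0 x) \<in> d0 ` carrier ?F1" if "x \<in> carrier (P 1)" for x
  proof -
    have "dP 0 x \<in> {x \<in> carrier (P 0). \<eta> x = \<zero>\<^bsub>K\<^esub>}" using ex0 \<open>x \<in> carrier (P 1)\<close> by blast
    then show ?thesis unfolding d0(2) using f0(2) left_module_homD(1)[OF f0(1)] by simp
  qed
  then have "(\<lambda>x. f0 (dP 0 x)) ` carrier (P 1) \<subseteq> d0 ` carrier ?F1" by blast
  from projective_lift[OF proj F(2) F(1) d0(1) left_module_hom_comp[OF dh0 f0(1)] this]
  obtain f1 where f1: "f1 \<in> left_module_hom R (P 1) ?F1" "\<And>x. x \<in> carrier (P 1) \<Longrightarrow> d0 (f1 x) = f0 (dP 0 x)" by blast
  have "f1 (dP 1 x) \<in> d1 ` carrier ?F2" if "x \<in> carrier (P 2)" for x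
  proof -
    have "dP 1 x \<in> {x \<in> carrier (P 1). dP 0 x = \<zero>\<^bsub>P 0\<^esub>}" using ex1' \<open>x \<in> carrier (P 2)\<close> by blast
    then show ?thesis unfolding d1(2)
      using f1(2) left_module_homD(1)[OF f1(1)] left_module.hom_zero[OF Pm F(1) f0(1)] by simp
  qed
  then have "(\<lambda>x. f1 (dP 1 x)) ` carrier (P 2) \<subseteq> d1 ` carrier ?F2" by blast
  from projective_lift[OF proj F(3) F(2) d1(1) left_module_hom_comp[OF dh1 f1(1)] this]
  obtain f2 where f2: "f2 \<in> left_module_hom R (P 2) ?F2" "\<And>x. x \<in> carrier (P 2) \<Longrightarrow> d1 (f2 x) = f1 (dP 1 x)" by blast
  \<comment> \<open>The chain map in the other direction.\<close>
  have "e ` carrier ?F0 \<subseteq> \<eta> ` carrier (P 0)" using \<eta> e by simp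
  from free_lift[OF Pm K \<eta>(1) e(1) this]
  obtain g0 where g0: "g0 \<in> left_module_hom R ?F0 (P 0)" "\<And>x. x \<in> carrier ?F0 \<Longrightarrow> \<eta> (g0 x) = e x" by blast
  have "g0 (d0 x) \<in> dP 0 ` carrier (P 1)" if "x \<in> carrier ?F1" for x
  proof -
    have "d0 x \<in> {x \<in> carrier ?F0. e x = \<zero>\<^bsub>K\<^esub>}" using d0(2) \<open>x \<in> carrier ?F1\<close> by blast
    then show ?thesis unfolding ex0 using g0(2) left_module_homD(1)[OF g0(1)] by simp
  qed
  then have "(\<lambda>x. g0 (d0 x)) ` carrier ?F1 \<subseteq> dP 0 ` carrier (P 1)" by blast
  from free_lift[OF Pm Pm dh0 left_module_hom_comp[OF d0(1) g0(1)] this]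
  obtain g1 where g1: "g1 \<in> left_module_hom R ?F1 (P 1)" "\<And>x. x \<in> carrier ?F1 \<Longrightarrow> dP 0 (g1 x) = g0 (d0 x)" by blast
  have "g1 (d1 x) \<in> dP 1 ` carrier (P 2)" if "x \<in> carrier ?F2" for x
  proof -
    have "d1 x \<in> {x \<in> carrier ?F1. d0 x = \<zero>\<^bsub>?F0\<^esub>}" using d1(2) \<open>x \<in> carrier ?F2\<close> by blast
    then show ?thesis unfolding ex1'
      using g1(2) left_module_homD(1)[OF g1(1)] left_module.hom_zero[OF F(1) Pm g0(1)] by simp
  qed
  then have "(\<lambda>x. g1 (d1 x)) ` carrier ?F2 \<subseteq> dP 1 ` carrier (P 2)" by blast
  from free_lift[OF Pm Pm dh1 left_module_hom_comp[OF d1(1) g1(1)] this]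
  obtain g2 where g2: "g2 \<in> left_module_hom R ?F2 (P 2)" "\<And>x. x \<in> carrier ?F2 \<Longrightarrow> dP 1 (g2 x) = g1 (d1 x)" by blast
  have inj: "x = \<zero>\<^bsub>P 2\<^esub>" if "x \<in> carrier (P 2)" "dP 1 x = \<zero>\<^bsub>P 1\<^esub>" for x
  proof -
    have "x \<in> dP 2 ` carrier (P 3)" unfolding ex2 using that by simp
    then show ?thesis unfolding short using left_module.hom_zero[OF Pm Pm dh2] by simp
  qed
  have 0: "\<forall>x\<in>carrier ?F0. e (f0 (g0 x)) = e x"
    using f0(2) g0(2) left_module_homD(1)[OF g0(1)] by simp
  have 1: "\<forall>x\<in>carrier ?F1. d0 (f1 (g1 x)) = f0 (g0 (d0 x))"
    using f1(2) g1(2) left_module_homD(1)[OF g1(1)] by simp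
  have 2: "\<forall>x\<in>carrier ?F2. d1 (f2 (g2 x)) = f1 (g1 (d1 x))"
    using f2(2) g2(2) left_module_homD(1)[OF g2(1)] by simp
  have 3: "\<forall>x\<in>carrier ?F2. d1 x = \<zero>\<^bsub>?F1\<^esub> \<longrightarrow> f2 (g2 x) = \<zero>\<^bsub>?F2\<^esub>"
  proof (intro ballI impI)
    fix x assume x: "x \<in> carrier ?F2" "d1 x = \<zero>\<^bsub>?F1\<^esub>"
    have "dP 1 (g2 x) = \<zero>\<^bsub>P 1\<^esub>"
      using g2(2)[OF x(1)] x(2) left_module.hom_zero[OF F(2) Pm g1(1)] by simp
    then have "g2 x = \<zero>\<^bsub>P 2\<^esub>" using inj left_module_homD(1)[OF g2(1) x(1)] by blast
    then show "f2 (g2 x) = \<zero>\<^bsub>?F2\<^esub>" using left_module.hom_zero[OF Pm F(3) f2(1)] by simp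
  qed
  show ?thesis
    by (intro exI[of _ "\<lambda>x. f0 (g0 x)"] exI[of _ "\<lambda>x. f1 (g1 x)"] exI[of _ "\<lambda>x. f2 (g2 x)"] conjI
        left_module_hom_comp[OF g0(1) f0(1)] left_module_hom_comp[OF g1(1) f1(1)]
        left_module_hom_comp[OF g2(1) f2(1)] 0 1 2 3)
qed


section \<open>Global dimension less than three\<close>

context homogeneous_relations
begin

text \<open>
  The copy of \<open>K\<close> consisting of constant functions. It lives in the type over which the supremum in the
  definition of global dimension ranges. Since the functions are constant, \<open>kval\<close> may evaluate them
  anywhere.
\<close>

definition kfun :: "'k \<Rightarrow> nat \<times> ('x, 'k) free_algebra set \<Rightarrow> ('x, 'k) free_algebra set" where
  "kfun c = (\<lambda>_. A.cls (scal c))"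

definition kval :: "(nat \<times> ('x, 'k) free_algebra set \<Rightarrow> ('x, 'k) free_algebra set) \<Rightarrow> 'k" where
  "kval f = class_const (f undefined)"

definition Kfun :: "(('x, 'k) free_algebra set,
    nat \<times> ('x, 'k) free_algebra set \<Rightarrow> ('x, 'k) free_algebra set) module" where
  "Kfun = \<lparr>carrier = range kfun, monoid.mult = undefined, one = undefined,
     ring.zero = kfun 0, add = (\<lambda>f g. kfun (kval f + kval g)),
     module.smult = (\<lambda>a f. kfun (class_const a * kval f))\<rparr>"

lemma kval_kfun [simp]: "kval (kfun c) = c"
  by (simp add: kval_def kfun_def class_const_cls)

lemma Kfun_one_dim: "one_dim kfun Kfun"
proof -
  have "inj kfun" by (rule inj_on_inverseI[of _ kval]) simp
  then show ?thesis by (simp add: one_dim_def Kfun_def class_const_cls)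
qed

lemma free_hom_tlin:
  assumes C: "C \<in> left_module_hom A.Q (F J) (F J')"
  shows "\<exists>c. (\<forall>j\<in>J. c j \<in> supp J') \<and> (\<forall>f\<in>supp J. C (tcls f) = tcls (tlin c f))"
proof -
  have "\<forall>j. \<exists>g. j \<in> J \<longrightarrow> g \<in> supp J' \<and> C (tcls (single j 1)) = tcls g"
  proof
    fix j show "\<exists>g. j \<in> J \<longrightarrow> g \<in> supp J' \<and> C (tcls (single j 1)) = tcls g"
    proof (cases "j \<in> J")
      case True
      have "C (tcls (single j 1)) \<in> carrier (F J')"
        by (rule left_module_homD(1)[OF C tcls_carrier[OF supp_single[OF True]]])
      then obtain g where "g \<in> supp J'" "C (tcls (single j 1)) = tcls g"
        unfolding F_carrier_iff by (elim bexE)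
      then show ?thesis by (intro exI[of _ g]) simp
    qed simp
  qed
  from choice[OF this] obtain c where c: "\<And>j. j \<in> J \<Longrightarrow> c j \<in> supp J'"
    "\<And>j. j \<in> J \<Longrightarrow> C (tcls (single j 1)) = tcls (c j)" by blast
  have D: "dmap c \<in> left_module_hom A.Q (F J) (F J')" by (rule dmap_hom[OF c(1)])
  have e: "(\<lambda>i. if i = j then \<one>\<^bsub>A.Q\<^esub> else \<zero>\<^bsub>A.Q\<^esub>) = tcls (single j 1)" for j
    by (rule ext) (simp add: tcls_def lookup_single when_def A.Q_one A.Q_zero)
  have "C (tcls f) = tcls (tlin c f)" if f: "f \<in> supp J" for f
  proof -
    have "C (tcls f) = dmap c (tcls f)"
      by (rule free_homs_agree[OF F_left_module C D _ tcls_carrier[OF f]])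
        (simp add: e c(2) dmap_tcls tlin_single)
    then show ?thesis by (simp only: dmap_tcls)
  qed
  then show ?thesis using c(1) by (intro exI[of _ c]) simp
qed

lemma tlin_single_one: "tlin (\<lambda>j. single j 1) f = f"
  by (simp add: tlin_def tsmult_single tuple_eq_sum_single[symmetric])

lemma tlin_diff_left: "tlin (\<lambda>j. u j - v j) f = tlin u f - tlin v f"
  by (simp add: tlin_def tsmult_diff_right sum_subtractf)

lemma tlin_tlin: "tlin (\<lambda>j. tlin b (h j)) f = tlin b (tlin h f)"
  by (simp add: tlin_def[of _ f] tlin_sum tlin_tsmult)

text \<open>
  Standard homotopies \<open>h\<^sub>0\<close>, \<open>h\<^sub>1\<close> between the identity and the composite chain map \<open>C\<close> of
  \<open>short_resolution_comparison\<close> give \<open>\<rho> = 1 - C\<^sub>2 - h\<^sub>1 d\<^sub>1\<close>. It maps \<open>A\<^sup>m\<close> into \<open>ker d\<^sub>1\<close>, and on \<open>ker d\<^sub>1\<close>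
  it is the identity since \<open>C\<^sub>2\<close> vanishes there. All identities hold modulo tuples over \<open>I\<close>.
\<close>

lemma syzygy_retraction:
  assumes short: "has_projective_resolution A.Q Kfun n" and n: "n < 3"
  shows "\<exists>\<rho>. (\<forall>i<m. \<rho> i \<in> syz) \<and> (\<forall>w\<in>syz. w - tlin \<rho> w \<in> TI)"
proof -
  let ?X = "range (to_nat :: 'x \<Rightarrow> nat)"
  have c1: "\<And>i. i \<in> {..<m} \<Longrightarrow> b1 i \<in> supp ?X" by (rule b1_supp)
  have c0: "\<And>j. j \<in> ?X \<Longrightarrow> b0 j \<in> supp {0}" by (rule b0_supp)
  have d0: "dmap b0 \<in> left_module_hom A.Q (F ?X) (F {0})" by (rule dmap_hom[OF c0])
  have d1: "dmap b1 \<in> left_module_hom A.Q (F {..<m}) (F ?X)" by (rule dmap_hom[OF c1])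
  have e1: "dmap b1 ` carrier (F {..<m}) = {x \<in> carrier (F ?X). dmap b0 x = \<zero>\<^bsub>F {0}\<^esub>}"
    by (rule dmap_exact[OF exact_1 c1])
  obtain P :: "nat \<Rightarrow> (('x, 'k) free_algebra set, nat \<times> ('x, 'k) free_algebra set \<Rightarrow> ('x, 'k) free_algebra set) module"
    and dP \<eta> where res: "is_resolution A.Q P dP \<eta> Kfun" and proj: "\<And>i. projective_module A.Q (P i)"
    and "\<And>i. i > n \<Longrightarrow> carrier (P i) = {\<zero>\<^bsub>P i\<^esub>}"
    using short unfolding has_projective_resolution_def by blast
  then have P3: "carrier (P 3) = {\<zero>\<^bsub>P 3\<^esub>}" using n by blast
  obtain C0 C1 C2 where
    C: "C0 \<in> left_module_hom A.Q (F {0}) (F {0})" "C1 \<in> left_module_hom A.Q (F ?X) (F ?X)"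
      "C2 \<in> left_module_hom A.Q (F {..<m}) (F {..<m})" and
    C_eq: "\<forall>x\<in>carrier (F {0}). augmentation kfun (C0 x) = augmentation kfun x"
      "\<forall>x\<in>carrier (F ?X). dmap b0 (C1 x) = C0 (dmap b0 x)"
      "\<forall>x\<in>carrier (F {..<m}). dmap b1 (C2 x) = C1 (dmap b1 x)"
      "\<forall>x\<in>carrier (F {..<m}). dmap b1 x = \<zero>\<^bsub>F ?X\<^esub> \<longrightarrow> C2 x = \<zero>\<^bsub>F {..<m}\<^esub>"
    using short_resolution_comparison[OF F_left_module F_left_module F_left_module
        augmentation_hom[OF Kfun_one_dim] augmentation_surj[OF Kfun_one_dim] d0
        augmentation_exact[OF Kfun_one_dim]
        d1 e1 res proj P3] by (elim exE conjE)
  obtain c0 where *: "(\<forall>j\<in>{0}. c0 j \<in> supp {0}) \<and> (\<forall>f\<in>supp {0}. C0 (tcls f) = tcls (tlin c0 f))"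
    using free_hom_tlin[OF C(1)] by (elim exE)
  have c0s: "\<And>j. j \<in> {0} \<Longrightarrow> c0 j \<in> supp {0}"
    by (rule bspec[OF conjunct1[OF *]])
  have c0: "\<And>f. f \<in> supp {0} \<Longrightarrow> C0 (tcls f) = tcls (tlin c0 f)"
    by (rule bspec[OF conjunct2[OF *]])
  obtain c1 where *: "(\<forall>j\<in>?X. c1 j \<in> supp ?X) \<and> (\<forall>f\<in>supp ?X. C1 (tcls f) = tcls (tlin c1 f))"
    using free_hom_tlin[OF C(2)] by (elim exE)
  have c1s: "\<And>j. j \<in> ?X \<Longrightarrow> c1 j \<in> supp ?X"
    by (rule bspec[OF conjunct1[OF *]])
  have c1: "\<And>f. f \<in> supp ?X \<Longrightarrow> C1 (tcls f) = tcls (tlin c1 f)"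
    by (rule bspec[OF conjunct2[OF *]])
  obtain c2 where *: "(\<forall>j\<in>{..<m}. c2 j \<in> supp {..<m}) \<and> (\<forall>f\<in>supp {..<m}. C2 (tcls f) = tcls (tlin c2 f))"
    using free_hom_tlin[OF C(3)] by (elim exE)
  have c2s: "\<And>j. j \<in> {..<m} \<Longrightarrow> c2 j \<in> supp {..<m}"
    by (rule bspec[OF conjunct1[OF *]])
  have c2: "\<And>f. f \<in> supp {..<m} \<Longrightarrow> C2 (tcls f) = tcls (tlin c2 f)"
    by (rule bspec[OF conjunct2[OF *]])
  have k0: "const_coeff (lookup (tlin c0 f) 0) = const_coeff (lookup f 0)"
    if f: "f \<in> supp {0}" for f
  proof -
    have "augmentation kfun (C0 (tcls f)) = augmentation kfun (tcls f)"
      using C_eq(1) tcls_carrier[OF f] by blast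
    then show ?thesis unfolding c0[OF f] augmentation_tcls by (metis kval_kfun)
  qed
  have k1: "tlin b0 (tlin c1 f) - tlin c0 (tlin b0 f) \<in> TI" if f: "f \<in> supp ?X" for f
  proof -
    have "dmap b0 (C1 (tcls f)) = C0 (dmap b0 (tcls f))" using C_eq(2) tcls_carrier[OF f] by blast
    then show ?thesis by (simp only: c1[OF f] dmap_tcls c0[OF supp_tlin[OF f b0_supp]] tcls_eq)
  qed
  have k2: "tlin b1 (tlin c2 f) - tlin c1 (tlin b1 f) \<in> TI" if f: "f \<in> supp {..<m}" for f
  proof -
    have "dmap b1 (C2 (tcls f)) = C1 (dmap b1 (tcls f))" using C_eq(3) tcls_carrier[OF f] by blast
    then show ?thesis by (simp only: c2[OF f] dmap_tcls c1[OF supp_tlin[OF f b1_supp]] tcls_eq)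
  qed
  have k3: "tlin c2 w \<in> TI" if w: "w \<in> syz" for w
  proof -
    have f: "w \<in> supp {..<m}" "tlin b1 w \<in> TI" using w unfolding syz_iff by simp_all
    have "dmap b1 (tcls w) = \<zero>\<^bsub>F ?X\<^esub>" using f(2) by (simp only: dmap_tcls tcls_zero_iff)
    then have "C2 (tcls w) = \<zero>\<^bsub>F {..<m}\<^esub>" using C_eq(4) tcls_carrier[OF f(1)] by blast
    then show ?thesis by (simp only: c2[OF f(1)] tcls_zero_iff)
  qed
  \<comment> \<open>\<open>h\<^sub>0\<close> is defined on the basis element by exactness, so that \<open>d\<^sub>0 h\<^sub>0 = 1 - C\<^sub>0\<close>.\<close>
  have "\<exists>g\<in>supp ?X. (single 0 1 - c0 0) - tlin b0 g \<in> TI"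
  proof -
    have s: "single 0 1 \<in> supp {0}" by (rule supp_single) simp
    have s': "single 0 1 - c0 0 \<in> supp {0}" by (rule supp_diff[OF s c0s]) simp
    have "const_coeff (lookup (single 0 1 - c0 0) 0) = 0"
      using k0[OF s] unfolding tlin_single tsmult_one lookup_minus const_coeff_diff lookup_single_eq by simp
    then show ?thesis unfolding exact_0[OF s'] .
  qed
  then obtain g where g: "g \<in> supp ?X" "(single 0 1 - c0 0) - tlin b0 g \<in> TI" by blast
  define h0 :: "nat \<Rightarrow> ('x, 'k) tuples" where "h0 = (\<lambda>_. g)"
  have h0s: "tlin h0 f \<in> supp ?X" for f by (rule supp_tlin[of f UNIV]) (simp_all add: h0_def g)
  have H0: "f - tlin c0 f - tlin b0 (tlin h0 f) \<in> TI" if f: "f \<in> supp {0}" for f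
  proof -
    have "tlin (\<lambda>j. (single j 1 - c0 j) - tlin b0 (h0 j)) f \<in> TI"
      by (rule TI_tlin_right) (use f g in \<open>auto simp: supp_def h0_def\<close>)
    then show ?thesis by (simp only: tlin_diff_left tlin_single_one tlin_tlin)
  qed
  \<comment> \<open>\<open>h\<^sub>1\<close> is obtained in the same way, with \<open>d\<^sub>1 h\<^sub>1 = 1 - C\<^sub>1 - h\<^sub>0 d\<^sub>0\<close>.\<close>
  have "\<forall>j. \<exists>g. j \<in> ?X \<longrightarrow> g \<in> supp {..<m} \<and> (single j 1 - c1 j - tlin h0 (b0 j)) - tlin b1 g \<in> TI"
  proof
    fix j show "\<exists>g. j \<in> ?X \<longrightarrow> g \<in> supp {..<m} \<and> (single j 1 - c1 j - tlin h0 (b0 j)) - tlin b1 g \<in> TI"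
    proof (cases "j \<in> ?X")
      case True
      have s: "single j 1 \<in> supp ?X" using True by (rule supp_single)
      let ?f = "single j 1 - c1 j - tlin h0 (b0 j)"
      have f: "?f \<in> supp ?X" by (intro supp_diff s c1s[OF True] h0s)
      have "tlin b0 (c1 j) - tlin c0 (b0 j) \<in> TI" using k1[OF s] by (simp add: tlin_single)
      moreover have "b0 j - tlin c0 (b0 j) - tlin b0 (tlin h0 (b0 j)) \<in> TI" by (rule H0[OF b0_supp])
      moreover have "tlin b0 ?f = (b0 j - tlin c0 (b0 j) - tlin b0 (tlin h0 (b0 j))) - (tlin b0 (c1 j) - tlin c0 (b0 j))"
        by (simp add: tlin_diff tlin_single)
      ultimately have "tlin b0 ?f \<in> TI" using TI_diff by (simp only:)
      then obtain g where "g \<in> supp {..<m}" "?f - tlin b1 g \<in> TI" unfolding exact_1[OF f] by blast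
      then show ?thesis by (intro exI[of _ g]) simp
    qed simp
  qed
  from choice[OF this] obtain h1 where h1: "\<And>j. j \<in> ?X \<Longrightarrow> h1 j \<in> supp {..<m}"
    "\<And>j. j \<in> ?X \<Longrightarrow> (single j 1 - c1 j - tlin h0 (b0 j)) - tlin b1 (h1 j) \<in> TI" by blast
  have H1: "f - tlin c1 f - tlin h0 (tlin b0 f) - tlin b1 (tlin h1 f) \<in> TI" if f: "f \<in> supp ?X" for f
  proof -
    have "tlin (\<lambda>j. (single j 1 - c1 j - tlin h0 (b0 j)) - tlin b1 (h1 j)) f \<in> TI"
      by (rule TI_tlin_right, rule h1(2)) (use f in \<open>auto simp: supp_def\<close>)
    then show ?thesis by (simp only: tlin_diff_left tlin_single_one tlin_tlin)
  qed
  define \<rho> where "\<rho> i = single i 1 - c2 i - tlin h1 (b1 i)" for i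
  have "\<rho> i \<in> syz" if i: "i < m" for i
  proof -
    have s: "single i 1 \<in> supp {..<m}" using i by (intro supp_single) simp
    have \<rho>s: "\<rho> i \<in> supp {..<m}" unfolding \<rho>_def
      by (intro supp_diff s c2s supp_tlin[OF b1_supp h1(1)]) (use i in simp_all)
    have "tlin b0 (b1 i) \<in> TI"
    proof -
      have "\<exists>g\<in>supp {..<m}. b1 i - tlin b1 g \<in> TI"
        using s by (intro bexI[of _ "single i 1"]) (simp_all add: tlin_single)
      then show ?thesis unfolding exact_1[OF b1_supp] .
    qed
    then have 1: "tlin h0 (tlin b0 (b1 i)) \<in> TI" by (rule TI_tlin)
    have 2: "tlin b1 (c2 i) - tlin c1 (b1 i) \<in> TI" using k2[OF s] by (simp add: tlin_single)
    have 3: "b1 i - tlin c1 (b1 i) - tlin h0 (tlin b0 (b1 i)) - tlin b1 (tlin h1 (b1 i)) \<in> TI"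
      by (rule H1[OF b1_supp])
    have "tlin b1 (\<rho> i) = (b1 i - tlin c1 (b1 i) - tlin h0 (tlin b0 (b1 i)) - tlin b1 (tlin h1 (b1 i)))
        - (tlin b1 (c2 i) - tlin c1 (b1 i)) + tlin h0 (tlin b0 (b1 i))"
      by (simp add: \<rho>_def tlin_diff tlin_single)
    also have "\<dots> \<in> TI" by (intro TI_add TI_diff[OF 3 2] 1)
    finally show ?thesis using \<rho>s by (simp add: syz_iff)
  qed
  moreover have "w - tlin \<rho> w \<in> TI" if w: "w \<in> syz" for w
  proof -
    have "tlin b1 w \<in> TI" using w unfolding syz_iff by simp
    then have "tlin c2 w + tlin h1 (tlin b1 w) \<in> TI" by (rule TI_add[OF k3[OF w] TI_tlin])
    moreover have "tlin \<rho> w = w - tlin c2 w - tlin h1 (tlin b1 w)"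
      unfolding \<rho>_def[abs_def] by (simp only: tlin_diff_left tlin_single_one tlin_tlin)
    ultimately show ?thesis by (simp add: add.commute)
  qed
  ultimately show ?thesis by blast
qed

end

context minimal_homogeneous_relations
begin

text \<open>
  A graded Nakayama argument. Modulo \<open>I\<close>, \<open>w = \<Sum> w\<^sub>j \<rho>\<^sub>j\<close> with \<open>w\<^sub>j \<in> T\<^sub>+\<close> and syzygies \<open>\<rho>\<^sub>j\<close>. If the parts of degree
  below \<open>N\<close> of all coordinates of all syzygies lie in \<open>I\<close>, the same follows for degree \<open>N\<close>.
\<close>

lemma syz_trivial_of_retraction:
  assumes \<rho>: "\<And>i. i < m \<Longrightarrow> \<rho> i \<in> syz" "\<And>w. w \<in> syz \<Longrightarrow> w - tlin \<rho> w \<in> TI" and w: "w \<in> syz"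
  shows "w \<in> TI"
proof -
  have "\<forall>w\<in>syz. \<forall>i. \<forall>e<N. hom_part e (lookup w i) \<in> I" for N
  proof (induction N)
    case (Suc N)
    show ?case
    proof (intro ballI allI impI)
      fix w i e assume w: "w \<in> syz" and e: "e < Suc N"
      have ks: "keys w \<subseteq> {..<m}" using w by (simp add: syz_def)
      have "hom_part e (lookup w j * lookup (\<rho> j) i) \<in> I"
        if j: "j \<in> keys w" for j
        unfolding hom_part_mult
      proof (rule I_sum)
        fix a assume a: "a \<in> {..e}"
        show "hom_part a (lookup w j) * hom_part (e - a) (lookup (\<rho> j) i) \<in> I"
        proof (cases "a = 0")
          case True
          then show ?thesis by (simp add: hom_part_0 syz_const[OF w])
        next
          case False
          have "\<rho> j \<in> syz" using j ks by (intro \<rho>(1)) auto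
          moreover have "e - a < N" using False e a by auto
          ultimately show ?thesis using Suc.IH by (intro I_lmult) blast
        qed
      qed
      then have "hom_part e (lookup (tlin \<rho> w) i) \<in> I"
        unfolding lookup_tlin hom_part_sum by (intro I_sum)
      moreover have "hom_part e (lookup (w - tlin \<rho> w) i) \<in> I"
        using \<rho>(2)[OF w] by (intro I_hom_part) (simp add: TI_def)
      ultimately have "hom_part e (lookup (w - tlin \<rho> w) i) + hom_part e (lookup (tlin \<rho> w) i) \<in> I"
        by (intro I_add)
      then show "hom_part e (lookup w i) \<in> I" by (simp add: lookup_minus hom_part_diff)
    qed
  qed simp
  then have hp: "hom_part e (lookup w i) \<in> I" for e i using w by (metis lessI)
  have "lookup w i \<in> I" for i
  proof -
    have "(\<Sum>e\<le>free_deg (lookup w i). hom_part e (lookup w i)) \<in> I"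
      by (intro I_sum hp)
    then show ?thesis by (simp only: sum_hom_part[OF free_deg_le])
  qed
  then show ?thesis by (simp add: TI_def)
qed

lemma decomposable_of_global_dim:
  assumes gd: "\<not> global_dim (quot_algebra m r) \<ge> 3" and w: "w \<in> syz"
  shows "w \<in> decomposable"
proof -
  have "proj_dim A.Q Kfun \<le> global_dim A.Q"
    unfolding global_dim_def using one_dim_left_module[OF Kfun_one_dim] by (intro SUP_upper) simp
  then have "proj_dim A.Q Kfun < 3" using gd unfolding Q_eq by simp
  then obtain n where n: "has_projective_resolution A.Q Kfun n" "enat n < 3"
    unfolding proj_dim_def INF_less_iff by blast
  have "n < 3" using n(2) by (simp add: numeral_eq_enat)
  from syzygy_retraction[OF n(1) this] obtain \<rho> where
    "\<And>i. i < m \<Longrightarrow> \<rho> i \<in> syz" "\<And>w. w \<in> syz \<Longrightarrow> w - tlin \<rho> w \<in> TI" by blast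
  then have "w \<in> TI" using w by (rule syz_trivial_of_retraction)
  then have "w \<in> tupI {..<m}" using w by (simp add: tupI_iff syz_iff)
  then show ?thesis by (rule decomposable.tupI)
qed

text \<open>
  If the global dimension is less than 3, all syzygies are decomposable. Otherwise an indecomposable
  syzygy of degree \<open>n\<close> would give \<open>n\<close> as one of the degrees whose supremum is \<open>c + 1\<close>, or 0 if \<open>c = 0\<close>.
\<close>

lemma decomposable_above_complexity:
  assumes c: "complexity (quot_algebra m r) comp = enat c" and n: "n > c + 1"
    and w: "w \<in> syz" "tuple_part d n w = w"
  shows "w \<in> decomposable"
proof (rule ccontr)
  assume nd: "w \<notin> decomposable"
  then have "global_dim (quot_algebra m r) \<ge> 3" using decomposable_of_global_dim w(1) by blast
  then have c': "(SUP n \<in> {n. ext_nonzero (quot_algebra m r) comp 3 n}. enat n) - 1 = enat c" (is "?S - 1 = _")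
    using c by (simp add: complexity_def)
  have "ext_nonzero (quot_algebra m r) comp 3 n" by (rule ext_nonzero_of_indecomposable[OF w nd])
  then have le: "enat n \<le> ?S" by (intro SUP_upper) simp
  show False
  proof (cases ?S)
    case (enat s)
    then have "s - 1 = c" "n \<le> s" using c' le by (simp_all add: one_enat_def)
    then show False using n by simp
  next
    case infinity
    then show False using c' by simp
  qed
qed

end

theorem theorem1p5:
  fixes r l :: "nat \<Rightarrow> ('x::finite, 'k::field) free_algebra" and m c :: nat
  assumes relations_homogeneous: "\<And>i. i < m \<Longrightarrow> \<exists>d \<ge> 2. r i \<in> free_comp d"
    and relations_minimal: "minimal_relations m r"
    and deformation: "\<And>i. i < m \<Longrightarrow> free_deg (l i) < free_deg (r i)"
    and finite_complexity: "complexity (quot_algebra m r) (quot_algebra_comp m r) = enat c"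
  shows "regular_element (central_ext m r l) (central_ext_z m r l) \<longleftrightarrow>
         not_zero_divisor_upto (central_ext m r l) (central_ext_comp m r l) c (central_ext_z m r l)"
proof -
  define d where "d i = free_deg (r i)" for i
  have nz: "r i \<noteq> 0" if "i < m" for i
    using deformation[OF that] by (auto simp: free_deg_def)
  have hom: "r i \<in> free_comp (d i) \<and> 2 \<le> d i" if i: "i < m" for i
  proof -
    obtain e where "e \<ge> 2" "r i \<in> free_comp e" using relations_homogeneous[OF i] by blast
    then show ?thesis using free_deg_homog[of "r i" e] nz[OF i] by (simp add: d_def)
  qed
  have l: "l i \<in> free_le (d i - 1)" if "i < m" for i
    using deformation[OF that] by (intro free_le_mono[OF free_deg_le]) (simp add: d_def)
  interpret minimal_homogeneous_relations m r d
    by unfold_locales (use hom relations_minimal in auto)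
  interpret deformed_relations m r d l
    by unfold_locales (use l nz in auto)
  have "(\<forall>k. reg k) \<longleftrightarrow> (\<forall>k\<le>c. reg k)"
    using reg_all[of c] decomposable_above_complexity[OF finite_complexity] by blast
  then show ?thesis by (simp only: regular_element_iff not_zero_divisor_upto_iff)
qed

end
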